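(* Let $F$ be a one component inner function with $F(0)=0$ which is not a rotation. If the Lebesgue measure has finite entropy with respect to $F$, i.e. $$\int_{\partial\mathbb{D}}\log|F'(z)|\,dm<\infty,$$ then for every $x\in\partial\mathbb{D}$ and every Borel set $B\subset\partial\mathbb{D}$ with $m(\partial B)=0$, $$\frac1T\int_0^T\frac{n(x,t,B)}{e^t}\,dt\ \sim\ \frac{1}{\int_{\partial\mathbb{D}}\log|F'(z)|\,dm}\cdot m(B)\qquad\text{as }T\to\infty.$$
   Context: $m=d\theta/2\pi$ is the normalized Lebesgue measure on $\partial\mathbb{D}$. An inner function is a holomorphic map $F:\mathbb{D}\to\mathbb{D}$ whose radial boundary values exist and are unimodular a.e. on $\partial\mathbb{D}$. It is a one component inner function if $\{z\in\mathbb{D}:|F(z)|<c\}$ is connected for some $c\in(0,1)$. Let $\Sigma\subset\partial\mathbb{D}$ be the closed set of points near which $F$ has no analytic extension; for a one component inner function $\Sigma$ has measure zero and is exactly the set of points where the radial limit fails to exist or is not unimodular, so $F$ is a map $\partial\mathbb{D}\setminus\Sigma\to\partial\mathbb{D}$ and iterates are considered where defined. For $x\in\partial\mathbb{D}$, $T>0$ and a Borel set $B\subset\partial\mathbb{D}$, $$n(x,T,B)=\#\{(n,y):n\ge0,\ y\in B,\ F^{\circ n}(y)=x,\ \log|(F^{\circ n})'(y)|<T\}.$$ $\partial B$ is the boundary of $B$ in $\partial\mathbb{D}$. The notation $a(T)\sim c$ means $a(T)\to c$ (also when $c=0$). *)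

theory Defs
  imports "HOL-Complex_Analysis.Complex_Analysis"
begin

text \<open>
  Inner functions are represented by total functions on the complex plane. Only the values on the
  open unit disk matter: everything on the circle is derived from them by radial limits or by
  analytic extension.
\<close>

definition circle_measure :: "complex measure" where
  "circle_measure = distr (uniform_measure lborel {0..2 * pi}) borel cis"

definition inner_function :: "(complex \<Rightarrow> complex) \<Rightarrow> bool" where
  "inner_function F \<longleftrightarrow>
     F holomorphic_on ball 0 1 \<and> F ` ball 0 1 \<subseteq> ball 0 1 \<and>
     (AE z in circle_measure.
        \<exists>w. norm w = 1 \<and> ((\<lambda>r::real. F (of_real r * z)) \<longlongrightarrow> w) (at_left 1))"

definition one_component_inner_function :: "(complex \<Rightarrow> complex) \<Rightarrow> bool" where
  "one_component_inner_function F \<longleftrightarrow>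
     inner_function F \<and> (\<exists>c::real. 0 < c \<and> c < 1 \<and> connected {z \<in> ball 0 1. norm (F z) < c})"

definition is_rotation :: "(complex \<Rightarrow> complex) \<Rightarrow> bool" where
  "is_rotation F \<longleftrightarrow> (\<exists>c. norm c = 1 \<and> (\<forall>z\<in>ball 0 1. F z = c * z))"

definition analytic_extension_at ::
    "(complex \<Rightarrow> complex) \<Rightarrow> complex \<Rightarrow> (complex \<Rightarrow> complex) \<Rightarrow> bool" where
  "analytic_extension_at F z g \<longleftrightarrow>
     g analytic_on {z} \<and> (\<forall>\<^sub>F w in at z within ball 0 1. g w = F w)"

definition singular_set :: "(complex \<Rightarrow> complex) \<Rightarrow> complex set" where
  "singular_set F = {z \<in> sphere 0 1. \<nexists>g. analytic_extension_at F z g}"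

definition boundary_map :: "(complex \<Rightarrow> complex) \<Rightarrow> complex \<Rightarrow> complex" where
  "boundary_map F z = Lim (at_left 1) (\<lambda>r::real. F (of_real r * z))"

text \<open>
  For z on the circle, all analytic extensions at z have the same derivative there, so the
  description below is proper off the singular set. On the singular set it is a fixed unspecified
  constant (the set of candidates is empty), hence harmless for measurability and integrals.
\<close>

definition boundary_deriv :: "(complex \<Rightarrow> complex) \<Rightarrow> complex \<Rightarrow> complex" where
  "boundary_deriv F z = (THE d. \<exists>g. analytic_extension_at F z g \<and> d = deriv g z)"

text \<open>
  The condition on k says that the n-th iterate of the boundary map is defined at y. The iterate
  of F on the disk then extends analytically to a neighbourhood of y, and its derivative there
  is meant. The count takes values in the extended nonnegative reals,
  so that an infinite set would count as infinity.
\<close>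

definition preimage_count ::
    "(complex \<Rightarrow> complex) \<Rightarrow> complex \<Rightarrow> real \<Rightarrow> complex set \<Rightarrow> ennreal" where
  "preimage_count F x T B =
     emeasure (count_space UNIV)
       {(n::nat, y). y \<in> B \<and> (\<forall>k<n. (boundary_map F ^^ k) y \<notin> singular_set F) \<and>
          (boundary_map F ^^ n) y = x \<and> ln (norm (boundary_deriv (F ^^ n) y)) < T}"

end

theory Submission
  imports Defs "HOL-Probability.Probability"
begin

text \<open>
  Write f for the boundary map, \<phi> = log |f'|, S n y for the sum of \<phi> along the first n points of the
  orbit of y, so that |(f^n)'(y)| = exp (S n y), and h for the integral of \<phi>.

  \<^emph>\<open>The count is an expectation.\<close> Since F 0 = 0, the weights 1/|f'(y)| over a fibre f y = x add up
  to 1 (\<open>fibre_has_sum\<close>). Choosing preimages with these probabilities gives a random backward walk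
  from x; after n steps it sits at y with probability exp (- S n y) (\<open>pmf_P\<close>). A pair (n, y)
  contributes to the integral of n(x,t,B) exp (- t) over 0 < t < T exactly
  exp (- S) (1 - exp (S - T)) if S < T and 0 otherwise. Hence this integral is the sum over n of the
  expectations of 1_B(y) (1 - exp (S n y - T)) restricted to S n y < T (\<open>counting_integral\<close>).
  If S n y / n tends to h in probability and the law of the n-th point tends to m, the n-th expectation
  is close to m(B) as long as n < T/h and close to 0 afterwards; as \<phi> is bounded below by a
  positive constant, only O(T) terms are nonzero. So the sum is asymptotic to T m(B)/h
  (\<open>renewal_limit\<close>). The average over t is what makes a law of large numbers sufficient.

  \<^emph>\<open>Both limit laws hold from every starting point x.\<close> The expectation of the Poisson kernel P_z under
  n backward steps is the Poisson kernel of F^n z at x, and F^n z tends to 0. This gives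
  equidistribution, uniformly in x (\<open>equidistribution_upper\<close>). For a continuous function of mean zero
  the law of large numbers follows by writing it, up to a small error, as g - L g with L the averaging
  operator of the walk; the sum of g - L g along the walk is a martingale with bounded increments up
  to boundary terms. The function \<phi> is unbounded, and its large values must be
  negligible uniformly in x (\<open>transfer_tail\<close>).

  \<^emph>\<open>The geometry behind this.\<close> Let \<Omega> be the connected set where |F| < c, and \<delta> y the distance from
  y to \<Omega>. It contains 0, so if it comes within s of y it joins that neighbourhood to 0 and partly shields the
  circle near y. A maximum principle for a product of four rotated copies turns this into the bound
  |F((1 - r) y)| \<le> c1 < 1 for all r between 9 s and 1/5 (\<open>small_above_sublevel\<close>). Where
  \<delta> y > 0, F extends across the circle by reflection (\<open>reflection_extension\<close>), so the singular set is
  the set where \<delta> vanishes and |f'| is at most a constant times 1/\<delta>. The estimate above gives the rest: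
  the singular set has measure zero; |f'| is at least a constant times 1/\<delta>; and, since the Poisson kernels P_{F z}(x) are bounded at such points
  z = (1 - r) y, the weights of a fibre near the singular set are dominated, on the scale of \<delta>, by a
  constant times Lebesgue measure, independently of x. So no mass of the fibre is lost, and the
  tail of \<phi> under the walk is dominated by its tail under m, which is small by finite entropy.
\<close>

section \<open>Random backward walks\<close>

text \<open>
  A step from x chooses one of its preimages under f. So the whole walk can be read off from its last
  point y, and sums along the walk are Birkhoff sums of f at y.
\<close>

locale backward_chain =
  fixes K :: "'a \<Rightarrow> 'a pmf" and S :: "'a set" and f :: "'a \<Rightarrow> 'a"
  assumes K_in: "x \<in> S \<Longrightarrow> y \<in> set_pmf (K x) \<Longrightarrow> y \<in> S"
    and f_K: "x \<in> S \<Longrightarrow> y \<in> set_pmf (K x) \<Longrightarrow> f y = x"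
begin

primrec P :: "nat \<Rightarrow> 'a \<Rightarrow> 'a pmf" where
  "P 0 x = return_pmf x"
| "P (Suc n) x = bind_pmf (K x) (P n)"

lemma P_support: "x \<in> S \<Longrightarrow> y \<in> set_pmf (P n x) \<Longrightarrow> y \<in> S \<and> (f ^^ n) y = x \<and> (\<forall>k. (f ^^ k) y \<in> S \<or> k > n)"
proof (induction n arbitrary: x)
  case (Suc n)
  then obtain u where u: "u \<in> set_pmf (K x)" "y \<in> set_pmf (P n u)" by auto
  then have uS: "u \<in> S" "f u = x" using K_in f_K Suc.prems by auto
  have y: "y \<in> S" "(f ^^ n) y = u" "\<And>k. (f ^^ k) y \<in> S \<or> k > n" using Suc.IH[OF uS(1) u(2)] by auto
  have "(f ^^ k) y \<in> S \<or> k > Suc n" for k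
    using y uS Suc.prems(1) by (cases "k = Suc n") (auto, metis Suc_lessI y(3))
  then show ?case using y uS by simp
qed auto

definition L :: "('a \<Rightarrow> real) \<Rightarrow> 'a \<Rightarrow> real" where
  "L g x = measure_pmf.expectation (K x) g"

definition birkhoff :: "('a \<Rightarrow> real) \<Rightarrow> nat \<Rightarrow> 'a \<Rightarrow> real" where
  "birkhoff g n y = (\<Sum>k<n. g ((f ^^ k) y))"

lemma integrable_K:
  assumes "x \<in> S" "\<forall>y\<in>S. \<bar>g y\<bar> \<le> B"
  shows "integrable (measure_pmf (K x)) (g :: 'a \<Rightarrow> real)"
  using assms K_in by (intro measure_pmf.integrable_const_bound[where B=B]) (auto simp: AE_measure_pmf_iff)

lemma L_bound:
  assumes x: "x \<in> S" and g: "\<forall>y\<in>S. \<bar>g y\<bar> \<le> B"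
  shows "\<bar>L g x\<bar> \<le> B"
proof -
  have "\<bar>L g x\<bar> \<le> measure_pmf.expectation (K x) (\<lambda>y. \<bar>g y\<bar>)"
    unfolding L_def by (rule integral_abs_bound)
  also have "\<dots> \<le> measure_pmf.expectation (K x) (\<lambda>y. B)"
    using integrable_K[OF x, of "\<lambda>y. \<bar>g y\<bar>" B] g K_in[OF x]
    by (intro integral_mono_AE) (auto simp: AE_measure_pmf_iff)
  finally show ?thesis by simp
qed

lemma L_power_bound:
  assumes "x \<in> S" "\<forall>y\<in>S. \<bar>g y\<bar> \<le> B"
  shows "\<bar>(L ^^ n) g x\<bar> \<le> B"
  using assms(1)
proof (induction n arbitrary: x)
  case (Suc n)
  then show ?case using L_bound[OF Suc.prems, of "(L ^^ n) g"] by simp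
qed (use assms(2) in simp)

text \<open>
  Shifting by the bound B makes all integrands nonnegative, where the integral over a bind of
  distributions is available without integrability conditions.
\<close>

lemma expectation_P:
  assumes "x \<in> S" "\<forall>y\<in>S. \<bar>g y\<bar> \<le> B"
  shows "measure_pmf.expectation (P n x) g = (L ^^ n) g x"
  using assms(1)
proof (induction n arbitrary: x)
  case (Suc n)
  have LB: "\<forall>y\<in>S. \<bar>(L ^^ n) g y\<bar> \<le> B" using L_power_bound assms(2) by blast
  have gP: "\<bar>g y\<bar> \<le> B" if "y \<in> set_pmf (P m u)" "u \<in> S" for y m u using P_support[OF that(2,1)] assms(2) by auto
  have int: "integrable (measure_pmf (P m u)) g" if "u \<in> S" for m u
    using gP[OF _ that] by (intro measure_pmf.integrable_const_bound[where B=B]) (auto simp: AE_measure_pmf_iff)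
  define h where "h = (\<lambda>y. B + g y)"
  have h: "h y \<ge> 0" if "y \<in> set_pmf (P m u)" "u \<in> S" for y m u using gP[OF that] by (auto simp: h_def)
  have Eh: "(\<integral>\<^sup>+y. ennreal (h y) \<partial>P m u) = ennreal (B + measure_pmf.expectation (P m u) g)" if "u \<in> S" for m u
  proof -
    have "(\<integral>\<^sup>+y. ennreal (h y) \<partial>P m u) = ennreal (measure_pmf.expectation (P m u) h)"
      using int[OF that] h[OF _ that] by (intro nn_integral_eq_integral) (auto simp: AE_measure_pmf_iff h_def)
    then show ?thesis using int[OF that] by (simp add: h_def)
  qed
  have nonneg: "B + (L ^^ n) g u \<ge> 0" if "u \<in> S" for u
    using L_power_bound[OF that assms(2), of n] by auto
  have "ennreal (B + measure_pmf.expectation (P (Suc n) x) g) = (\<integral>\<^sup>+u. (\<integral>\<^sup>+y. ennreal (h y) \<partial>P n u) \<partial>K x)"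
    using Eh[OF Suc.prems, of "Suc n"] by simp
  also have "\<dots> = (\<integral>\<^sup>+u. ennreal (B + (L ^^ n) g u) \<partial>K x)"
    using Suc.prems by (intro nn_integral_cong_AE) (auto simp: AE_measure_pmf_iff Eh Suc.IH dest: K_in)
  also have "\<dots> = ennreal (measure_pmf.expectation (K x) (\<lambda>u. B + (L ^^ n) g u))"
    using nonneg Suc.prems integrable_K[OF Suc.prems LB] K_in[OF Suc.prems]
    by (intro nn_integral_eq_integral) (auto simp: AE_measure_pmf_iff)
  also have "measure_pmf.expectation (K x) (\<lambda>u. B + (L ^^ n) g u) = B + (L ^^ Suc n) g x"
    using integrable_K[OF Suc.prems LB] by (simp add: L_def)
  finally have "ennreal (B + measure_pmf.expectation (P (Suc n) x) g) = ennreal (B + (L ^^ Suc n) g x)" .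
  moreover have "B + measure_pmf.expectation (P (Suc n) x) g \<ge> 0"
  proof -
    have "0 \<le> measure_pmf.expectation (P (Suc n) x) h"
      using h[OF _ Suc.prems, of _ "Suc n"] by (intro integral_nonneg_AE) (simp add: AE_measure_pmf_iff)
    then show ?thesis using int[OF Suc.prems, of "Suc n"] by (simp add: h_def)
  qed
  moreover have "B + (L ^^ Suc n) g x \<ge> 0" using L_power_bound[OF Suc.prems assms(2), of "Suc n"] by auto
  ultimately show ?case by (simp add: ennreal_inj)
qed simp

definition martingale :: "('a \<Rightarrow> real) \<Rightarrow> nat \<Rightarrow> 'a \<Rightarrow> real" where
  "martingale g n y = (\<Sum>k<n. g ((f ^^ k) y) - L g ((f ^^ Suc k) y))"

text \<open>
  The increment of the first step has mean zero and is bounded by 2 B. Given its outcome, the other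
  steps form a walk of length n from the new starting point, with the constant a changed by the
  increment; hence the induction with a arbitrary.
\<close>

lemma martingale_square:
  assumes g: "\<forall>y\<in>S. \<bar>g y\<bar> \<le> B" and x: "x \<in> S"
  shows "(\<integral>\<^sup>+y. ennreal ((a + martingale g n y)\<^sup>2) \<partial>P n x) \<le> ennreal (a\<^sup>2 + real n * (2 * B)\<^sup>2)"
  using x
proof (induction n arbitrary: x a)
  case (Suc n)
  define d where "d = (\<lambda>u. g u - L g x)"
  have dB: "\<bar>d u\<bar> \<le> 2 * B" if "u \<in> S" for u using bspec[OF g that] L_bound[OF Suc.prems g] unfolding d_def by linarith
  have int: "integrable (measure_pmf (K x)) d" "integrable (measure_pmf (K x)) (\<lambda>u. (d u)\<^sup>2)"
  proof -
    show "integrable (measure_pmf (K x)) d" by (rule integrable_K[OF Suc.prems]) (use dB in blast)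
    show "integrable (measure_pmf (K x)) (\<lambda>u. (d u)\<^sup>2)"
    proof (rule integrable_K[OF Suc.prems], rule ballI)
      show "\<bar>(d u)\<^sup>2\<bar> \<le> (2 * B)\<^sup>2" if "u \<in> S" for u using power_mono[OF dB[OF that], of 2] by simp
    qed
  qed
  have Ed: "measure_pmf.expectation (K x) d = 0"
    using integrable_K[OF Suc.prems g] by (simp add: d_def L_def)
  have Ed2: "measure_pmf.expectation (K x) (\<lambda>u. (d u)\<^sup>2) \<le> (2 * B)\<^sup>2"
  proof -
    have "measure_pmf.expectation (K x) (\<lambda>u. (d u)\<^sup>2) \<le> measure_pmf.expectation (K x) (\<lambda>u. (2 * B)\<^sup>2)"
    proof (rule integral_mono_AE[OF int(2)])
      show "AE u in K x. (d u)\<^sup>2 \<le> (2 * B)\<^sup>2"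
      proof (subst AE_measure_pmf_iff, rule ballI)
        fix u assume "u \<in> set_pmf (K x)"
        from power_mono[OF dB[OF K_in[OF Suc.prems this]], of 2] show "(d u)\<^sup>2 \<le> (2 * B)\<^sup>2" by simp
      qed
    qed simp
    then show ?thesis by simp
  qed
  have "(\<integral>\<^sup>+y. ennreal ((a + martingale g (Suc n) y)\<^sup>2) \<partial>P (Suc n) x)
      = (\<integral>\<^sup>+u. (\<integral>\<^sup>+y. ennreal ((a + martingale g (Suc n) y)\<^sup>2) \<partial>P n u) \<partial>K x)" by simp
  also have "\<dots> = (\<integral>\<^sup>+u. (\<integral>\<^sup>+y. ennreal (((a + d u) + martingale g n y)\<^sup>2) \<partial>P n u) \<partial>K x)"
  proof (rule nn_integral_cong_AE, subst AE_measure_pmf_iff, intro ballI, rule nn_integral_cong_AE, subst AE_measure_pmf_iff, intro ballI)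
    fix u y assume u: "u \<in> set_pmf (K x)" and y: "y \<in> set_pmf (P n u)"
    have "(f ^^ n) y = u" using P_support[OF K_in[OF Suc.prems u] y] by simp
    then have "martingale g (Suc n) y = d u + martingale g n y"
      using f_K[OF Suc.prems u] by (simp add: martingale_def d_def)
    then show "ennreal ((a + martingale g (Suc n) y)\<^sup>2) = ennreal ((a + d u + martingale g n y)\<^sup>2)"
      by (simp add: add.assoc)
  qed
  also have "\<dots> \<le> (\<integral>\<^sup>+u. ennreal ((a + d u)\<^sup>2 + real n * (2 * B)\<^sup>2) \<partial>K x)"
    using Suc.IH K_in[OF Suc.prems] by (intro nn_integral_mono_AE) (auto simp: AE_measure_pmf_iff)
  also have "\<dots> = ennreal (measure_pmf.expectation (K x) (\<lambda>u. (a + d u)\<^sup>2 + real n * (2 * B)\<^sup>2))"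
  proof (intro nn_integral_eq_integral AE_I2)
    show "integrable (measure_pmf (K x)) (\<lambda>u. (a + d u)\<^sup>2 + real n * (2 * B)\<^sup>2)"
      using int by (simp add: power2_sum)
  qed simp
  also have "measure_pmf.expectation (K x) (\<lambda>u. (a + d u)\<^sup>2 + real n * (2 * B)\<^sup>2)
      = a\<^sup>2 + measure_pmf.expectation (K x) (\<lambda>u. (d u)\<^sup>2) + real n * (2 * B)\<^sup>2"
    using int Ed by (simp add: power2_sum)
  also have "ennreal \<dots> \<le> ennreal (a\<^sup>2 + real (Suc n) * (2 * B)\<^sup>2)"
    using Ed2 by (intro ennreal_leI) (simp add: algebra_simps)
  finally show ?case .
qed (simp add: martingale_def)

text \<open>
  With g the sum of L^j \<psi> over j < N one has \<psi> = (g - L g) + L^N \<psi>. The Birkhoff sum of g - L g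
  is the martingale up to the two boundary terms of a telescoping sum, and the second part is at
  most \<epsilon> at each step.
\<close>

lemma birkhoff_mean_le:
  assumes psi: "\<forall>y\<in>S. \<bar>\<psi> y\<bar> \<le> B" and small: "\<forall>y\<in>S. \<bar>(L ^^ N) \<psi> y\<bar> \<le> \<epsilon>" and x: "x \<in> S"
  shows "(\<integral>\<^sup>+y. ennreal \<bar>birkhoff \<psi> n y\<bar> \<partial>P n x) \<le> ennreal (sqrt (real n) * (2 * (real N * B)) + 2 * (real N * B) + real n * \<epsilon>)"
proof -
  have B: "B \<ge> 0" and \<epsilon>: "\<epsilon> \<ge> 0" using bspec[OF psi x] bspec[OF small x] by auto
  define g where "g = (\<lambda>y. \<Sum>j<N. (L ^^ j) \<psi> y)"
  define C where "C = real N * B"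
  have C: "C \<ge> 0" using B by (simp add: C_def)
  have gC: "\<forall>y\<in>S. \<bar>g y\<bar> \<le> C"
  proof
    fix y assume that: "y \<in> S"
    have "\<bar>g y\<bar> \<le> (\<Sum>j<N. \<bar>(L ^^ j) \<psi> y\<bar>)" unfolding g_def by (rule sum_abs)
    also have "\<dots> \<le> (\<Sum>j<N. B)" by (intro sum_mono L_power_bound[OF that psi])
    finally show "\<bar>g y\<bar> \<le> C" by (simp add: C_def)
  qed
  have Lg: "L g y = g y - \<psi> y + (L ^^ N) \<psi> y" if "y \<in> S" for y
  proof -
    have "L g y = (\<Sum>j<N. (L ^^ Suc j) \<psi> y)"
    proof -
      have "integrable (measure_pmf (K y)) (\<lambda>u. (L ^^ j) \<psi> u)" for j
        by (rule integrable_K[OF that]) (use L_power_bound psi in blast)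
      then show ?thesis unfolding g_def by (simp add: L_def[of _ y])
    qed
    also have "\<dots> = g y - \<psi> y + (L ^^ N) \<psi> y"
      unfolding g_def using sum.lessThan_Suc_shift[of "\<lambda>j. (L ^^ j) \<psi> y" N] by simp
    finally show ?thesis .
  qed
  have pointwise: "\<bar>birkhoff \<psi> n y\<bar> \<le> \<bar>martingale g n y\<bar> + (2 * C + real n * \<epsilon>)" if y: "y \<in> set_pmf (P n x)" for y
  proof -
    have S: "(f ^^ k) y \<in> S" if "k \<le> n" for k using P_support[OF x y] that by (metis not_le)
    have "birkhoff \<psi> n y = (\<Sum>k<n. (g ((f ^^ k) y) - L g ((f ^^ Suc k) y)) + (L g ((f ^^ Suc k) y) - L g ((f ^^ k) y)) + (L ^^ N) \<psi> ((f ^^ k) y))"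
      unfolding birkhoff_def by (intro sum.cong refl) (use S Lg in \<open>simp add: less_imp_le\<close>)
    also have "\<dots> = martingale g n y + (L g ((f ^^ n) y) - L g y) + (\<Sum>k<n. (L ^^ N) \<psi> ((f ^^ k) y))"
      unfolding sum.distrib martingale_def using sum_lessThan_telescope[of "\<lambda>k. L g ((f ^^ k) y)" n] by simp
    finally have eq: "birkhoff \<psi> n y = martingale g n y + (L g ((f ^^ n) y) - L g y) + (\<Sum>k<n. (L ^^ N) \<psi> ((f ^^ k) y))" .
    have "\<bar>\<Sum>k<n. (L ^^ N) \<psi> ((f ^^ k) y)\<bar> \<le> (\<Sum>k<n. \<bar>(L ^^ N) \<psi> ((f ^^ k) y)\<bar>)" by (rule sum_abs)
    also have "\<dots> \<le> (\<Sum>k<n. \<epsilon>)" using small S by (intro sum_mono) (auto simp: less_imp_le)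
    finally have "\<bar>\<Sum>k<n. (L ^^ N) \<psi> ((f ^^ k) y)\<bar> \<le> real n * \<epsilon>" by simp
    moreover have "\<bar>L g ((f ^^ n) y)\<bar> \<le> C" "\<bar>L g y\<bar> \<le> C" using L_bound[OF _ gC] S[of n] S[of 0] by simp_all
    ultimately show ?thesis using eq by linarith
  qed
  \<comment> \<open>Cauchy-Schwarz in the form |d| <= (d^2 / s + s) / 2 with s the bound for the standard deviation; s = 0 is the trivial case.\<close>
  have mart: "(\<integral>\<^sup>+y. ennreal \<bar>martingale g n y\<bar> \<partial>P n x) \<le> ennreal (sqrt (real n) * (2 * C))"
  proof (cases "n = 0 \<or> C = 0")
    case True
    then have "(\<integral>\<^sup>+y. ennreal ((0 + martingale g n y)\<^sup>2) \<partial>P n x) \<le> ennreal 0"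
      using martingale_square[OF gC x, where a = 0 and n = n] by auto
    then have "(\<integral>\<^sup>+y. ennreal ((martingale g n y)\<^sup>2) \<partial>P n x) = 0" by simp
    then have "AE y in P n x. ennreal ((martingale g n y)\<^sup>2) = 0"
      by (subst (asm) nn_integral_0_iff_AE) auto
    then have "AE y in P n x. ennreal \<bar>martingale g n y\<bar> = 0" by eventually_elim simp
    then have "(\<integral>\<^sup>+y. ennreal \<bar>martingale g n y\<bar> \<partial>P n x) = 0"
      by (subst nn_integral_0_iff_AE) auto
    then show ?thesis by simp
  next
    case False
    define s where "s = sqrt (real n) * (2 * C)"
    have s: "s > 0" "s\<^sup>2 = real n * (2 * C)\<^sup>2" using False C by (auto simp: s_def power_mult_distrib)
    have "ennreal \<bar>d\<bar> \<le> ennreal (1 / (2 * s)) * ennreal ((0 + d)\<^sup>2) + ennreal (s / 2)" for d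
    proof -
      have "0 \<le> (\<bar>d\<bar> - s)\<^sup>2" by simp
      then have "\<bar>d\<bar> \<le> 1 / (2 * s) * d\<^sup>2 + s / 2" using s(1) by (simp add: power2_eq_square field_simps)
      then have "ennreal \<bar>d\<bar> \<le> ennreal (1 / (2 * s) * d\<^sup>2 + s / 2)" by (rule ennreal_leI)
      also have "\<dots> = ennreal (1 / (2 * s)) * ennreal (d\<^sup>2) + ennreal (s / 2)"
        using s(1) by (subst ennreal_plus, simp, simp, subst ennreal_mult) auto
      finally show ?thesis by simp
    qed
    then have "(\<integral>\<^sup>+y. ennreal \<bar>martingale g n y\<bar> \<partial>P n x)
        \<le> (\<integral>\<^sup>+y. ennreal (1 / (2 * s)) * ennreal ((0 + martingale g n y)\<^sup>2) + ennreal (s / 2) \<partial>P n x)"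
      by (intro nn_integral_mono)
    also have "\<dots> = ennreal (1 / (2 * s)) * (\<integral>\<^sup>+y. ennreal ((0 + martingale g n y)\<^sup>2) \<partial>P n x) + ennreal (s / 2)"
      by (simp add: nn_integral_add nn_integral_cmult)
    also have "\<dots> \<le> ennreal (1 / (2 * s)) * ennreal (0\<^sup>2 + real n * (2 * C)\<^sup>2) + ennreal (s / 2)"
      by (intro add_mono mult_left_mono martingale_square gC x) auto
    also have "\<dots> = ennreal (1 / (2 * s) * s\<^sup>2 + s / 2)"
      using s(1) unfolding s(2) by (subst ennreal_plus, simp, simp, subst ennreal_mult) auto
    also have "1 / (2 * s) * s\<^sup>2 + s / 2 = s" using s(1) by (simp add: power2_eq_square)
    finally show ?thesis by (simp add: s_def)
  qed
  have "(\<integral>\<^sup>+y. ennreal \<bar>birkhoff \<psi> n y\<bar> \<partial>P n x) \<le> (\<integral>\<^sup>+y. ennreal \<bar>martingale g n y\<bar> + ennreal (2 * C + real n * \<epsilon>) \<partial>P n x)"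
  proof (rule nn_integral_mono_AE, simp add: AE_measure_pmf_iff, intro ballI)
    fix y assume "y \<in> set_pmf (P n x)"
    then have "ennreal \<bar>birkhoff \<psi> n y\<bar> \<le> ennreal (\<bar>martingale g n y\<bar> + (2 * C + real n * \<epsilon>))" by (intro ennreal_leI pointwise)
    also have "\<dots> = ennreal \<bar>martingale g n y\<bar> + ennreal (2 * C + real n * \<epsilon>)" using C \<epsilon> by (subst ennreal_plus) auto
    finally show "ennreal \<bar>birkhoff \<psi> n y\<bar> \<le> ennreal \<bar>martingale g n y\<bar> + ennreal (2 * C + real n * \<epsilon>)" .
  qed
  also have "(\<integral>\<^sup>+y. ennreal \<bar>martingale g n y\<bar> + ennreal (2 * C + real n * \<epsilon>) \<partial>P n x) = (\<integral>\<^sup>+y. ennreal \<bar>martingale g n y\<bar> \<partial>P n x) + ennreal (2 * C + real n * \<epsilon>)"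
    by (simp add: nn_integral_add)
  also have "\<dots> \<le> ennreal (sqrt (real n) * (2 * C)) + ennreal (2 * C + real n * \<epsilon>)"
    by (rule add_right_mono[OF mart])
  also have "\<dots> = ennreal (sqrt (real n) * (2 * C) + (2 * C + real n * \<epsilon>))" using C \<epsilon> by (subst ennreal_plus) auto
  finally show ?thesis by (simp add: C_def add.assoc)
qed

lemma birkhoff_nn_integral_le:
  fixes \<tau> :: "'a \<Rightarrow> ennreal"
  assumes \<tau>: "\<forall>x\<in>S. (\<integral>\<^sup>+y. \<tau> y \<partial>K x) \<le> e" and x: "x \<in> S"
  shows "(\<integral>\<^sup>+y. (\<Sum>k<n. \<tau> ((f ^^ k) y)) \<partial>P n x) \<le> of_nat n * e"
  using x
proof (induction n arbitrary: x)
  case (Suc n)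
  have "(\<integral>\<^sup>+y. (\<Sum>k<Suc n. \<tau> ((f ^^ k) y)) \<partial>P (Suc n) x)
      = (\<integral>\<^sup>+u. (\<integral>\<^sup>+y. (\<Sum>k<n. \<tau> ((f ^^ k) y)) + \<tau> ((f ^^ n) y) \<partial>P n u) \<partial>K x)" by simp
  also have "\<dots> = (\<integral>\<^sup>+u. (\<integral>\<^sup>+y. (\<Sum>k<n. \<tau> ((f ^^ k) y)) + \<tau> u \<partial>P n u) \<partial>K x)"
  proof (rule nn_integral_cong_AE, subst AE_measure_pmf_iff, intro ballI, rule nn_integral_cong_AE, subst AE_measure_pmf_iff, intro ballI)
    fix u y assume u: "u \<in> set_pmf (K x)" and y: "y \<in> set_pmf (P n u)"
    show "(\<Sum>k<n. \<tau> ((f ^^ k) y)) + \<tau> ((f ^^ n) y) = (\<Sum>k<n. \<tau> ((f ^^ k) y)) + \<tau> u"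
      using P_support[OF K_in[OF Suc.prems u] y] by simp
  qed
  also have "\<dots> = (\<integral>\<^sup>+u. (\<integral>\<^sup>+y. (\<Sum>k<n. \<tau> ((f ^^ k) y)) \<partial>P n u) + \<tau> u \<partial>K x)"
    by (simp add: nn_integral_add)
  also have "\<dots> \<le> (\<integral>\<^sup>+u. of_nat n * e + \<tau> u \<partial>K x)"
    using Suc.IH K_in[OF Suc.prems]
    by (intro nn_integral_mono_AE) (auto simp: AE_measure_pmf_iff intro!: add_right_mono)
  also have "\<dots> \<le> of_nat n * e + e"
    using \<tau> Suc.prems by (simp add: nn_integral_add add_left_mono)
  finally show ?case by (simp add: algebra_simps)
qed simp

end

section \<open>A renewal limit\<close>

lemma cesaro_null:
  fixes d :: "nat \<Rightarrow> real"
  assumes "d \<longlonglongrightarrow> 0" "\<And>n. d n \<ge> 0" and e: "e > 0"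
  obtains C where "C \<ge> 0" "\<And>N. (\<Sum>n<N. d n) \<le> C + real N * e"
proof -
  obtain n0 where n0: "\<And>n. n \<ge> n0 \<Longrightarrow> d n < e"
    using order_tendstoD(2)[OF assms(1) e] by (auto simp: eventually_sequentially)
  show ?thesis
  proof (rule that[of "\<Sum>n<n0. d n"])
    show "(\<Sum>n<N. d n) \<le> (\<Sum>n<n0. d n) + real N * e" for N
    proof -
      have "(\<Sum>n<N. d n) \<le> (\<Sum>n<N. (if n < n0 then d n else 0) + e)"
        using n0 e assms(2) by (intro sum_mono) (auto simp: not_less less_imp_le)
      also have "\<dots> = (\<Sum>n<N. (if n < n0 then d n else 0)) + real N * e" by (simp add: sum.distrib)
      also have "(\<Sum>n<N. (if n < n0 then d n else 0)) \<le> (\<Sum>n<n0. d n)"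
      proof -
        have "(\<Sum>n<N. (if n < n0 then d n else 0)) = (\<Sum>n\<in>{..<N} \<inter> {..<n0}. d n)"
          by (subst sum.inter_restrict) auto
        also have "\<dots> \<le> (\<Sum>n<n0. d n)" using assms(2) by (intro sum_mono2) auto
        finally show ?thesis .
      qed
      finally show ?thesis by simp
    qed
  qed (use assms(2) in \<open>auto intro: sum_nonneg\<close>)
qed

text \<open>
  Replacing \<alpha> n T by \<beta> if n X \<le> T and by 0 otherwise costs a null sequence in n, except in the
  window T/(X + e) < n < T/(X - e), whose length is a small multiple of T.
\<close>

lemma renewal_limit:
  fixes \<alpha> :: "nat \<Rightarrow> real \<Rightarrow> real" and \<beta> X l :: real and N :: "real \<Rightarrow> nat"
  assumes \<alpha>: "\<And>n T. 0 \<le> \<alpha> n T" "\<And>n T. \<alpha> n T \<le> 1" and \<beta>: "0 \<le> \<beta>" "\<beta> \<le> 1" and X: "X > 0" and l: "0 < l" "l \<le> X"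
    and N: "\<And>T. T \<ge> 0 \<Longrightarrow> T / l < real (N T)" "\<And>T. T \<ge> 0 \<Longrightarrow> real (N T) \<le> T / l + 1"
    and early: "\<And>e. 0 < e \<Longrightarrow> \<exists>d. d \<longlonglongrightarrow> 0 \<and> (\<forall>n T. real n * (X + e) \<le> T \<longrightarrow> \<bar>\<alpha> n T - \<beta>\<bar> \<le> d n)"
    and late: "\<And>e. 0 < e \<Longrightarrow> e < X \<Longrightarrow> \<exists>d. d \<longlonglongrightarrow> 0 \<and> (\<forall>n T. T \<le> real n * (X - e) \<longrightarrow> \<alpha> n T \<le> d n)"
  shows "((\<lambda>T. (\<Sum>n<N T. \<alpha> n T) / T) \<longlongrightarrow> \<beta> / X) at_top"
proof (rule tendstoI)
  fix \<eta> :: real assume \<eta>: "\<eta> > 0"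
  \<comment> \<open>e is chosen so that the window of transition has length at most T \<eta> / 4.\<close>
  have "((\<lambda>e. 1 / (X - e) - 1 / (X + e)) \<longlongrightarrow> 1 / (X - 0) - 1 / (X + 0)) (at_right 0)"
    using X by (intro tendsto_intros) auto
  then have "eventually (\<lambda>e. 1 / (X - e) - 1 / (X + e) < \<eta> / 4) (at_right 0)"
    using \<eta> by (intro order_tendstoD) auto
  moreover have "eventually (\<lambda>e. e \<in> {0<..<X}) (at_right (0::real))" by (rule eventually_at_right_real[OF X])
  ultimately have "eventually (\<lambda>e. e \<in> {0<..<X} \<and> 1 / (X - e) - 1 / (X + e) < \<eta> / 4) (at_right 0)"
    by eventually_elim simp
  then obtain e where e: "0 < e" "e < X" "1 / (X - e) - 1 / (X + e) < \<eta> / 4"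
    using eventually_happens'[OF trivial_limit_at_right_real] by force
  obtain d1 where d1: "d1 \<longlonglongrightarrow> 0" "\<And>n T. real n * (X + e) \<le> T \<Longrightarrow> \<bar>\<alpha> n T - \<beta>\<bar> \<le> d1 n" using early[OF e(1)] by blast
  obtain d2 where d2: "d2 \<longlonglongrightarrow> 0" "\<And>n T. T \<le> real n * (X - e) \<Longrightarrow> \<alpha> n T \<le> d2 n" using late[OF e(1,2)] by blast
  define d where "d = (\<lambda>n. \<bar>d1 n\<bar> + \<bar>d2 n\<bar>)"
  have "d \<longlonglongrightarrow> 0" unfolding d_def using tendsto_add[OF tendsto_rabs[OF d1(1)] tendsto_rabs[OF d2(1)]] by simp
  moreover have "d n \<ge> 0" for n by (simp add: d_def)
  moreover have "\<eta> * l / 8 > 0" using \<eta> l by simp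
  ultimately obtain C where C: "C \<ge> 0" "\<And>N. (\<Sum>n<N. d n) \<le> C + real N * (\<eta> * l / 8)"
    by (rule cesaro_null) auto
  have bound: "\<bar>(\<Sum>n<N T. \<alpha> n T) - T * (\<beta> / X)\<bar> \<le> (C + \<eta> * l / 8 + 2) + T * (3 / 8 * \<eta>)" if T: "T \<ge> 0" for T
  proof -
    define W where "W = {n. T / (X + e) < real n \<and> real n < T / (X - e)}"
    define V where "V = {n. real n * X \<le> T}"
    have finV: "V = {..nat \<lfloor>T / X\<rfloor>}"
    proof (intro set_eqI)
      fix n
      have "n \<in> V \<longleftrightarrow> real n \<le> T / X" using X by (simp add: V_def le_divide_eq)
      also have "\<dots> \<longleftrightarrow> n \<le> nat \<lfloor>T / X\<rfloor>" using X T by (simp add: le_nat_iff le_floor_iff)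
      finally show "n \<in> V \<longleftrightarrow> n \<in> {..nat \<lfloor>T / X\<rfloor>}" by simp
    qed
    have cardV: "T / X \<le> real (card V)" "real (card V) \<le> T / X + 1"
      using X T unfolding finV by (simp_all, linarith+)
    have VN: "V \<subseteq> {..<N T}"
    proof
      fix n assume "n \<in> V"
      then have "real n \<le> T / X" using X by (simp add: V_def le_divide_eq)
      also have "\<dots> \<le> T / l" using l T by (intro divide_left_mono) auto
      also have "\<dots> < real (N T)" by (rule N(1)[OF T])
      finally show "n \<in> {..<N T}" by simp
    qed
    have cardW: "finite W \<and> real (card W) \<le> T * (\<eta> / 4) + 1"
    proof -
      define a where "a = nat \<lfloor>T / (X + e)\<rfloor>"
      define b where "b = nat \<lceil>T / (X - e)\<rceil>"
      have pos: "0 \<le> T / (X + e)" "0 \<le> T / (X - e)" using T X e by auto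
      have sub: "W \<subseteq> {a<..<b}"
      proof
        fix n assume "n \<in> W"
        then have "T / (X + e) < real n" "real n < T / (X - e)" by (auto simp: W_def)
        then show "n \<in> {a<..<b}" unfolding a_def b_def greaterThanLessThan_iff using pos by linarith
      qed
      then have "finite W" by (rule finite_subset) simp
      have "card W \<le> card {a<..<b}" using sub by (intro card_mono) auto
      then have "real (card W) \<le> real (b - Suc a)" by simp
      also have "\<dots> \<le> T / (X - e) - T / (X + e) + 1"
      proof -
        have "T / (X + e) \<le> T / (X - e)" using T e X by (intro divide_left_mono) auto
        then show ?thesis unfolding a_def b_def using pos by linarith
      qed
      also have "T / (X - e) - T / (X + e) = T * (1 / (X - e) - 1 / (X + e))" by (simp add: right_diff_distrib)
      also have "\<dots> \<le> T * (\<eta> / 4)" using e(3) T by (intro mult_left_mono) auto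
      finally show ?thesis using \<open>finite W\<close> by simp
    qed
    have ind: "(\<Sum>n<m. indicator A n) = real (card ({..<m} \<inter> A))" for m :: nat and A
      unfolding indicator_def by (subst sum_of_bool_eq) auto
    have termwise: "\<bar>\<alpha> n T - \<beta> * indicator V n\<bar> \<le> d n + indicator W n" for n
    proof -
      consider "real n * (X + e) \<le> T" | "T \<le> real n * (X - e)" "\<not> real n * (X + e) \<le> T" | "n \<in> W"
        using e X by (force simp: W_def pos_divide_less_eq pos_less_divide_eq not_le)
      then show ?thesis
      proof cases
        case 1
        have "real n * X \<le> real n * (X + e)" using e by (intro mult_left_mono) auto
        then have "n \<in> V" using 1 by (simp add: V_def)
        then have "\<bar>\<alpha> n T - \<beta> * indicator V n\<bar> \<le> d n" using d1(2)[OF 1] by (simp add: d_def)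
        then show ?thesis by (rule add_increasing2[rotated]) simp
      next
        case 2
        show ?thesis
        proof (cases "n \<in> V")
          case True
          then have "real n * X \<le> real n * (X - e)" using 2 by (simp add: V_def)
          then have "real n * e \<le> 0" by (simp add: algebra_simps)
          then have "n = 0" using e by (simp add: mult_le_0_iff)
          then have "\<not> real n * (X + e) \<le> T" using 2 by simp
          then show ?thesis using \<open>n = 0\<close> T by simp
        next
          case False
          then have "\<bar>\<alpha> n T - \<beta> * indicator V n\<bar> \<le> d n" using d2(2)[OF 2(1)] \<alpha>(1)[of n T] by (simp add: d_def)
          then show ?thesis by (rule add_increasing2[rotated]) simp
        qed
      next
        case 3
        have "\<bar>\<alpha> n T - \<beta> * indicator V n\<bar> \<le> 1" using \<alpha>[of n T] \<beta> by (auto simp: indicator_def)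
        then show ?thesis using 3 by (simp add: d_def)
      qed
    qed
    have "\<bar>(\<Sum>n<N T. \<alpha> n T) - (\<Sum>n<N T. \<beta> * indicator V n)\<bar> \<le> (\<Sum>n<N T. \<bar>\<alpha> n T - \<beta> * indicator V n\<bar>)"
      unfolding sum_subtractf[symmetric] by (rule sum_abs)
    also have "\<dots> \<le> (\<Sum>n<N T. d n + indicator W n)" by (intro sum_mono termwise)
    also have "\<dots> = (\<Sum>n<N T. d n) + real (card ({..<N T} \<inter> W))" by (simp add: sum.distrib ind)
    also have "\<dots> \<le> (C + real (N T) * (\<eta> * l / 8)) + (T * (\<eta> / 4) + 1)"
    proof (rule add_mono[OF C(2)])
      have "card ({..<N T} \<inter> W) \<le> card W" using cardW by (intro card_mono) auto
      then show "real (card ({..<N T} \<inter> W)) \<le> T * (\<eta> / 4) + 1" using cardW by linarith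
    qed
    also have "real (N T) * (\<eta> * l / 8) \<le> (T / l + 1) * (\<eta> * l / 8)"
      using N(2)[OF T] \<eta> l by (intro mult_right_mono) auto
    also have "(T / l + 1) * (\<eta> * l / 8) = T * (\<eta> / 8) + \<eta> * l / 8" using l by (simp add: field_simps)
    finally have 1: "\<bar>(\<Sum>n<N T. \<alpha> n T) - (\<Sum>n<N T. \<beta> * indicator V n)\<bar> \<le> (C + (T * (\<eta> / 8) + \<eta> * l / 8)) + (T * (\<eta> / 4) + 1)" by simp
    have "(\<Sum>n<N T. \<beta> * indicator V n) = \<beta> * real (card V)"
    proof -
      have "{..<N T} \<inter> V = V" using VN by auto
      then show ?thesis by (simp add: sum_distrib_left[symmetric] ind)
    qed
    moreover have "\<bar>\<beta> * real (card V) - T * (\<beta> / X)\<bar> \<le> 1"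
    proof -
      have "\<beta> * real (card V) - T * (\<beta> / X) = \<beta> * (real (card V) - T / X)" by (simp add: algebra_simps)
      also have "\<bar>\<dots>\<bar> \<le> 1 * 1" unfolding abs_mult using \<beta> cardV by (intro mult_mono) auto
      finally show ?thesis by simp
    qed
    ultimately have "\<bar>(\<Sum>n<N T. \<alpha> n T) - T * (\<beta> / X)\<bar> \<le> (C + (T * (\<eta> / 8) + \<eta> * l / 8)) + (T * (\<eta> / 4) + 1) + 1"
      using 1 by linarith
    then show ?thesis by (simp add: algebra_simps)
  qed
  define D where "D = C + \<eta> * l / 8 + 2"
  have "((\<lambda>T. D / T + 3 / 8 * \<eta>) \<longlongrightarrow> 0 + 3 / 8 * \<eta>) at_top"
    by (intro tendsto_add tendsto_const real_tendsto_divide_at_top[OF tendsto_const filterlim_ident])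
  then have "eventually (\<lambda>T. D / T + 3 / 8 * \<eta> < \<eta>) at_top"
    by (rule order_tendstoD(2)) (use \<eta> in simp)
  then show "eventually (\<lambda>T. dist ((\<Sum>n<N T. \<alpha> n T) / T) (\<beta> / X) < \<eta>) at_top"
    using eventually_gt_at_top[of 0]
  proof eventually_elim
    case (elim T)
    have "dist ((\<Sum>n<N T. \<alpha> n T) / T) (\<beta> / X) = \<bar>((\<Sum>n<N T. \<alpha> n T) - T * (\<beta> / X)) / T\<bar>"
      using elim by (simp add: dist_real_def diff_divide_distrib)
    also have "\<dots> = \<bar>(\<Sum>n<N T. \<alpha> n T) - T * (\<beta> / X)\<bar> / T" using elim by simp
    also have "\<dots> \<le> (D + T * (3 / 8 * \<eta>)) / T" using bound[of T] elim by (intro divide_right_mono) (auto simp: D_def)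
    also have "\<dots> = D / T + 3 / 8 * \<eta>" using elim by (simp add: add_divide_distrib)
    finally show ?case using elim by linarith
  qed
qed

section \<open>Normalized Lebesgue measure on the circle\<close>

lemma cis_measurable [measurable]: "cis \<in> borel_measurable borel"
  by (intro borel_measurable_continuous_onI) (auto intro!: continuous_intros)

lemma sets_circle_measure [measurable_cong, simp]: "sets circle_measure = sets borel"
  by (simp add: circle_measure_def)

lemma space_circle_measure [simp]: "space circle_measure = UNIV"
  by (simp add: circle_measure_def)

interpretation circle: prob_space circle_measure
  unfolding circle_measure_def
proof (rule prob_space.prob_space_distr)
  show "prob_space (uniform_measure lborel {0..2 * pi})"
    by (rule prob_space_uniform_measure) auto
qed simp

text \<open>
  Arguments outside one period are reached by countably many translations.
\<close>

lemma AE_circle_imp_AE_arguments: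
  assumes "AE z in circle_measure. P z"
  shows "AE t in lborel. P (cis t)"
proof -
  have "AE t in uniform_measure lborel {0..2 * pi}. P (cis t)"
    using assms unfolding circle_measure_def by (rule AE_distrD[rotated]) simp
  then have 0: "AE t in lborel. t \<in> {0..2 * pi} \<longrightarrow> P (cis t)"
    by (subst (asm) AE_uniform_measure) auto
  have "AE t in lborel. \<forall>k::int. t + 2 * pi * of_int k \<in> {0..2 * pi} \<longrightarrow> P (cis t)"
  proof (subst AE_all_countable, rule allI)
    fix k :: int
    have "AE t in distr lborel borel ((+) (2 * pi * of_int k)). t \<in> {0..2 * pi} \<longrightarrow> P (cis t)"
      unfolding lborel_distr_plus by (rule 0)
    then have "AE t in lborel. (2 * pi * of_int k + t) \<in> {0..2 * pi} \<longrightarrow> P (cis (2 * pi * of_int k + t))"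
      by (rule AE_distrD[rotated]) simp
    moreover have "cis (2 * pi * of_int k + t) = cis t" for t
      by (simp add: cis_mult[symmetric] cis_multiple_2pi)
    ultimately show "AE t in lborel. t + 2 * pi * of_int k \<in> {0..2 * pi} \<longrightarrow> P (cis t)"
      by (simp add: add.commute)
  qed
  then show ?thesis
  proof eventually_elim
    fix t :: real assume *: "\<forall>k::int. t + 2 * pi * of_int k \<in> {0..2 * pi} \<longrightarrow> P (cis t)"
    define k where "k = - \<lfloor>t / (2 * pi)\<rfloor>"
    have "of_int \<lfloor>t / (2 * pi)\<rfloor> \<le> t / (2 * pi)" "t / (2 * pi) \<le> of_int \<lfloor>t / (2 * pi)\<rfloor> + 1" by linarith+
    then have "of_int \<lfloor>t / (2 * pi)\<rfloor> * (2 * pi) \<le> t / (2 * pi) * (2 * pi)"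
        "t / (2 * pi) * (2 * pi) \<le> (of_int \<lfloor>t / (2 * pi)\<rfloor> + 1) * (2 * pi)"
      using pi_gt_zero by (intro mult_right_mono; linarith)+
    moreover have "t / (2 * pi) * (2 * pi) = t" by simp
    ultimately have "of_int \<lfloor>t / (2 * pi)\<rfloor> * (2 * pi) \<le> t" "t \<le> (of_int \<lfloor>t / (2 * pi)\<rfloor> + 1) * (2 * pi)"
      by linarith+
    then have "t + 2 * pi * of_int k \<in> {0..2 * pi}" by (simp add: k_def algebra_simps)
    then show "P (cis t)" using * by blast
  qed
qed

lemma AE_circle_in_sphere: "AE z in circle_measure. z \<in> sphere 0 1"
proof -
  have "AE t in uniform_measure lborel {0..2*pi}. cis t \<in> sphere 0 1" by simp
  then show ?thesis unfolding circle_measure_def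
    by (subst AE_distr_iff) auto
qed

lemma norm_cis_diff_le: "norm (cis s - cis t) \<le> \<bar>s - t\<bar>"
proof -
  have "cis s - cis t = cis t * (cis (s - t) - 1)" by (simp add: cis_mult algebra_simps)
  then have "norm (cis s - cis t) = norm (exp (\<i> * of_real (s - t)) - 1)"
    by (simp add: norm_mult cis_conv_exp)
  also have "\<dots> = 2 * \<bar>sin ((s - t) / 2)\<bar>" by (rule dist_exp_i_1)
  also have "\<dots> \<le> 2 * \<bar>(s - t) / 2\<bar>" by (intro mult_left_mono abs_sin_x_le_abs_x) simp
  finally show ?thesis by simp
qed

text \<open>
  Only a part of the arc is counted, on the side that stays inside one period of the argument.
\<close>

lemma measure_circle_ball_ge:
  assumes y: "norm y = 1" and t: "0 < t" "t \<le> 1"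
  shows "measure circle_measure (ball y t) \<ge> t / 2 / (2 * pi)"
proof -
  obtain a where a: "0 \<le> a" "a < 2 * pi" "y = cis a"
    using complex_unimodular_polar[OF y] by (metis cis.ctr)
  define I where "I = (if a \<le> pi then {a..a + t/2} else {a - t/2..a})"
  have I: "I \<subseteq> {0..2*pi} \<inter> (cis -` ball y t \<inter> space lborel)"
  proof
    fix s assume s: "s \<in> I"
    have "norm (cis a - cis s) \<le> \<bar>a - s\<bar>" by (rule norm_cis_diff_le)
    also have "\<dots> < t" using s t by (auto simp: I_def split: if_splits)
    finally show "s \<in> {0..2*pi} \<inter> (cis -` ball y t \<inter> space lborel)"
      using s a t pi_gt3 by (auto simp: I_def dist_norm split: if_splits)
  qed
  have "ennreal (t / 2 / (2 * pi)) = emeasure lborel I / ennreal (2 * pi)"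
    using t by (simp add: I_def divide_ennreal)
  also have "\<dots> \<le> emeasure lborel ({0..2*pi} \<inter> (cis -` ball y t \<inter> space lborel)) / ennreal (2 * pi)"
    by (intro divide_right_mono_ennreal emeasure_mono I) measurable
  also have "\<dots> = emeasure circle_measure (ball y t)"
    using measurable_sets[OF cis_measurable, of "ball y t"] unfolding circle_measure_def
    by (subst emeasure_distr, simp, simp, subst emeasure_uniform_measure) simp_all
  finally have "ennreal (t / 2 / (2 * pi)) \<le> ennreal (measure circle_measure (ball y t))"
    by (simp add: circle.emeasure_eq_measure)
  then show ?thesis by simp
qed

lemma AE_circle_near:
  assumes "AE z in circle_measure. P z" and y: "norm y = 1" and e: "e > 0"
  obtains z where "norm z = 1" "dist y z < e" "P z"
proof -
  define d where "d = min e 1"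
  have "AE z in circle_measure. z \<in> sphere 0 1 \<and> P z"
    using AE_circle_in_sphere assms(1) by eventually_elim auto
  moreover have "\<not> (AE z in circle_measure. z \<notin> ball y d)"
  proof
    assume "AE z in circle_measure. z \<notin> ball y d"
    then have "measure circle_measure (ball y d) = 0"
      by (subst circle.prob_eq_0) auto
    then show False using measure_circle_ball_ge[of y d] y e pi_gt_zero
      by (auto simp: d_def divide_le_0_iff not_le split: if_splits)
  qed
  ultimately have "\<exists>z. (z \<in> sphere 0 1 \<and> P z) \<and> z \<in> ball y d"
    by (smt (verit) eventually_mono)
  then show ?thesis using that by (auto simp: d_def)
qed

section \<open>Crossing a square\<close>

definition sqr :: "real \<Rightarrow> complex set" where
  "sqr a = {z. \<bar>Re z\<bar> < a \<and> \<bar>Im z\<bar> < a}"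

lemma open_sqr: "open (sqr a)"
proof -
  have "sqr a = {z. -a < Re z} \<inter> {z. Re z < a} \<inter> {z. -a < Im z} \<inter> {z. Im z < a}"
    by (auto simp: sqr_def)
  then show ?thesis
    by (simp add: open_Int open_halfspace_Re_gt open_halfspace_Re_lt open_halfspace_Im_gt open_halfspace_Im_lt)
qed

text \<open>
  The theorem of Fashoda for a path p that may leave the square sideways. Its real part is clamped
  to [-a, a]; clamped points lie on the vertical sides, which q avoids, so an intersection with q is a
  point of p itself.
\<close>

lemma paths_crossing_square_meet:
  fixes p q :: "real \<Rightarrow> complex"
  assumes p: "path p" and q: "path q" and a: "a > 0"
    and pI: "\<And>z. z \<in> path_image p \<Longrightarrow> \<bar>Im z\<bar> \<le> a"
    and p0: "Re (pathstart p) \<le> -a" and p1: "Re (pathfinish p) \<ge> a"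
    and qR: "\<And>z. z \<in> path_image q \<Longrightarrow> \<bar>Re z\<bar> < a \<and> \<bar>Im z\<bar> \<le> a"
    and q0: "Im (pathstart q) = -a" and q1: "Im (pathfinish q) = a"
  shows "path_image p \<inter> path_image q \<noteq> {}"
proof -
  define cl where "cl = (\<lambda>t::real. max (-a) (min a t))"
  define f where "f = (\<lambda>t. vector [cl (Re (p t)), Im (p t)] :: real^2)"
  define g where "g = (\<lambda>t. vector [Re (q t), Im (q t)] :: real^2)"
  have vec: "continuous_on S (\<lambda>t. vector [u t, v t] :: real^2)"
    if "continuous_on S u" "continuous_on S v" for S and u v :: "real \<Rightarrow> real"
  proof -
    have "(\<lambda>t. vector [u t, v t] :: real^2) = (\<lambda>t. \<chi> i. if i = 1 then u t else v t)"
      by (rule ext) (simp add: vec_eq_iff forall_2)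
    moreover have "continuous_on S (\<lambda>t. (\<chi> i. if i = 1 then u t else v t) :: real^2)"
      proof (rule continuous_on_vec_lambda)
      show "continuous_on S (\<lambda>t. if i = 1 then u t else v t)" for i :: 2
        using that by (cases "i = 1") auto
    qed
    ultimately show ?thesis by (simp only:)
  qed
  have pf: "path f" 
    using p unfolding path_def f_def cl_def
    by (intro vec continuous_intros) auto
  have pg: "path g"
    using q unfolding path_def g_def
    by (intro vec continuous_intros) auto
  have "\<exists>z. z \<in> path_image f \<and> z \<in> path_image g"
  proof (rule fashoda[OF pf pg, of "vector [-a,-a]" "vector [a,a]"])
    show "path_image f \<subseteq> cbox (vector [- a, - a]) (vector [a, a])"
      using pI a by (force simp: path_image_def f_def cl_def mem_box_cart forall_2 vector_2)
    show "path_image g \<subseteq> cbox (vector [- a, - a]) (vector [a, a])"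
      using qR a by (force simp: path_image_def g_def mem_box_cart forall_2 vector_2)
    show "pathstart f $ 1 = vector [- a, - a] $ 1"
      using p0 a by (simp add: pathstart_def f_def cl_def vector_2)
    show "pathfinish f $ 1 = vector [a, a] $ 1"
      using p1 a by (simp add: pathfinish_def f_def cl_def vector_2)
    show "pathstart g $ 2 = (vector [- a, - a] :: real^2) $ 2"
      using q0 by (simp add: pathstart_def g_def vector_2)
    show "pathfinish g $ 2 = (vector [a, a] :: real^2) $ 2"
      using q1 by (simp add: pathfinish_def g_def vector_2)
  qed blast
  then obtain s t where st: "s \<in> {0..1}" "t \<in> {0..1}" "f s = g t"
    by (auto simp: path_image_def)
  then have e: "cl (Re (p s)) = Re (q t)" "Im (p s) = Im (q t)"
    by (metis f_def g_def vector_2(1)) (metis st(3) f_def g_def vector_2(2))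
  have "\<bar>Re (q t)\<bar> < a"
    using qR st by (auto simp: path_image_def)
  then have "Re (p s) = Re (q t)"
    using e(1) by (auto simp: cl_def max_def min_def split: if_splits)
  then have "p s = q t"
    using e(2) by (simp add: complex_eq_iff)
  then have "p s \<in> path_image p \<inter> path_image q"
    using st(1,2) unfolding path_image_def by (metis IntI imageI)
  then show ?thesis by blast
qed

text \<open>
  The product H of G over the four rotations of the square is small on the union K of the four rotated
  copies of the path. The component of the centre in the complement of K stays away from the
  sides: it is invariant under the rotations, so otherwise it would give a connection from the bottom to the
  top that avoids the path. So the maximum principle applies on it.
\<close>

lemma crossing_square:
  fixes G :: "complex \<Rightarrow> complex" and p :: "real \<Rightarrow> complex"
  assumes a: "a > 0" and hol: "G holomorphic_on sqr a"
    and le1: "\<And>z. z \<in> sqr a \<Longrightarrow> norm (G z) \<le> 1"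
    and p: "path p" and pI: "\<And>z. z \<in> path_image p \<Longrightarrow> \<bar>Im z\<bar> < a"
    and p0: "Re (pathstart p) \<le> -a" and p1: "Re (pathfinish p) \<ge> a"
    and small: "\<And>z. z \<in> path_image p \<inter> sqr a \<Longrightarrow> norm (G z) \<le> c"
  shows "norm (G 0) ^ 4 \<le> c"
proof -
  define R where "R = path_image p"
  define K where "K = R \<union> (*) \<i> ` R \<union> (*) (-1) ` R \<union> (*) (-\<i>) ` R"
  define H where "H = (\<lambda>z. G z * G (\<i> * z) * G (- z) * G (-\<i> * z))"
  have cR: "compact R" unfolding R_def by (rule compact_path_image[OF p])
  then have cK: "compact K"
    unfolding K_def by (intro compact_Un compact_continuous_image continuous_intros)
  have mem: "z \<in> K \<longleftrightarrow> z \<in> R \<or> \<i> * z \<in> R \<or> - z \<in> R \<or> -\<i> * z \<in> R" for z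
  proof -
    have im: "z \<in> (*) u ` R \<longleftrightarrow> inverse u * z \<in> R" if "u \<noteq> 0" for u
      using that by (auto simp: image_iff mult.assoc[symmetric] intro!: bexI[of _ "inverse u * z"])
    have "z \<in> (*) \<i> ` R \<longleftrightarrow> -\<i> * z \<in> R" "z \<in> (*) (-1) ` R \<longleftrightarrow> - z \<in> R" "z \<in> (*) (-\<i>) ` R \<longleftrightarrow> \<i> * z \<in> R"
      using im[of "\<i>"] im[of "-1"] im[of "-\<i>"] by simp_all
    then show ?thesis
      unfolding K_def Un_iff by blast
  qed
  have rot: "\<i> * z \<in> K \<longleftrightarrow> z \<in> K" for z
    unfolding mem by (auto simp: algebra_simps)
  have sq_rot: "\<i> * z \<in> sqr a \<longleftrightarrow> z \<in> sqr a" "- z \<in> sqr a \<longleftrightarrow> z \<in> sqr a" "-\<i> * z \<in> sqr a \<longleftrightarrow> z \<in> sqr a" for z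
    by (auto simp: sqr_def)
  have holH: "H holomorphic_on sqr a"
  proof -
    have "G \<circ> (\<lambda>z. u * z) holomorphic_on sqr a" if "\<And>z. u * z \<in> sqr a \<longleftrightarrow> z \<in> sqr a" for u
      by (rule holomorphic_on_compose_gen[OF _ hol]) (use that in \<open>auto intro!: holomorphic_intros\<close>)
    from this[of "\<i>"] this[of "-1"] this[of "-\<i>"] hol show ?thesis
      unfolding H_def o_def using sq_rot by (auto intro!: holomorphic_intros)
  qed
  have H_small: "norm (H z) \<le> c" if "z \<in> K" "z \<in> sqr a" for z
  proof -
    have n: "norm (G z) \<le> 1" "norm (G (\<i> * z)) \<le> 1" "norm (G (-z)) \<le> 1" "norm (G (-\<i> * z)) \<le> 1"
      using that(2) sq_rot le1 by auto
    have 4: "w * x * y * z \<le> k" if "0 \<le> w" "0 \<le> x" "0 \<le> y" "0 \<le> z" "w \<le> 1" "x \<le> 1" "y \<le> 1" "z \<le> 1"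
        "w \<le> k \<or> x \<le> k \<or> y \<le> k \<or> z \<le> k" for w x y z k :: real
    proof -
      have "w * x * y * z \<le> w * 1 * 1 * 1" "w * x * y * z \<le> 1 * x * 1 * 1"
           "w * x * y * z \<le> 1 * 1 * y * 1" "w * x * y * z \<le> 1 * 1 * 1 * z"
        by (intro mult_mono; use that in \<open>simp add: mult_nonneg_nonneg mult_le_one\<close>)+
      then show ?thesis using that(9) by auto
    qed
    have "norm (G z) \<le> c \<or> norm (G (\<i> * z)) \<le> c \<or> norm (G (-z)) \<le> c \<or> norm (G (-\<i> * z)) \<le> c"
      using that small sq_rot unfolding mem R_def by blast
    then show ?thesis
      unfolding H_def norm_mult using n by (intro 4) auto
  qed
  have "norm (H 0) \<le> c"
  proof (cases "0 \<in> K")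
    case True
    then show ?thesis using H_small a by (auto simp: sqr_def)
  next
    case False
    define U where "U = sqr a - K"
    have oU: "open U" unfolding U_def by (intro open_Diff open_sqr compact_imp_closed cK)
    have 0: "0 \<in> U" using False a by (auto simp: U_def sqr_def)
    \<comment> \<open>C is invariant under rotation by a right angle, since U is.\<close>
    define C where "C = connected_component_set U 0"
    have oC: "open C" unfolding C_def by (rule open_connected_component[OF oU])
    have CU: "C \<subseteq> U" unfolding C_def by (rule connected_component_subset)
    have conC: "connected C" unfolding C_def by simp
    have 0: "0 \<in> C" unfolding C_def using 0 by simp
    have Crot: "(*) \<i> ` C \<subseteq> C"
      unfolding C_def
    proof (rule connected_component_maximal)
      show "0 \<in> (*) \<i> ` connected_component_set U 0" using 0 C_def by force
      show "connected ((*) \<i> ` connected_component_set U 0)"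
        by (intro connected_continuous_image continuous_intros) simp
      show "(*) \<i> ` connected_component_set U 0 \<subseteq> U"
        using CU rot sq_rot unfolding C_def U_def by auto
    qed
    have Crot: "\<i> * z \<in> C" if "z \<in> C" for z using Crot that by auto
    then have Crot2: "-z \<in> C" if "z \<in> C" for z
      using Crot[OF Crot[OF that]] by (simp add: mult.assoc[symmetric])
    obtain e where e: "0 < e" "e < a" "\<And>z. z \<in> R \<Longrightarrow> \<bar>Im z\<bar> < e"
    proof -
      have "R \<noteq> {}" unfolding R_def by simp
      then obtain w where w: "w \<in> R" "\<And>z. z \<in> R \<Longrightarrow> \<bar>Im z\<bar> \<le> \<bar>Im w\<bar>"
        using continuous_attains_sup[OF cR, of "\<lambda>z. \<bar>Im z\<bar>"] continuous_on_rabs[OF continuous_on_Im[OF continuous_on_id]] by blast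
      have "\<bar>Im w\<bar> < a" using pI w by (auto simp: R_def)
      then show ?thesis
        using w(2) by (intro that[of "(\<bar>Im w\<bar> + a) / 2"]) (fastforce simp: field_simps)+
    qed
    have key: "Im z > -e" if z: "z \<in> C" for z
    proof (rule ccontr)
      assume "\<not> Im z > -e"
      then have ze: "Im z \<le> -e" by simp
      have zs: "z \<in> sqr a" using z CU by (auto simp: U_def)
      obtain g where g: "path g" "path_image g \<subseteq> C" "pathstart g = z" "pathfinish g = -z"
        using connected_open_path_connected[OF oC conC] z Crot2[OF z] unfolding path_connected_def by metis
      define b where "b = Complex (Re z) (-a)"
      define q where "q = linepath b z +++ (g +++ linepath (-z) (-b))"
      have seg1: "Im w \<le> -e \<and> -a \<le> Im w \<and> \<bar>Re w\<bar> < a" if ws: "w \<in> closed_segment b z" for w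
      proof -
        obtain u where u: "0 \<le> u" "u \<le> 1" "w = (1-u) *\<^sub>R b + u *\<^sub>R z"
          using ws by (auto simp: in_segment)
        have "Re w = Re z" unfolding u(3) by (simp add: b_def algebra_simps)
        moreover have "Im w = (1-u) * (-a) + u * Im z" unfolding u(3) by (simp add: b_def)
        moreover have "(1-u) * (-a) + u * Im z \<le> (1-u) * (-e) + u * (-e)"
          using u ze e by (intro add_mono mult_left_mono) auto
        moreover have "(1-u) * (-a) + u * Im z \<ge> (1-u) * (-a) + u * (-a)"
          using u zs by (intro add_mono mult_left_mono) (auto simp: sqr_def)
        ultimately show ?thesis using zs by (auto simp: sqr_def algebra_simps)
      qed
      have seg2: "-w \<in> closed_segment b z" if "w \<in> closed_segment (-z) (-b)" for w
        using that by (auto simp: in_segment closed_segment_commute[of "-z"])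
      have pq: "path q" unfolding q_def using g by (auto intro!: path_join_imp)
      have imq: "path_image q = closed_segment b z \<union> (path_image g \<union> closed_segment (-z) (-b))"
        unfolding q_def using g by (simp add: path_image_join)
      have "path_image p \<inter> path_image q \<noteq> {}"
      proof (rule paths_crossing_square_meet[OF p pq a _ p0 p1])
        show "\<bar>Im z\<bar> \<le> a" if "z \<in> path_image p" for z using pI[OF that] by simp
        show "\<bar>Re w\<bar> < a \<and> \<bar>Im w\<bar> \<le> a" if "w \<in> path_image q" for w
        proof -
          have "\<bar>Re w\<bar> < a \<and> \<bar>Im w\<bar> \<le> a" if "w \<in> C"
            using that CU by (auto simp: U_def sqr_def)
          moreover have "\<bar>Re w\<bar> < a \<and> \<bar>Im w\<bar> \<le> a" if "w \<in> closed_segment b z"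
            using seg1[OF that] e by auto
          moreover have "\<bar>Re w\<bar> < a \<and> \<bar>Im w\<bar> \<le> a" if "w \<in> closed_segment (-z) (-b)"
            using seg1[OF seg2[OF that]] e by auto
          ultimately show ?thesis using that g(2) unfolding imq by blast
        qed
        show "Im (pathstart q) = - a" by (simp add: q_def b_def)
        show "Im (pathfinish q) = a" by (simp add: q_def b_def)
      qed
      then obtain w where w: "w \<in> R" "w \<in> path_image q" by (auto simp: R_def)
      have "w \<notin> C" using w(1) CU by (auto simp: U_def mem)
      then have "Im w \<le> -e \<or> Im (-w) \<le> -e" using w(2) seg1 seg2 g(2) unfolding imq by blast
      then show False using e(3)[OF w(1)] by auto
    qed
    define T where "T = {z. \<bar>Re z\<bar> \<le> e \<and> \<bar>Im z\<bar> \<le> e}"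
    have "C \<subseteq> T"
    proof
      fix z assume z: "z \<in> C"
      have "Im z > -e" "Im (-z) > -e" "Im (\<i> * z) > -e" "Im (- (\<i> * z)) > -e"
        using key z Crot Crot2 by blast+
      then show "z \<in> T" by (auto simp: T_def)
    qed
    moreover have "T = cbox (Complex (-e) (-e)) (Complex e e)"
      by (auto simp: T_def in_cbox_complex_iff)
    ultimately have clC: "closure C \<subseteq> T" and bC: "bounded C"
      by (metis closed_cbox closure_minimal, metis bounded_cbox bounded_subset)
    have Ts: "T \<subseteq> sqr a" using e by (auto simp: T_def sqr_def)
    have fr: "frontier C \<subseteq> K"
    proof
      fix w assume w: "w \<in> frontier C"
      then have ws: "w \<in> sqr a" "w \<in> closure C" "w \<notin> C" using clC Ts oC by (auto simp: frontier_def interior_open)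
      show "w \<in> K"
      proof (rule ccontr)
        assume "w \<notin> K"
        then have "w \<in> U" using ws by (simp add: U_def)
        then obtain d where d: "0 < d" "ball w d \<subseteq> U" using oU open_contains_ball by blast
        then obtain v where "v \<in> C" "v \<in> ball w d" using ws(2) by (metis closure_approachable dist_commute mem_ball)
        then have "connected_component_set U v = C" 
          unfolding C_def by (metis C_def connected_component_eq)
        moreover have "ball w d \<subseteq> connected_component_set U v"
          using \<open>v \<in> ball w d\<close> d by (intro connected_component_maximal) auto
        ultimately show False using ws(3) d(1) centre_in_ball by blast
      qed
    qed
    show ?thesis
    proof (rule maximum_modulus_frontier[of H C])
      show "H holomorphic_on interior C" using holH CU unfolding interior_open[OF oC] U_def by (meson Diff_subset order_trans holomorphic_on_subset)
      show "continuous_on (closure C) H"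
        using holomorphic_on_imp_continuous_on[OF holH] clC Ts continuous_on_subset by blast
      show "norm (H z) \<le> c" if "z \<in> frontier C" for z
        using H_small fr that clC Ts by (auto simp: frontier_def)
    qed (use bC 0 in auto)
  qed
  then show ?thesis by (simp add: H_def norm_mult power4_eq_xxxx)
qed

text \<open>
  In the coordinate log ((y - z) / (\<sigma> (y + z))) the disc becomes the strip |Im| < \<pi>/2 with the
  point (1 - r) y at the centre and y at the left end. A path from z1 to 0 inside the sublevel set
  crosses the square of half side \<pi>/2; the factor 9 is a bound for exp (\<pi>/2).
\<close>

lemma sublevel_point_near_circle:
  fixes F :: "complex \<Rightarrow> complex" and y z1 :: complex
  assumes hol: "F holomorphic_on ball 0 1" and le1: "\<And>z. z \<in> ball 0 1 \<Longrightarrow> norm (F z) \<le> 1"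
    and conn: "connected {z \<in> ball 0 1. norm (F z) < c}" and zero: "norm (F 0) < c"
    and y: "norm y = 1" and z1: "norm z1 < 1" "norm (F z1) < c"
    and r: "9 * norm (z1 - y) \<le> r" "r \<le> 1/5"
  shows "norm (F (of_real (1 - r) * y)) ^ 4 \<le> c"
proof -
  define Om where "Om = {z \<in> ball 0 1. norm (F z) < c}"
  define s where "s = norm (z1 - y)"
  define \<sigma> where "\<sigma> = r / (2 - r)"
  have s0: "s > 0" using y z1 by (auto simp: s_def)
  then have r0: "r > 0" using r unfolding s_def by linarith
  have \<sigma>: "\<sigma> > 0" "\<sigma> \<le> 1/9" using r0 r by (auto simp: \<sigma>_def field_simps)
  have e9: "exp (pi/2) \<le> 9"
  proof -
    have "exp (pi/2) \<le> exp (1 + 1::real)" using pi_less_4 by simp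
    also have "\<dots> = exp 1 * exp 1" by (rule exp_add)
    also have "\<dots> \<le> 3 * 3" using exp_le by (intro mult_mono) auto
    finally show ?thesis by simp
  qed
  define k where "k = (\<lambda>z. (y - z) / (of_real \<sigma> * (y + z)))"
  define \<psi> where "\<psi> = (\<lambda>w. y * (1 - of_real \<sigma> * w) / (1 + of_real \<sigma> * w))"
  have yz: "y + z \<noteq> 0" "y - z \<noteq> 0" if "norm z < 1" for z
    using that y by (auto simp: add_eq_0_iff)
  have Rek: "Re (k z) > 0" if z: "norm z < 1" for z
  proof -
    have "k z = (y - z) / (y + z) / of_real \<sigma>" by (simp add: k_def)
    also have "(y - z) / (y + z) = (y - z) * cnj (y + z) / of_real ((norm (y + z))\<^sup>2)"
      by (subst complex_div_cnj) simp
    finally have "k z = (y - z) * cnj (y + z) / of_real (\<sigma> * (norm (y + z))\<^sup>2)"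
      by (simp add: mult.commute)
    then have "Re (k z) = Re ((y - z) * cnj (y + z)) / (\<sigma> * (norm (y + z))\<^sup>2)"
      by (simp only: Re_divide_of_real)
    moreover have "Re ((y - z) * cnj (y + z)) = (norm y)\<^sup>2 - (norm z)\<^sup>2"
      by (simp only: cmod_power2) (simp add: algebra_simps power2_eq_square)
    moreover have "(norm z)\<^sup>2 < 1" using z by (simp add: power_less_one_iff)
    ultimately show ?thesis using y \<sigma> yz[OF z] by simp
  qed
  have psik: "\<psi> (k z) = z" if z: "norm z < 1" for z
  proof -
    have "of_real \<sigma> * k z = (y - z) / (y + z)" using \<sigma> by (simp add: k_def)
    then have "\<psi> (k z) = y * (1 - (y - z) / (y + z)) / (1 + (y - z) / (y + z))" by (simp add: \<psi>_def)
    also have "\<dots> = y * (2 * z / (y + z)) / (2 * y / (y + z))"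
      using yz[OF z] by (simp add: field_simps)
    also have "\<dots> = z * (2 * y / (y + z)) / (2 * y / (y + z))" by simp
    also have "\<dots> = z" using yz[OF z] y by (intro nonzero_mult_div_cancel_right) auto
    finally show ?thesis .
  qed
  have psi: "norm (\<psi> w) < 1 \<and> 1 + of_real \<sigma> * w \<noteq> 0" if w: "Re w > 0" for w
  proof -
    have p: "Re (of_real \<sigma> * w) > 0" using w \<sigma> by simp
    then have nz: "1 + of_real \<sigma> * w \<noteq> 0" by (auto simp: complex_eq_iff)
    have "(norm (1 - of_real \<sigma> * w))\<^sup>2 < (norm (1 + of_real \<sigma> * w))\<^sup>2"
      using p by (simp only: cmod_power2) (simp add: power2_eq_square algebra_simps)
    then have "norm (1 - of_real \<sigma> * w) < norm (1 + of_real \<sigma> * w)"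
      by (rule power2_less_imp_less) simp
    then show ?thesis using nz y by (simp add: \<psi>_def norm_mult norm_divide divide_less_eq)
  qed
  define G where "G = (\<lambda>\<zeta>. F (\<psi> (exp \<zeta>)))"
  have exp_pos: "Re (exp \<zeta>) > 0" if "\<bar>Im \<zeta>\<bar> < pi/2" for \<zeta>
    using that by (simp add: Re_exp cos_gt_zero_pi)
  have sq: "norm (\<psi> (exp \<zeta>)) < 1 \<and> 1 + of_real \<sigma> * exp \<zeta> \<noteq> 0" if "\<zeta> \<in> sqr (pi/2)" for \<zeta>
    using psi[OF exp_pos] that by (auto simp: sqr_def)
  have hG: "G holomorphic_on sqr (pi/2)"
  proof -
    have "(\<lambda>\<zeta>. \<psi> (exp \<zeta>)) holomorphic_on sqr (pi/2)"
      unfolding \<psi>_def using sq by (auto intro!: holomorphic_intros)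
    then have "F \<circ> (\<lambda>\<zeta>. \<psi> (exp \<zeta>)) holomorphic_on sqr (pi/2)"
      by (rule holomorphic_on_compose_gen[OF _ hol]) (use sq in auto)
    then show ?thesis by (simp add: G_def o_def)
  qed
  have "open Om"
  proof -
    have "open (ball 0 1 \<inter> (\<lambda>z. norm (F z)) -` {..<c})"
      by (intro continuous_open_preimage continuous_intros holomorphic_on_imp_continuous_on hol) auto
    moreover have "Om = ball 0 1 \<inter> (\<lambda>z. norm (F z)) -` {..<c}" by (auto simp: Om_def)
    ultimately show ?thesis by simp
  qed
  then have "path_connected Om"
    by (rule connected_open_path_connected) (use conn in \<open>simp add: Om_def\<close>)
  moreover have "z1 \<in> Om" "0 \<in> Om" using z1 zero by (auto simp: Om_def)
  ultimately obtain p where p: "path p" "path_image p \<subseteq> Om" "pathstart p = z1" "pathfinish p = 0"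
    unfolding path_connected_def by blast
  have pin: "norm z < 1 \<and> norm (F z) < c" if "z \<in> path_image p" for z
    using that p(2) by (auto simp: Om_def)
  define q where "q = (\<lambda>z. Ln (k z)) \<circ> p"
  have "norm (G 0) ^ 4 \<le> c"
  proof (rule crossing_square[of "pi/2" G q c])
    show "norm (G z) \<le> 1" if "z \<in> sqr (pi/2)" for z
      using sq[OF that] le1 by (simp add: G_def)
    have "continuous_on (path_image p) (\<lambda>z. Ln (k z))"
    proof (rule continuous_on_Ln')
      have nz: "of_real \<sigma> * (y + z) \<noteq> 0" if zp: "z \<in> path_image p" for z
      proof -
        have "norm z < 1" using pin[OF zp] by (rule conjunct1)
        then have "y + z \<noteq> 0" by (rule yz(1))
        then show ?thesis using \<sigma>(1) by simp
      qed
      have "continuous_on (path_image p) (\<lambda>z. (y - z) / (of_real \<sigma> * (y + z)))"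
        by (rule continuous_on_divide) (intro continuous_intros | rule ballI nz | assumption)+
      then show "continuous_on (path_image p) k" unfolding k_def .
      show "\<And>z. z \<in> path_image p \<Longrightarrow> k z \<notin> \<real>\<^sub>\<le>\<^sub>0"
        using Rek pin by (fastforce simp: complex_nonpos_Reals_iff)
    qed
    then show "path q" unfolding q_def by (rule path_continuous_image[OF p(1)])
    have q: "\<exists>z\<in>path_image p. w = Ln (k z)" if "w \<in> path_image q" for w
      using that by (auto simp: q_def path_image_compose)
    show "\<bar>Im w\<bar> < pi/2" if wq: "w \<in> path_image q" for w
    proof -
      obtain z where z: "z \<in> path_image p" "w = Ln (k z)" using q[OF wq] by blast
      then show ?thesis using Re_Ln_pos_lt_imp[OF Rek] pin by blast
    qed
    show "norm (G w) \<le> c" if wq: "w \<in> path_image q \<inter> sqr (pi/2)" for w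
    proof -
      obtain z where z: "z \<in> path_image p" "w = Ln (k z)" using q wq by blast
      have "k z \<noteq> 0" using Rek[of z] pin[OF z(1)] by auto
      then have "G w = F z" using z psik pin by (simp add: G_def)
      then show ?thesis using pin[OF z(1)] by simp
    qed
    have Reln: "Re (Ln (k z)) = ln (norm (y - z) / (\<sigma> * norm (y + z)))" if "norm z < 1" for z
    proof -
      have "k z \<noteq> 0" using Rek[OF that] by auto
      then show ?thesis using \<sigma> by (simp add: k_def norm_mult norm_divide)
    qed
    have "norm (y - z1) / (\<sigma> * norm (y + z1)) \<le> exp (-(pi/2))"
    proof -
      have n: "norm (y + z1) \<ge> 2 - s"
        using norm_triangle_ineq2[of "2*y" "y - z1"] y by (simp add: s_def norm_minus_commute norm_mult algebra_simps)
      have "s \<le> r / 9" using r by (simp add: s_def)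
      then have "9 * s * (2 - r) \<le> r * (2 - s)" using r0 r s0 by (intro mult_mono) auto
      also have "\<dots> \<le> r * norm (y + z1)" using n r0 by simp
      finally have "9 * s \<le> \<sigma> * norm (y + z1)" using r by (simp add: \<sigma>_def field_simps)
      moreover have "s * exp (pi/2) \<le> s * 9" using e9 s0 by simp
      ultimately have "s * exp (pi/2) \<le> \<sigma> * norm (y + z1)" by linarith
      then show ?thesis using \<sigma> yz[OF z1(1)] by (simp add: s_def exp_minus field_simps norm_minus_commute)
    qed
    then have "ln (norm (y - z1) / (\<sigma> * norm (y + z1))) \<le> ln (exp (-(pi/2)))"
      using \<sigma> yz[OF z1(1)] by (intro ln_mono) auto
    then show "Re (pathstart q) \<le> - (pi/2)"
      using Reln[OF z1(1)] p(3) by (simp add: q_def pathstart_def)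
    have "exp (pi/2) \<le> 1 / \<sigma>"
      using \<sigma> e9 mult_mono[of \<sigma> "1/9" "exp (pi/2)" 9] by (simp add: field_simps)
    then have "ln (exp (pi/2)) \<le> ln (1/\<sigma>)" using \<sigma> by (intro ln_mono) auto
    then show "Re (pathfinish q) \<ge> pi/2"
      using Reln[of 0] p(4) y by (simp add: q_def pathfinish_def)
  qed (use hG in auto)
  moreover have "\<psi> 1 = of_real (1 - r) * y"
  proof -
    have "(1 - \<sigma>) / (1 + \<sigma>) = 1 - r" using r by (simp add: \<sigma>_def field_simps)
    then have "complex_of_real (1 - r) = (1 - of_real \<sigma>) / (1 + of_real \<sigma>)"
      by (metis of_real_1 of_real_add of_real_diff of_real_divide)
    then show ?thesis by (simp add: \<psi>_def)
  qed
  ultimately show ?thesis by (simp add: G_def)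
qed

section \<open>Reflection across an arc with limits almost everywhere\<close>

text \<open>
  The reflected function 1 / cnj (K (cnj u)) has the same vertical limits as K where these
  are unimodular. Both functions are bounded, so their primitives are Lipschitz and extend
  continuously to the real segment; by dominated convergence the extended primitives differ there by a
  constant. The two primitives paste to a holomorphic function, and its derivative is the extension.
\<close>

lemma reflection_extension:
  fixes K :: "complex \<Rightarrow> complex" and x0 \<rho> c :: real
  assumes \<rho>: "\<rho> > 0" and c: "c > 0"
    and hol: "K holomorphic_on ball (of_real x0) \<rho> \<inter> {u. Im u > 0}"
    and bd: "\<And>u. u \<in> ball (of_real x0) \<rho> \<Longrightarrow> Im u > 0 \<Longrightarrow> c \<le> norm (K u) \<and> norm (K u) \<le> 1"
    and lim: "AE t in lborel. \<bar>t - x0\<bar> < \<rho> \<longrightarrow>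
                (\<exists>w. norm w = 1 \<and> ((\<lambda>s. K (Complex t s)) \<longlongrightarrow> w) (at_right 0))"
  obtains L where "L holomorphic_on ball (of_real x0) \<rho>"
    "\<And>u. u \<in> ball (of_real x0) \<rho> \<Longrightarrow> Im u > 0 \<Longrightarrow> L u = K u"
    "\<And>u. u \<in> ball (of_real x0) \<rho> \<Longrightarrow> c \<le> norm (L u) \<and> norm (L u) \<le> 1 / c"
proof -
  define B where "B = ball (complex_of_real x0) \<rho>"
  define U where "U = B \<inter> {u. Im u > 0}"
  define V where "V = B \<inter> {u. Im u < 0}"
  have oU: "open U" and oV: "open V" and oB: "open B"
    by (auto simp: U_def V_def B_def intro!: open_Int open_halfspace_Im_gt open_halfspace_Im_lt)
  have cU: "convex U" and cV: "convex V"
    by (auto simp: U_def V_def B_def intro!: convex_Int convex_halfspace_Im_gt convex_halfspace_Im_lt)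
  have cnjB: "cnj u \<in> B \<longleftrightarrow> u \<in> B" for u
    using complex_mod_cnj[of "of_real x0 - u"] by (simp add: B_def dist_norm)
  have cnjU: "cnj ` V = U"
  proof
    show "cnj ` V \<subseteq> U" using cnjB by (auto simp: U_def V_def)
    show "U \<subseteq> cnj ` V"
    proof
      fix u assume "u \<in> U"
      then have "u = cnj (cnj u)" "cnj u \<in> V" using cnjB by (auto simp: U_def V_def)
      then show "u \<in> cnj ` V" by blast
    qed
  qed
  have bd': "c \<le> norm (K u)" "norm (K u) \<le> 1" "K u \<noteq> 0" if "u \<in> U" for u
  proof -
    show "c \<le> norm (K u)" "norm (K u) \<le> 1" using bd that by (auto simp: U_def B_def)
    then show "K u \<noteq> 0" using c by auto
  qed
  define K2 where "K2 = (\<lambda>u. inverse (cnj (K (cnj u))))"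
  have holU: "K holomorphic_on U" using hol by (simp add: U_def B_def)
  have holV: "K2 holomorphic_on V"
  proof -
    have "(cnj \<circ> K \<circ> cnj) holomorphic_on V"
      by (rule holomorphic_on_compose_cnj_cnj) (use holU cnjU oV in auto)
    then have "(\<lambda>u. inverse ((cnj \<circ> K \<circ> cnj) u)) holomorphic_on V"
      by (rule holomorphic_on_inverse) (use bd'(3) cnjU in auto)
    then show ?thesis by (simp add: K2_def o_def)
  qed
  have K2_bd: "1 \<le> norm (K2 u)" "norm (K2 u) \<le> 1 / c" if "u \<in> V" for u
  proof -
    have "cnj u \<in> U" using that cnjU by blast
    note b = bd'(1,2)[OF this]
    have "0 < norm (K (cnj u))" using b c by linarith
    have "norm (K2 u) = inverse (norm (K (cnj u)))" by (simp only: K2_def norm_inverse complex_mod_cnj)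
    then show "1 \<le> norm (K2 u)" "norm (K2 u) \<le> 1 / c" using b c
      using \<open>0 < norm (K (cnj u))\<close> le_imp_inverse_le[of c "norm (K (cnj u))"] le_imp_inverse_le[of "norm (K (cnj u))" 1]
      by (simp_all add: inverse_eq_divide)
  qed
  obtain A where A: "\<And>x. x \<in> U \<Longrightarrow> (A has_field_derivative K x) (at x within U)"
    using holomorphic_convex_primitive'[OF cU oU holU] by blast
  obtain D where D: "\<And>x. x \<in> V \<Longrightarrow> (D has_field_derivative K2 x) (at x within V)"
    using holomorphic_convex_primitive'[OF cV oV holV] by blast
  have ucA: "uniformly_continuous_on U A"
  proof (rule lipschitz_on_uniformly_continuous)
    show "1-lipschitz_on U A"
      unfolding lipschitz_on_def dist_norm
      using field_differentiable_bound[OF cU A, of 1] bd' by auto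
  qed
  have ucD: "uniformly_continuous_on V D"
  proof (rule lipschitz_on_uniformly_continuous)
    show "(1/c)-lipschitz_on V D"
      unfolding lipschitz_on_def dist_norm
      using field_differentiable_bound[OF cV D, of "1/c"] K2_bd c by auto
  qed
  obtain A1 where A1: "uniformly_continuous_on (closure U) A1" "\<And>x. x \<in> U \<Longrightarrow> A x = A1 x"
    using uniformly_continuous_on_extension_on_closure[OF ucA] by metis
  obtain D1 where D1: "uniformly_continuous_on (closure V) D1" "\<And>x. x \<in> V \<Longrightarrow> D x = D1 x"
    using uniformly_continuous_on_extension_on_closure[OF ucD] by metis
  have shift: "u + \<i> * of_real s \<in> U" if "u \<in> B" "Im u \<ge> 0" "0 < s" "s < \<rho> - norm (u - of_real x0)" for u s
  proof -
    have "norm (u + \<i> * of_real s - of_real x0) \<le> norm (u - of_real x0) + norm (\<i> * complex_of_real s)"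
      using norm_triangle_ineq[of "u - of_real x0" "\<i> * of_real s"] by (simp add: algebra_simps)
    then have "norm (u + \<i> * of_real s - of_real x0) < \<rho>" using that by (simp add: norm_mult)
    then show ?thesis using that by (simp add: U_def B_def dist_norm norm_minus_commute)
  qed
  have clU: "u \<in> closure U" if u: "u \<in> B" "Im u \<ge> 0" for u
  proof (subst closure_approachable, intro allI impI)
    fix e :: real assume e: "e > 0"
    define r where "r = \<rho> - norm (u - of_real x0)"
    have r: "r > 0" using u by (simp add: r_def B_def dist_norm norm_minus_commute)
    define s where "s = min (e/2) (r/2)"
    have s: "0 < s" "s < e" "s < r" using e r by (auto simp: s_def)
    have "u + \<i> * of_real s \<in> U" using shift u s by (simp add: r_def)
    moreover have "dist (u + \<i> * of_real s) u < e" using s by (simp add: dist_norm norm_mult)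
    ultimately show "\<exists>v\<in>U. dist v u < e" by blast
  qed
  have clV: "u \<in> closure V" if u: "u \<in> B" "Im u \<le> 0" for u
  proof (subst closure_approachable, intro allI impI)
    fix e :: real assume e: "e > 0"
    have "cnj u \<in> closure U" using u cnjB by (intro clU) auto
    then obtain v where v: "v \<in> U" "dist v (cnj u) < e" using e by (auto simp: closure_approachable)
    have "cnj v \<in> V" using v(1) cnjB by (auto simp: U_def V_def)
    moreover have "dist (cnj v) u < e" using v(2) complex_mod_cnj[of "v - cnj u"] by (simp add: dist_norm)
    ultimately show "\<exists>v\<in>V. dist v u < e" by blast
  qed
  \<comment> \<open>As s tends to 0 the increments of the two primitives along horizontal segments at heights s and -s have the same limit.\<close>
  have inB: "of_real t \<in> B \<longleftrightarrow> \<bar>t - x0\<bar> < \<rho>" for t :: real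
    by (simp add: B_def dist_norm abs_minus_commute flip: of_real_diff)
  have step: "A1 (of_real b) - A1 (of_real a) = D1 (of_real b) - D1 (of_real a)"
    if ab: "a \<le> b" "\<bar>a - x0\<bar> < \<rho>" "\<bar>b - x0\<bar> < \<rho>" for a b :: real
  proof -
    define h where "h = \<rho> - max \<bar>a - x0\<bar> \<bar>b - x0\<bar>"
    have h: "h > 0" using ab by (simp add: h_def)
    define s where "s = (\<lambda>n::nat. h / (real n + 2))"
    have s: "0 < s n" "s n < h" for n
    proof -
      have "0 \<le> h * real n" using h by simp
      then have "0 < h + h * real n" using h by linarith
      then show "0 < s n" "s n < h" using h by (simp_all add: s_def field_simps)
    qed
    have slim: "s \<longlonglongrightarrow> 0" unfolding s_def by real_asymp
    have inI: "\<bar>t - x0\<bar> \<le> \<rho> - h" if "t \<in> {a..b}" for t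
      using that ab by (auto simp: h_def)
    have up: "of_real t + \<i> * of_real (s n) \<in> U" if "t \<in> {a..b}" for t n
    proof (rule shift)
      show "of_real t \<in> B" using inI[OF that] h by (simp add: inB)
      have "norm (complex_of_real t - of_real x0) = \<bar>t - x0\<bar>" by (metis norm_of_real of_real_diff)
      then show "s n < \<rho> - norm (complex_of_real t - of_real x0)" using inI[OF that] s(2)[of n] by linarith
    qed (use s in auto)
    have down: "of_real t - \<i> * of_real (s n) \<in> V" if "t \<in> {a..b}" for t n
    proof -
      have "cnj (of_real t - \<i> * of_real (s n)) \<in> U" using up[OF that] by simp
      then show ?thesis using cnjB[of "of_real t - \<i> * of_real (s n)"] by (auto simp: U_def V_def)
    qed
    have line: "((\<lambda>t. of_real t + w) has_vector_derivative 1) (at t within S)" for t S and w :: complex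
      by (auto intro!: derivative_eq_intros)
    define f where "f = (\<lambda>n t. K (of_real t + \<i> * of_real (s n)))"
    define g where "g = (\<lambda>n t. K2 (of_real t - \<i> * of_real (s n)))"
    have contf: "continuous_on {a..b} (f n)" for n
      unfolding f_def
      by (rule continuous_on_compose2[OF holomorphic_on_imp_continuous_on[OF holU]])
         (use up in \<open>auto intro!: continuous_intros\<close>)
    have contg: "continuous_on {a..b} (g n)" for n
      unfolding g_def
      by (rule continuous_on_compose2[OF holomorphic_on_imp_continuous_on[OF holV]])
         (use down in \<open>auto intro!: continuous_intros\<close>)
    have FA: "((\<lambda>t. A (of_real t + \<i> * of_real (s n))) has_vector_derivative f n t) (at t within {a..b})"
      if "t \<in> {a..b}" for t n
    proof -
      have "(A has_field_derivative K (of_real t + \<i> * of_real (s n))) (at (of_real t + \<i> * of_real (s n)))"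
        using A[OF up[OF that]] at_within_open[OF up[OF that] oU] by simp
      from field_vector_diff_chain_at[OF line this] show ?thesis
        by (auto simp: f_def o_def intro: has_vector_derivative_at_within)
    qed
    have FD: "((\<lambda>t. D (of_real t - \<i> * of_real (s n))) has_vector_derivative g n t) (at t within {a..b})"
      if "t \<in> {a..b}" for t n
    proof -
      have "(D has_field_derivative K2 (of_real t + (- \<i> * of_real (s n)))) (at (of_real t + (- \<i> * of_real (s n))))"
        using D[OF down[OF that]] at_within_open[OF down[OF that] oV] by simp
      from field_vector_diff_chain_at[OF line this] show ?thesis
        by (auto simp: g_def o_def intro: has_vector_derivative_at_within)
    qed
    have IA: "(\<integral>t. indicator {a..b} t *\<^sub>R f n t \<partial>lborel) =
        A (of_real b + \<i> * of_real (s n)) - A (of_real a + \<i> * of_real (s n))" for n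
      using integral_FTC_Icc[OF ab(1), of "\<lambda>t. A (of_real t + \<i> * of_real (s n))" "f n"] FA contf by auto
    have ID: "(\<integral>t. indicator {a..b} t *\<^sub>R g n t \<partial>lborel) =
        D (of_real b - \<i> * of_real (s n)) - D (of_real a - \<i> * of_real (s n))" for n
      using integral_FTC_Icc[OF ab(1), of "\<lambda>t. D (of_real t - \<i> * of_real (s n))" "g n"] FD contg by auto
    have intf: "integrable lborel (\<lambda>t. indicator {a..b} t *\<^sub>R f n t)" for n
      by (rule borel_integrable_compact) (use contf in auto)
    have intg: "integrable lborel (\<lambda>t. indicator {a..b} t *\<^sub>R g n t)" for n
      by (rule borel_integrable_compact) (use contg in auto)
    have gf: "g n t = inverse (cnj (f n t))" for n t
      by (simp add: f_def g_def K2_def)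
    define J where "J = (\<lambda>n t. indicator {a..b} t *\<^sub>R f n t - indicator {a..b} t *\<^sub>R g n t)"
    have "(\<lambda>n. \<integral>t. J n t \<partial>lborel) \<longlonglongrightarrow> (\<integral>t. 0 \<partial>(lborel :: real measure))"
    proof (rule integral_dominated_convergence[where w = "\<lambda>t. indicator {a..b} t *\<^sub>R (1 + 1/c)"])
      show "J n \<in> borel_measurable lborel" for n
        unfolding J_def using intf intg by (intro borel_measurable_diff borel_measurable_integrable)
      show "integrable lborel (\<lambda>t. indicator {a..b} t *\<^sub>R (1 + 1/c))"
        by (rule borel_integrable_compact) auto
      show "AE t in lborel. (\<lambda>n. J n t) \<longlonglongrightarrow> 0"
        using lim
      proof eventually_elim
        fix t assume t: "\<bar>t - x0\<bar> < \<rho> \<longrightarrow>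
                (\<exists>w. norm w = 1 \<and> ((\<lambda>s. K (Complex t s)) \<longlongrightarrow> w) (at_right 0))"
        show "(\<lambda>n. J n t) \<longlonglongrightarrow> 0"
        proof (cases "t \<in> {a..b}")
          case True
          then have "\<bar>t - x0\<bar> < \<rho>" using inI h by fastforce
          then obtain w where w: "norm w = 1" "((\<lambda>s. K (Complex t s)) \<longlongrightarrow> w) (at_right 0)" using t by blast
          have "filterlim s (at_right 0) sequentially"
            using slim s by (auto simp: filterlim_at intro!: always_eventually less_imp_neq[symmetric])
          from filterlim_compose[OF w(2) this] have f: "(\<lambda>n. f n t) \<longlonglongrightarrow> w"
            by (simp add: f_def Complex_eq)
          have w1: "w = inverse (cnj w)"
          proof -
            have "w * cnj w = 1" using w(1) by (simp add: complex_norm_square[symmetric])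
            then show ?thesis by (metis inverse_unique inverse_inverse_eq)
          qed
          have "(\<lambda>n. g n t) \<longlonglongrightarrow> inverse (cnj w)"
            unfolding gf by (intro tendsto_intros f) (use w(1) in auto)
          then have "(\<lambda>n. f n t - g n t) \<longlonglongrightarrow> w - inverse (cnj w)" using f by (intro tendsto_diff)
          then show ?thesis using True w1 by (simp add: J_def)
        qed (simp add: J_def)
      qed
      show "AE t in lborel. norm (J n t) \<le> indicator {a..b} t *\<^sub>R (1 + 1/c)" for n
      proof (rule AE_I2)
        fix t
        show "norm (J n t) \<le> indicator {a..b} t *\<^sub>R (1 + 1/c)"
        proof (cases "t \<in> {a..b}")
          case True
          have "norm (f n t) \<le> 1" using bd'(2)[OF up[OF True]] by (simp add: f_def)
          moreover have "norm (g n t) \<le> 1/c" using K2_bd(2)[OF down[OF True]] by (simp add: g_def)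
          ultimately show ?thesis using True norm_triangle_ineq4[of "f n t" "g n t"] by (simp add: J_def)
        qed (simp add: J_def)
      qed
    qed auto
    moreover have "(\<integral>t. J n t \<partial>lborel) = 
       (A1 (of_real b + \<i> * of_real (s n)) - A1 (of_real a + \<i> * of_real (s n))) -
       (D1 (of_real b - \<i> * of_real (s n)) - D1 (of_real a - \<i> * of_real (s n)))" for n
      unfolding J_def
      by (subst Bochner_Integration.integral_diff[OF intf intg])
         (use IA ID A1(2) D1(2) up down ab in auto)
    ultimately have lim0: "(\<lambda>n. (A1 (of_real b + \<i> * of_real (s n)) - A1 (of_real a + \<i> * of_real (s n))) -
       (D1 (of_real b - \<i> * of_real (s n)) - D1 (of_real a - \<i> * of_real (s n)))) \<longlonglongrightarrow> 0" by simp
    have limA: "(\<lambda>n. A1 (of_real t + \<i> * of_real (s n))) \<longlonglongrightarrow> A1 (of_real t)" if t: "t \<in> {a..b}" for t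
    proof (rule continuous_on_tendsto_compose[OF uniformly_continuous_imp_continuous[OF A1(1)]])
      have "(\<lambda>n. complex_of_real t + \<i> * of_real (s n)) \<longlonglongrightarrow> of_real t + \<i> * of_real 0"
        by (intro tendsto_intros slim)
      then show "(\<lambda>n. complex_of_real t + \<i> * of_real (s n)) \<longlonglongrightarrow> of_real t" by simp
      show "of_real t \<in> closure U" using inI[OF t] h by (intro clU) (auto simp: inB)
    qed (use up t closure_subset in \<open>auto intro!: always_eventually\<close>)
    have limD: "(\<lambda>n. D1 (of_real t - \<i> * of_real (s n))) \<longlonglongrightarrow> D1 (of_real t)" if t: "t \<in> {a..b}" for t
    proof (rule continuous_on_tendsto_compose[OF uniformly_continuous_imp_continuous[OF D1(1)]])
      have "(\<lambda>n. complex_of_real t - \<i> * of_real (s n)) \<longlonglongrightarrow> of_real t - \<i> * of_real 0"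
        by (intro tendsto_intros slim)
      then show "(\<lambda>n. complex_of_real t - \<i> * of_real (s n)) \<longlonglongrightarrow> of_real t" by simp
      show "of_real t \<in> closure V" using inI[OF t] h by (intro clV) (auto simp: inB)
    qed (use down t closure_subset in \<open>auto intro!: always_eventually\<close>)
    have "(\<lambda>n. (A1 (of_real b + \<i> * of_real (s n)) - A1 (of_real a + \<i> * of_real (s n))) -
       (D1 (of_real b - \<i> * of_real (s n)) - D1 (of_real a - \<i> * of_real (s n)))) \<longlonglongrightarrow>
       (A1 (of_real b) - A1 (of_real a)) - (D1 (of_real b) - D1 (of_real a))"
      using ab by (intro tendsto_intros limA limD) auto
    from LIMSEQ_unique[OF this lim0] show ?thesis by simp
  qed
  define d where "d = A1 (of_real x0) - D1 (of_real x0)"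
  have const: "A1 (of_real t) = D1 (of_real t) + d" if "\<bar>t - x0\<bar> < \<rho>" for t
  proof (cases "t \<le> x0")
    case True
    then show ?thesis using step[of t x0] that \<rho> by (simp add: d_def algebra_simps)
  next
    case False
    then show ?thesis using step[of x0 t] that \<rho> by (simp add: d_def algebra_simps)
  qed
  define P where "P = (\<lambda>u. if Im u \<le> 0 then D1 u + d else A1 u)"
  have contP: "continuous_on B P"
    unfolding P_def
  proof (rule continuous_on_cases_le)
    show "continuous_on {x \<in> B. Im x \<le> 0} (\<lambda>u. D1 u + d)"
      by (intro continuous_intros continuous_on_subset[OF uniformly_continuous_imp_continuous[OF D1(1)]])
         (use clV in auto)
    show "continuous_on {x \<in> B. 0 \<le> Im x} A1"
      by (intro continuous_on_subset[OF uniformly_continuous_imp_continuous[OF A1(1)]])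
         (use clU in auto)
    show "continuous_on B Im" by (intro continuous_intros)
    show "D1 x + d = A1 x" if "x \<in> B" "Im x = 0" for x
    proof -
      have "x = of_real (Re x)" using that(2) by (simp add: complex_eq_iff)
      then show ?thesis using const[of "Re x"] inB[of "Re x"] that(1) by simp
    qed
  qed
  have dU: "(P has_field_derivative K u) (at u)" if "u \<in> U" for u
  proof -
    have "(A has_field_derivative K u) (at u)" using A[OF that] at_within_open[OF that oU] by simp
    then show ?thesis
      by (rule has_field_derivative_transform_within_open[OF _ oU that])
         (auto simp: P_def A1(2) U_def)
  qed
  have dV: "(P has_field_derivative K2 u) (at u)" if "u \<in> V" for u
  proof -
    have "((\<lambda>u. D u + d) has_field_derivative K2 u) (at u)" 
      using D[OF that] at_within_open[OF that oV] by (auto intro!: derivative_eq_intros)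
    then show ?thesis
      by (rule has_field_derivative_transform_within_open[OF _ oV that])
         (auto simp: P_def D1(2) V_def)
  qed
  have holP: "P holomorphic_on B"
  proof (rule holomorphic_on_paste_across_line[OF oB, of \<i> _ 0])
    have "P holomorphic_on V" using dV unfolding holomorphic_on_def field_differentiable_def
      using has_field_derivative_at_within by blast
    then show "P holomorphic_on B \<inter> {z. \<i> \<bullet> z < 0}" by (simp add: V_def)
    have "P holomorphic_on U" using dU unfolding holomorphic_on_def field_differentiable_def
      using has_field_derivative_at_within by blast
    then show "P holomorphic_on B \<inter> {z. 0 < \<i> \<bullet> z}" by (simp add: U_def)
  qed (use contP in auto)
  have holL: "deriv P holomorphic_on B" by (rule holomorphic_deriv[OF holP oB])
  have LU: "deriv P u = K u" if "u \<in> U" for u using dU[OF that] by (rule DERIV_imp_deriv)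
  have LV: "deriv P u = K2 u" if "u \<in> V" for u using dV[OF that] by (rule DERIV_imp_deriv)
  have c1: "c \<le> 1"
  proof -
    have "of_real x0 \<in> closure U" using \<rho> by (intro clU) (auto simp: B_def)
    then obtain u where "u \<in> U" by (metis closure_empty empty_iff all_not_in_conv)
    then show ?thesis using bd'[of u] by linarith
  qed
  have bdL: "c \<le> norm (deriv P u) \<and> norm (deriv P u) \<le> 1/c" if u: "u \<in> B" for u
  proof -
    have inU: "c \<le> norm (deriv P u) \<and> norm (deriv P u) \<le> 1/c" if "u \<in> U" for u
    proof -
      have "1 \<le> 1/c" using c1 c by simp
      then show ?thesis using bd'(1,2)[OF that] unfolding LU[OF that] by linarith
    qed
    consider "u \<in> U" | "u \<in> V" | "Im u = 0" using u by (fastforce simp: U_def V_def)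
    then show ?thesis
    proof cases
      case 1 then show ?thesis by (rule inU)
    next
      case 2 then show ?thesis using K2_bd[OF 2] c1 unfolding LV[OF 2] by linarith
    next
      case 3
      have "u \<in> closure U" using u 3 by (intro clU) auto
      then obtain x where x: "\<And>n. x n \<in> U" "x \<longlonglongrightarrow> u" unfolding closure_sequential by blast
      have "(\<lambda>n. deriv P (x n)) \<longlonglongrightarrow> deriv P u"
        by (rule continuous_on_tendsto_compose[OF holomorphic_on_imp_continuous_on[OF holL] x(2) u])
           (use x(1) in \<open>auto simp: U_def\<close>)
      then have "(\<lambda>n. norm (deriv P (x n))) \<longlonglongrightarrow> norm (deriv P u)" by (rule tendsto_norm)
      then show ?thesis using inU x(1)
        by (intro conjI) (rule LIMSEQ_le_const LIMSEQ_le_const2, assumption, blast)+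
    qed
  qed
  show ?thesis
    by (rule that[of "deriv P"]) (use holL LU bdL in \<open>auto simp: B_def U_def\<close>)
qed

section \<open>Analytic extension to boundary points\<close>

lemma analytic_extension_atE:
  assumes "analytic_extension_at F y g"
  obtains r where "r > 0" "g holomorphic_on ball y r" "\<And>z. z \<in> ball y r \<inter> ball 0 1 - {y} \<Longrightarrow> g z = F z"
proof -
  obtain r1 where r1: "r1 > 0" "g holomorphic_on ball y r1"
    using assms by (auto simp: analytic_extension_at_def analytic_at_ball)
  obtain r2 where r2: "r2 > 0" "\<And>z. z \<in> ball 0 1 \<Longrightarrow> z \<noteq> y \<Longrightarrow> dist z y < r2 \<Longrightarrow> g z = F z"
    using assms by (auto simp: analytic_extension_at_def eventually_at)
  show ?thesis
    by (rule that[of "min r1 r2"])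
       (use r1 r2 in \<open>auto simp: dist_commute intro: holomorphic_on_subset\<close>)
qed

lemma in_closure_disc: "norm y = 1 \<Longrightarrow> e > 0 \<Longrightarrow> \<exists>z::complex. norm z < 1 \<and> z \<noteq> y \<and> dist y z < e"
proof -
  assume y: "norm y = 1" and e: "e > 0"
  define d where "d = min (e/2) (1/2)"
  have d: "0 < d" "d < e" "d < 1" using e by (auto simp: d_def)
  have "norm (of_real (1 - d) * y) = 1 - d" using d y by (simp only: norm_mult norm_of_real) simp
  moreover have "dist y (of_real (1 - d) * y) = d"
    using d y by (simp add: dist_norm algebra_simps norm_mult)
  ultimately show ?thesis using d y by (intro exI[of _ "of_real (1 - d) * y"]) auto
qed

lemma analytic_extension_unique:
  assumes g: "analytic_extension_at F y g" and h: "analytic_extension_at F y h" and y: "norm y = 1"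
  shows "g y = h y" "deriv g y = deriv h y"
proof -
  obtain r where r: "r > 0" "g holomorphic_on ball y r" "\<And>z. z \<in> ball y r \<inter> ball 0 1 - {y} \<Longrightarrow> g z = F z"
    using analytic_extension_atE[OF g] by metis
  obtain s where s: "s > 0" "h holomorphic_on ball y s" "\<And>z. z \<in> ball y s \<inter> ball 0 1 - {y} \<Longrightarrow> h z = F z"
    using analytic_extension_atE[OF h] by metis
  define t where "t = min r s"
  have t: "t > 0" using r s by (simp add: t_def)
  obtain z where z: "norm z < 1" "z \<noteq> y" "dist y z < t" using in_closure_disc[OF y t] by blast
  define U where "U = ball y t \<inter> ball 0 1"
  have yU: "y \<notin> U" using y by (simp add: U_def)
  have eq: "g w = h w" if "w \<in> ball y t" for w
  proof -
    have "(\<lambda>w. g w - h w) w = 0"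
    proof (rule analytic_continuation[of "\<lambda>w. g w - h w" "ball y t" U z])
      show "(\<lambda>w. g w - h w) holomorphic_on ball y t"
        by (intro holomorphic_intros holomorphic_on_subset[OF r(2)] holomorphic_on_subset[OF s(2)])
           (auto simp: t_def)
      show "z islimpt U"
        by (rule interior_limit_point) (use z in \<open>simp add: U_def interior_open open_Int\<close>)
      show "g w - h w = 0" if "w \<in> U" for w
      proof -
        have "w \<noteq> y" using that yU by auto
        then show ?thesis using that r(3)[of w] s(3)[of w] by (auto simp: U_def t_def)
      qed
    qed (use z that in \<open>auto simp: U_def\<close>)
    then show ?thesis by simp
  qed
  show "g y = h y" using eq t by simp
  show "deriv g y = deriv h y"
    by (rule deriv_cong_ev) (use t eq in \<open>auto simp: eventually_nhds_metric dist_commute\<close>)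
qed

lemma boundary_deriv_eq:
  assumes "analytic_extension_at F y g" "norm y = 1"
  shows "boundary_deriv F y = deriv g y"
  unfolding boundary_deriv_def
  using assms analytic_extension_unique by (intro the_equality) blast+

lemma radial_filterlim:
  assumes y: "norm (y::complex) = 1"
  shows "filterlim (\<lambda>r::real. of_real r * y) (at y within ball 0 1) (at_left 1)"
proof -
  have "((\<lambda>r::real. of_real r * y) \<longlongrightarrow> of_real 1 * y) (at_left 1)"
    by (intro tendsto_intros)
  moreover have "eventually (\<lambda>r::real. of_real r * y \<in> ball 0 1 \<and> of_real r * y \<noteq> y) (at_left 1)"
  proof -
    have "eventually (\<lambda>r::real. r \<in> {0<..<1}) (at_left 1)"
      by (rule eventually_at_left_real) simp
    then show ?thesis
      by eventually_elim (use y in \<open>auto simp: norm_mult\<close>)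
  qed
  ultimately show ?thesis by (simp add: filterlim_at)
qed

lemma analytic_extension_tendsto:
  assumes g: "analytic_extension_at F y g"
  shows "(F \<longlongrightarrow> g y) (at y within ball 0 1)"
proof -
  have "isCont g y"
    using g by (auto simp: analytic_extension_at_def intro: analytic_at_imp_isCont)
  then have "(g \<longlongrightarrow> g y) (at y within ball 0 1)"
    using continuous_at_imp_continuous_at_within continuous_within by blast
  then show ?thesis
    by (rule Lim_transform_eventually) (use g in \<open>simp add: analytic_extension_at_def\<close>)
qed

lemma boundary_map_eq:
  assumes g: "analytic_extension_at F y g" and y: "norm y = 1"
  shows "boundary_map F y = g y"
  unfolding boundary_map_def
  by (rule tendsto_Lim)
     (auto intro: filterlim_compose[OF analytic_extension_tendsto[OF g] radial_filterlim[OF y]])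

lemma analytic_extension_nearby:
  assumes "r > 0" "g holomorphic_on ball y r" "\<And>z. z \<in> ball y r \<inter> ball 0 1 - {y} \<Longrightarrow> g z = F z"
    and y: "norm y = 1" and \<zeta>: "\<zeta> \<in> ball y r" "norm \<zeta> = 1"
  shows "analytic_extension_at F \<zeta> g"
proof -
  have "g analytic_on {\<zeta>}"
    using assms(2) \<zeta>(1) by (metis analytic_on_open analytic_on_subset empty_subsetI insert_subset open_ball)
  moreover have "eventually (\<lambda>z. z \<in> ball y r) (nhds \<zeta>)"
    using \<zeta>(1) by (rule eventually_nhds_in_open[OF open_ball])
  then have "eventually (\<lambda>w. g w = F w) (at \<zeta> within ball 0 1)"
    unfolding eventually_at_filter
    by eventually_elim (use assms(3) y in auto)
  ultimately show ?thesis by (simp add: analytic_extension_at_def)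
qed

locale inner_fixing_zero =
  fixes F :: "complex \<Rightarrow> complex"
  assumes hol: "F holomorphic_on ball 0 1"
    and maps: "\<And>z. norm z < 1 \<Longrightarrow> norm (F z) < 1"
    and radial: "AE z in circle_measure.
        \<exists>w. norm w = 1 \<and> ((\<lambda>r::real. F (of_real r * z)) \<longlongrightarrow> w) (at_left 1)"
    and F0: "F 0 = 0"
begin

definition "regular = sphere 0 1 - singular_set F"

abbreviation "f \<equiv> boundary_map F"
abbreviation "f' \<equiv> boundary_deriv F"

lemma Schwarz: "norm z < 1 \<Longrightarrow> norm (F z) \<le> norm z"
  by (rule Schwarz_Lemma(1)[OF hol F0]) (auto simp: maps)

text \<open>
  Radial limits are unimodular almost everywhere, hence on a dense set of the arc, so by continuity
  the local extension is unimodular on the whole arc.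
\<close>

lemma regularE:
  assumes "y \<in> regular"
  obtains g r where "r > 0" "g holomorphic_on ball y r"
    "\<And>z. z \<in> ball y r \<Longrightarrow> norm z < 1 \<Longrightarrow> g z = F z"
    "\<And>\<zeta>. \<zeta> \<in> ball y r \<Longrightarrow> norm \<zeta> = 1 \<Longrightarrow> analytic_extension_at F \<zeta> g"
    "\<And>\<zeta>. \<zeta> \<in> ball y r \<Longrightarrow> norm \<zeta> = 1 \<Longrightarrow> \<zeta> \<in> regular \<and> f \<zeta> = g \<zeta> \<and> f' \<zeta> = deriv g \<zeta> \<and> norm (g \<zeta>) = 1"
proof -
  have y: "norm y = 1" using assms by (simp add: regular_def)
  obtain g where g: "analytic_extension_at F y g"
    using assms by (auto simp: regular_def singular_set_def)
  obtain r where r: "r > 0" "g holomorphic_on ball y r" "\<And>z. z \<in> ball y r \<inter> ball 0 1 - {y} \<Longrightarrow> g z = F z"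
    using analytic_extension_atE[OF g] by metis
  have ext: "analytic_extension_at F \<zeta> g" if "\<zeta> \<in> ball y r" "norm \<zeta> = 1" for \<zeta>
    using analytic_extension_nearby[OF r y that] .
  have lim: "norm (g \<zeta>) = 1" if z: "\<zeta> \<in> ball y r" "norm \<zeta> = 1"
     "\<exists>w. norm w = 1 \<and> ((\<lambda>r::real. F (of_real r * \<zeta>)) \<longlongrightarrow> w) (at_left 1)" for \<zeta>
  proof -
    obtain w where w: "norm w = 1" "((\<lambda>r::real. F (of_real r * \<zeta>)) \<longlongrightarrow> w) (at_left 1)"
      using z(3) by blast
    have "((\<lambda>r::real. F (of_real r * \<zeta>)) \<longlongrightarrow> g \<zeta>) (at_left 1)"
      by (rule filterlim_compose[OF analytic_extension_tendsto[OF ext[OF z(1,2)]] radial_filterlim[OF z(2)]])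
    then show ?thesis using w tendsto_unique[OF trivial_limit_at_left_real] by metis
  qed
  have unim: "norm (g \<zeta>) = 1" if \<zeta>: "\<zeta> \<in> ball y r" "norm \<zeta> = 1" for \<zeta>
  proof -
    obtain d where d: "d > 0" "ball \<zeta> d \<subseteq> ball y r"
      using \<zeta>(1) by (meson open_ball open_contains_ball)
    have "\<exists>z. norm z = 1 \<and> dist \<zeta> z < min d (1 / real (Suc n)) \<and> norm (g z) = 1" for n
    proof -
      obtain z where z: "norm z = 1" "dist \<zeta> z < min d (1 / real (Suc n))"
         "\<exists>w. norm w = 1 \<and> ((\<lambda>r::real. F (of_real r * z)) \<longlongrightarrow> w) (at_left 1)"
        using AE_circle_near[OF radial \<zeta>(2), of "min d (1 / real (Suc n))"] d(1) by auto
      moreover have "z \<in> ball y r" using z(2) d(2) by (intro subsetD[OF d(2)]) simp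
      ultimately show ?thesis using lim[of z] by blast
    qed
    then obtain x where x: "\<And>n. norm (x n) = 1" "\<And>n. dist \<zeta> (x n) < min d (1 / real (Suc n))" "\<And>n. norm (g (x n)) = 1"
      by metis
    have "x \<longlonglongrightarrow> \<zeta>"
    proof (rule metric_LIMSEQ_I)
      fix e :: real assume "e > 0"
      then obtain N where N: "1 / real (Suc N) < e" using nat_approx_posE by blast
      have "dist (x n) \<zeta> < e" if "n \<ge> N" for n
      proof -
        have "1 / real (Suc n) \<le> 1 / real (Suc N)" using that by (simp add: frac_le)
        then show ?thesis using x(2)[of n] N by (simp add: dist_commute)
      qed
      then show "\<exists>no. \<forall>n\<ge>no. dist (x n) \<zeta> < e" by blast
    qed
    then have "(\<lambda>n. norm (g (x n))) \<longlonglongrightarrow> norm (g \<zeta>)"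
      using holomorphic_on_imp_continuous_on[OF r(2)] \<zeta>(1) 
      by (intro tendsto_norm) (metis continuous_on_eq_continuous_at isCont_tendsto_compose open_ball)
    then show ?thesis using x(3) by (simp add: LIMSEQ_const_iff)
  qed
  have gF: "g z = F z" if "z \<in> ball y r" "norm z < 1" for z
    using r(3)[of z] that y by auto
  show ?thesis
  proof (rule that[of r g])
    show "\<zeta> \<in> regular \<and> f \<zeta> = g \<zeta> \<and> f' \<zeta> = deriv g \<zeta> \<and> norm (g \<zeta>) = 1"
      if "\<zeta> \<in> ball y r" "norm \<zeta> = 1" for \<zeta>
      using boundary_map_eq[OF ext[OF that] that(2)] boundary_deriv_eq[OF ext[OF that] that(2)]
        unim[OF that] ext[OF that] that(2)
      by (auto simp: regular_def singular_set_def)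
  qed (use r(1,2) gF ext in blast)+
qed

lemma regular_norm: "y \<in> regular \<Longrightarrow> norm y = 1" "y \<in> regular \<Longrightarrow> norm (f y) = 1"
proof -
  show y1: "norm y = 1" if "y \<in> regular" using that by (simp add: regular_def)
  show "norm (f y) = 1" if "y \<in> regular"
    using regularE[OF that] y1[OF that] by (metis centre_in_ball)
qed

text \<open>
  Let D = cnj (f y) f'(y) y. Along the circle Re (cnj (f y) g) has a maximum at y, so D is real; along
  the radius the Schwarz lemma gives 1 - |F (r y)| \<ge> 1 - r, so D \<ge> 1.
\<close>

lemma boundary_deriv_polar:
  assumes y: "y \<in> regular"
  shows "cnj (f y) * f' y * y = of_real (norm (f' y))" "norm (f' y) \<ge> 1"
proof -
  obtain g r where g: "r > 0" "g holomorphic_on ball y r"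
    "\<And>z. z \<in> ball y r \<Longrightarrow> norm z < 1 \<Longrightarrow> g z = F z"
    "\<And>\<zeta>. \<zeta> \<in> ball y r \<Longrightarrow> norm \<zeta> = 1 \<Longrightarrow> f \<zeta> = g \<zeta> \<and> f' \<zeta> = deriv g \<zeta> \<and> norm (g \<zeta>) = 1"
    using regularE[OF y] by metis
  have y1: "norm y = 1" using y by (simp add: regular_def)
  have gy: "f y = g y" "f' y = deriv g y" "norm (g y) = 1" using g(4)[of y] g(1) y1 by auto
  define D where "D = cnj (g y) * deriv g y * y"
  have dg: "(g has_field_derivative deriv g y) (at y)"
    using g(1,2) holomorphic_derivI[OF g(2) open_ball] by simp
  define \<phi> where "\<phi> = (\<lambda>t. Re (cnj (g y) * g (y * cis t)))"
  have gg: "cnj (g y) * g y = 1" using gy(3) by (simp add: complex_norm_square[symmetric] mult.commute)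
  have gy0: "(g has_field_derivative deriv g y) (at (y * exp (\<i> * of_real 0)))" using dg by simp
  have d1: "(\<phi> has_field_derivative Re (D * \<i>)) (at 0)"
  proof -
    have "((\<lambda>u. y * exp (\<i> * u)) has_field_derivative (y * \<i>)) (at (of_real 0))"
      by (auto intro!: derivative_eq_intros)
    from DERIV_chain2[OF gy0 this]
    have "((\<lambda>u. cnj (g y) * g (y * exp (\<i> * u))) has_field_derivative (D * \<i>)) (at (of_real 0))"
      unfolding D_def by (auto intro!: derivative_eq_intros)
    from has_field_derivative_Re[OF has_vector_derivative_real_field[OF this]]
    show ?thesis by (simp add: \<phi>_def cis_conv_exp)
  qed
  have "Re (D * \<i>) = 0"
  proof (rule DERIV_local_max[OF d1 g(1)], intro allI impI)
    fix t :: real assume t: "\<bar>0 - t\<bar> < r"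
    have "y - y * cis t = y * (cis 0 - cis t)" by (simp add: algebra_simps)
    then have "norm (y - y * cis t) \<le> \<bar>0 - t\<bar>" using norm_cis_diff_le[of 0 t] y1 by (simp only: norm_mult)
    then have "y * cis t \<in> ball y r" using t by (simp add: dist_norm)
    then have "norm (g (y * cis t)) = 1" using g(4) y1 by (simp add: norm_mult)
    then have "norm (cnj (g y) * g (y * cis t)) = 1" using gy(3) by (simp add: norm_mult)
    then have "\<phi> t \<le> 1" unfolding \<phi>_def by (metis complex_Re_le_cmod)
    then show "\<phi> t \<le> \<phi> 0" using gg unfolding \<phi>_def cis_zero mult_1_right by (metis one_complex.sel(1))
  qed
  then have imD: "Im D = 0" by simp
  define \<rho> where "\<rho> = (\<lambda>s. Re (cnj (g y) * g ((1 - of_real s) * y)) + s)"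
  have d2: "(\<rho> has_field_derivative Re (- D) + 1) (at 0)"
  proof -
    have gy1: "(g has_field_derivative deriv g y) (at ((1 - of_real 0) * y))" using dg by simp
    have "((\<lambda>u. (1 - u) * y) has_field_derivative (- y)) (at (of_real 0))"
      by (auto intro!: derivative_eq_intros)
    from DERIV_chain2[OF gy1 this]
    have "((\<lambda>u. cnj (g y) * g ((1 - u) * y)) has_field_derivative (- D)) (at (of_real 0))"
      unfolding D_def by (auto intro!: derivative_eq_intros)
    from has_field_derivative_Re[OF has_vector_derivative_real_field[OF this]]
    have "((\<lambda>s. Re (cnj (g y) * g ((1 - of_real s) * y))) has_field_derivative Re (- D)) (at 0)" .
    from DERIV_add[OF this DERIV_ident] show ?thesis unfolding \<rho>_def .
  qed
  have "\<not> Re (- D) + 1 > 0"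
  proof
    assume "Re (- D) + 1 > 0"
    from DERIV_pos_inc_right[OF d2 this] obtain d where d: "d > 0" "\<And>h. h > 0 \<Longrightarrow> h < d \<Longrightarrow> \<rho> 0 < \<rho> (0 + h)" by blast
    define h where "h = min (min d r) 1 / 2"
    have h: "0 < h" "h < d" "h < r" "h < 1" using d(1) g(1) by (auto simp: h_def)
    define z where "z = (1 - complex_of_real h) * y"
    have "z = of_real (1 - h) * y" by (simp add: z_def)
    then have nz: "norm z = 1 - h" using h y1 by (simp only: norm_mult norm_of_real) simp
    have "y - z = of_real h * y" by (simp add: z_def algebra_simps)
    then have "z \<in> ball y r" using h y1 by (simp add: dist_norm norm_mult)
    then have "norm (g z) \<le> 1 - h" using g(3)[of z] Schwarz[of z] nz h by simp
    then have "norm (cnj (g y) * g z) \<le> 1 - h" using gy(3) by (simp add: norm_mult)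
    then have "Re (cnj (g y) * g z) \<le> 1 - h" using complex_Re_le_cmod order_trans by blast
    then have "\<rho> h \<le> 1" by (simp add: \<rho>_def z_def)
    moreover have "\<rho> 0 = 1" using arg_cong[OF gg, of Re] by (simp add: \<rho>_def)
    ultimately show False using d(2)[OF h(1,2)] by simp
  qed
  then have reD: "Re D \<ge> 1" by simp
  have "norm D = norm (f' y)" using gy y1 by (simp add: D_def norm_mult)
  moreover have DR: "D = of_real (Re D)" using imD by (simp add: complex_eq_iff)
  moreover have "norm D = Re D" using DR reD by (metis norm_of_real abs_of_nonneg order_trans zero_le_one)
  ultimately have "D = of_real (norm (f' y))" "norm (f' y) \<ge> 1"
    using reD by simp_all
  then show "cnj (f y) * f' y * y = of_real (norm (f' y))" "norm (f' y) \<ge> 1"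
    unfolding gy(1,2) D_def by simp_all
qed

lemma continuous_on_boundary_deriv: "continuous_on regular f'"
proof -
  have "continuous (at y within regular) f'" if y: "y \<in> regular" for y
  proof -
    obtain g r where g: "r > 0" "g holomorphic_on ball y r"
      "\<And>\<zeta>. \<zeta> \<in> ball y r \<Longrightarrow> norm \<zeta> = 1 \<Longrightarrow> f' \<zeta> = deriv g \<zeta>"
      using regularE[OF y] by metis
    have "eventually (\<lambda>\<zeta>. \<zeta> \<in> ball y r \<and> norm \<zeta> = 1) (at y within regular)"
      using eventually_at_ball[OF g(1), of y regular] by eventually_elim (auto simp: regular_norm)
    then have near: "eventually (\<lambda>\<zeta>. deriv g \<zeta> = f' \<zeta>) (at y within regular)"
      by eventually_elim (use g(3) in simp)
    have "isCont (deriv g) y"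
      using holomorphic_on_imp_continuous_on[OF holomorphic_deriv[OF g(2)]] g(1)
      by (auto simp: continuous_on_eq_continuous_at)
    from continuous_at_imp_continuous_at_within[OF this]
    have "(deriv g \<longlongrightarrow> deriv g y) (at y within regular)" by (simp add: continuous_within)
    from Lim_transform_eventually[OF this near] show ?thesis
      using g(1) g(3)[of y] regular_norm(1)[OF y] by (simp add: continuous_within)
  qed
  then show ?thesis by (auto simp: continuous_on_eq_continuous_within)
qed

end

section \<open>The sublevel set and the singular set\<close>

lemma norm_exp_i_diff_le:
  assumes "Im u \<ge> 0" "Im v \<ge> 0"
  shows "norm (exp (\<i> * u) - exp (\<i> * v)) \<le> norm (u - v)"
proof -
  have "norm (exp (\<i> * u) - exp (\<i> * v)) \<le> 1 * norm (u - v)"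
  proof (rule field_differentiable_bound[of "{u. Im u \<ge> 0}"])
    show "convex {u. Im u \<ge> 0}" by (rule convex_halfspace_Im_ge)
    show "((\<lambda>u. exp (\<i> * u)) has_field_derivative \<i> * exp (\<i> * z)) (at z within {u. 0 \<le> Im u})" for z
      by (auto intro!: derivative_eq_intros)
    show "norm (\<i> * exp (\<i> * z)) \<le> 1" if "z \<in> {u. 0 \<le> Im u}" for z
      using that by (simp add: norm_mult)
  qed (use assms in auto)
  then show ?thesis by simp
qed

locale one_component = inner_fixing_zero +
  fixes c :: real
  assumes c: "0 < c" "c < 1"
    and conn: "connected {z \<in> ball 0 1. norm (F z) < c}"
begin

text \<open>
  The distance \<delta> to the sublevel set is the scale on which F is controlled near a boundary point.
  The fourth root in c1 comes from the four rotated copies in \<open>crossing_square\<close>.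
\<close>

definition "\<Omega> = {z \<in> ball 0 1. norm (F z) < c}"
definition "\<delta> y = infdist y \<Omega>"
definition "c1 = root 4 c"

lemma c1: "0 < c1" "c1 < 1"
  using c by (auto simp: c1_def)

lemma zero_in_\<Omega>: "0 \<in> \<Omega>"
  using c by (simp add: \<Omega>_def F0)

lemma \<delta>_nonneg: "\<delta> y \<ge> 0" by (simp add: \<delta>_def infdist_nonneg)

lemma \<delta>_lipschitz: "\<delta> x \<le> \<delta> y + dist x y"
  unfolding \<delta>_def by (rule infdist_triangle)

lemma continuous_\<delta>: "continuous_on S \<delta>"
  unfolding \<delta>_def by (intro continuous_intros)

lemma small_above_sublevel:
  assumes y: "norm y = 1" and s: "\<delta> y < s" and r: "9 * s \<le> r" "r \<le> 1/5"
  shows "norm (F (of_real (1 - r) * y)) \<le> c1"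
proof -
  obtain z where z: "z \<in> \<Omega>" "dist y z < s"
    using s cInf_lessD[of "(\<lambda>a. dist y a) ` \<Omega>" s] zero_in_\<Omega> by (auto simp: \<delta>_def infdist_def split: if_splits)
  have "norm (F (of_real (1 - r) * y)) ^ 4 \<le> c"
  proof (rule sublevel_point_near_circle[OF hol _ conn _ y, of z])
    show "9 * norm (z - y) \<le> r" using z(2) r by (simp add: dist_norm norm_minus_commute)
  qed (use z r c maps less_imp_le in \<open>auto simp: \<Omega>_def F0\<close>)
  then have "root 4 (norm (F (of_real (1 - r) * y)) ^ 4) \<le> root 4 c" by (intro real_root_le_mono) auto
  then show ?thesis by (simp add: c1_def real_root_power_cancel)
qed

lemma \<delta>_pos_if_regular:
  assumes "y \<in> regular"
  shows "\<delta> y > 0"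
proof -
  obtain g r where g: "r > 0" "g holomorphic_on ball y r"
    "\<And>z. z \<in> ball y r \<Longrightarrow> norm z < 1 \<Longrightarrow> g z = F z"
    "\<And>\<zeta>. \<zeta> \<in> ball y r \<Longrightarrow> norm \<zeta> = 1 \<Longrightarrow> norm (g \<zeta>) = 1"
    using regularE[OF assms] by metis
  have "norm (g y) = 1" using g(1,4) regular_norm(1)[OF assms] by simp
  moreover have "isCont (\<lambda>z. norm (g z)) y"
    using holomorphic_on_imp_continuous_on[OF g(2)] g(1) by (auto simp: continuous_on_eq_continuous_at intro!: continuous_intros)
  ultimately have "eventually (\<lambda>z. norm (g z) > c) (nhds y)"
    using c(2) order_tendstoD(1)[of "\<lambda>z. norm (g z)" _ "nhds y"] by (metis isCont_def tendsto_nhds_iff)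
  then obtain d where d: "d > 0" "\<And>z. dist z y < d \<Longrightarrow> norm (g z) > c" by (auto simp: eventually_nhds_metric)
  have "min d r \<le> dist y z" if "z \<in> \<Omega>" for z
  proof (rule ccontr)
    assume "\<not> min d r \<le> dist y z"
    then have "dist y z < d" "dist y z < r" by simp_all
    then have "norm (g z) > c" "g z = F z" using d(2)[of z] g(3)[of z] that by (auto simp: dist_commute \<Omega>_def)
    then show False using that by (simp add: \<Omega>_def)
  qed
  then have "min d r \<le> \<delta> y" unfolding \<delta>_def infdist_def using zero_in_\<Omega> by (auto intro!: cINF_greatest)
  then show ?thesis using d(1) g(1) by linarith
qed

text \<open>
  In the coordinate z = exp (i u) the function is bounded below on the half disc of radius \<delta> y and
  extends across by reflection, with modulus between c and 1/c; Cauchy's estimate on half the radius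
  bounds the derivative.
\<close>

lemma regular_if_\<delta>_pos:
  assumes y: "norm y = 1" and pos: "\<delta> y > 0"
  shows "y \<in> regular" "norm (f' y) \<le> 2 / (c * \<delta> y)"
proof -
  obtain t0 where t0: "y = cis t0" using complex_unimodular_polar[OF y] by (metis cis.ctr)
  define \<rho> where "\<rho> = \<delta> y"
  define K where "K = (\<lambda>u. F (exp (\<i> * u)))"
  have far: "norm (F z) \<ge> c" if "norm z < 1" "dist y z < \<rho>" for z
  proof (rule ccontr)
    assume "\<not> norm (F z) \<ge> c"
    then have "z \<in> \<Omega>" using that by (simp add: \<Omega>_def)
    then show False using infdist_le[of z \<Omega> y] that by (simp add: \<rho>_def \<delta>_def)
  qed
  obtain L where L: "L holomorphic_on ball (of_real t0) \<rho>"
    "\<And>u. u \<in> ball (of_real t0) \<rho> \<Longrightarrow> Im u > 0 \<Longrightarrow> L u = K u"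
    "\<And>u. u \<in> ball (of_real t0) \<rho> \<Longrightarrow> c \<le> norm (L u) \<and> norm (L u) \<le> 1 / c"
  proof (rule reflection_extension[of \<rho> c K t0])
    show "0 < \<rho>" using pos by (simp add: \<rho>_def)
    have "F \<circ> (\<lambda>u. exp (\<i> * u)) holomorphic_on ball (of_real t0) \<rho> \<inter> {u. 0 < Im u}"
      by (rule holomorphic_on_compose_gen[OF _ hol]) (auto intro!: holomorphic_intros)
    then show "K holomorphic_on ball (of_real t0) \<rho> \<inter> {u. 0 < Im u}" by (simp add: K_def o_def)
    show "c \<le> norm (K u) \<and> norm (K u) \<le> 1" if u: "u \<in> ball (of_real t0) \<rho>" "0 < Im u" for u
    proof -
      have "norm (exp (\<i> * of_real t0) - exp (\<i> * u)) \<le> norm (of_real t0 - u)"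
        by (rule norm_exp_i_diff_le) (use u in auto)
      then have "dist y (exp (\<i> * u)) < \<rho>" using u(1) by (simp add: t0 cis_conv_exp dist_norm)
      moreover have "norm (exp (\<i> * u)) < 1" using u(2) by simp
      ultimately show ?thesis using far maps less_imp_le unfolding K_def by blast
    qed
    show "AE t in lborel. \<bar>t - t0\<bar> < \<rho> \<longrightarrow>
        (\<exists>w. norm w = 1 \<and> ((\<lambda>s. K (Complex t s)) \<longlongrightarrow> w) (at_right 0))"
      using AE_circle_imp_AE_arguments[OF radial]
    proof eventually_elim
      fix t assume "\<exists>w. norm w = 1 \<and> ((\<lambda>r. F (of_real r * cis t)) \<longlongrightarrow> w) (at_left 1)"
      then obtain w where w: "norm w = 1" "((\<lambda>r. F (of_real r * cis t)) \<longlongrightarrow> w) (at_left 1)" by blast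
      have "filterlim (\<lambda>s::real. exp (- s)) (at_left 1) (at_right 0)" by real_asymp
      from filterlim_compose[OF w(2) this]
      have "((\<lambda>s. F (of_real (exp (-s)) * cis t)) \<longlongrightarrow> w) (at_right 0)" .
      moreover have "of_real (exp (-s)) * cis t = exp (\<i> * Complex t s)" for s
        by (simp add: exp_eq_polar)
      ultimately show "\<bar>t - t0\<bar> < \<rho> \<longrightarrow> (\<exists>w. norm w = 1 \<and> ((\<lambda>s. K (Complex t s)) \<longlongrightarrow> w) (at_right 0))"
        using w(1) by (auto simp: K_def)
    qed
  qed (use c in auto)
  define h where "h = (\<lambda>z. of_real t0 - \<i> * Ln (z / y))"
  define g where "g = (\<lambda>z. L (h z))"
  have y0: "y \<noteq> 0" using y by auto
  have hy: "h y = of_real t0" using y0 by (simp add: h_def)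
  have dh: "(h has_field_derivative (- \<i> / y)) (at y)"
    unfolding h_def using y0 by (auto intro!: derivative_eq_intros simp: complex_nonpos_Reals_iff)
  have "isCont h y" using dh by (rule DERIV_isCont)
  then have "eventually (\<lambda>z. h z \<in> ball (of_real t0) \<rho>) (nhds y)"
    using hy pos unfolding isCont_def tendsto_nhds_iff[symmetric]
    by (intro topological_tendstoD[of h "h y"]) (auto simp: \<rho>_def tendsto_nhds_iff)
  moreover have "eventually (\<lambda>z. z \<noteq> 0 \<and> z / y \<notin> \<real>\<^sub>\<le>\<^sub>0) (nhds y)"
  proof (rule eventually_nhds_in_open[of "{z. z \<noteq> 0 \<and> z / y \<notin> \<real>\<^sub>\<le>\<^sub>0}", simplified])
    have "open (UNIV \<inter> (\<lambda>z. z / y) -` (- \<real>\<^sub>\<le>\<^sub>0))"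
      by (rule continuous_open_preimage) (use y0 in \<open>auto intro!: continuous_intros\<close>)
    moreover have "{z. z \<noteq> 0 \<and> z / y \<notin> \<real>\<^sub>\<le>\<^sub>0} = UNIV \<inter> (\<lambda>z. z / y) -` (- \<real>\<^sub>\<le>\<^sub>0)" by auto
    ultimately show "open {z. z \<noteq> 0 \<and> z / y \<notin> \<real>\<^sub>\<le>\<^sub>0}" by simp
  qed (use y0 in auto)
  ultimately have "eventually (\<lambda>z. h z \<in> ball (of_real t0) \<rho> \<and> z \<noteq> 0 \<and> z / y \<notin> \<real>\<^sub>\<le>\<^sub>0) (nhds y)"
    by eventually_elim simp
  then obtain U where U: "open U" "y \<in> U" "\<And>z. z \<in> U \<Longrightarrow> h z \<in> ball (of_real t0) \<rho> \<and> z \<noteq> 0 \<and> z / y \<notin> \<real>\<^sub>\<le>\<^sub>0"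
    unfolding eventually_nhds by blast
  have "h holomorphic_on U" unfolding h_def using U(3) y0 by (auto intro!: holomorphic_intros)
  then have "L \<circ> h holomorphic_on U" by (rule holomorphic_on_compose_gen[OF _ L(1)]) (use U(3) in auto)
  then have "g analytic_on {y}" using U(1,2) by (auto simp: g_def o_def analytic_on_holomorphic)
  moreover have "eventually (\<lambda>z. g z = F z) (at y within ball 0 1)"
    unfolding eventually_at_topological
  proof (intro exI[of _ U] conjI ballI impI U)
    fix z assume z: "z \<in> U" "z \<noteq> y" "z \<in> ball 0 1"
    have "Im (h z) > 0" using z(3) U(3)[OF z(1)] y y0 by (simp add: h_def norm_divide ln_less_zero)
    moreover have "exp (\<i> * h z) = z"
      using U(3)[OF z(1)] y0 by (simp add: h_def algebra_simps exp_add t0 cis_conv_exp)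
    ultimately show "g z = F z" using L(2)[of "h z"] U(3)[OF z(1)] by (simp add: g_def K_def)
  qed
  ultimately have ext: "analytic_extension_at F y g" by (simp add: analytic_extension_at_def)
  then show "y \<in> regular" using y by (auto simp: regular_def singular_set_def)
  have "(L has_field_derivative deriv L (h y)) (at (h y))"
    using holomorphic_derivI[OF L(1) open_ball, of "h y"] hy pos by (simp add: \<rho>_def)
  from DERIV_chain2[OF this dh] have "deriv g y = deriv L (of_real t0) * (- \<i> / y)"
    unfolding g_def hy by (rule DERIV_imp_deriv)
  then have "norm (f' y) = norm (deriv L (of_real t0))"
    using boundary_deriv_eq[OF ext y] y by (simp add: norm_mult norm_divide)
  also have "norm ((deriv ^^ 1) L (of_real t0)) \<le> fact 1 * (1/c) / (\<rho>/2) ^ 1"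
  proof (rule Cauchy_inequality)
    show "L holomorphic_on ball (of_real t0) (\<rho>/2)"
      using pos by (intro holomorphic_on_subset[OF L(1)]) (auto simp: \<rho>_def)
    show "continuous_on (cball (of_real t0) (\<rho>/2)) L"
      using pos by (intro continuous_on_subset[OF holomorphic_on_imp_continuous_on[OF L(1)]]) (auto simp: \<rho>_def)
    show "norm (L x) \<le> 1 / c" if "norm (of_real t0 - x) = \<rho>/2" for x
      using L(3)[of x] that pos by (simp add: dist_norm \<rho>_def)
  qed (use pos in \<open>simp add: \<rho>_def\<close>)
  then have "norm (deriv L (of_real t0)) \<le> 2 / (c * \<delta> y)" by (simp add: \<rho>_def mult.commute)
  finally show "norm (f' y) \<le> 2 / (c * \<delta> y)" by simp
qed

lemma regular_iff: "y \<in> regular \<longleftrightarrow> norm y = 1 \<and> \<delta> y > 0"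
  using \<delta>_pos_if_regular regular_if_\<delta>_pos regular_norm by blast

text \<open>
  Where \<delta> vanishes, |F| \<le> c1 on the whole end of the radius, so the radial limit cannot be unimodular.
\<close>

lemma AE_regular: "AE y in circle_measure. y \<in> regular"
  using radial AE_circle_in_sphere
proof eventually_elim
  fix y :: complex
  assume "\<exists>w. norm w = 1 \<and> ((\<lambda>r. F (of_real r * y)) \<longlongrightarrow> w) (at_left 1)" and "y \<in> sphere 0 1"
  then obtain w where w: "norm w = 1" "((\<lambda>r. F (of_real r * y)) \<longlongrightarrow> w) (at_left 1)" and y: "norm y = 1" by auto
  show "y \<in> regular"
  proof (rule ccontr)
    assume "y \<notin> regular"
    then have \<delta>0: "\<delta> y = 0" using y \<delta>_nonneg[of y] by (auto simp: regular_iff)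
    have "eventually (\<lambda>r::real. r \<in> {4/5<..<1}) (at_left 1)"
      by (rule eventually_at_left_real) simp
    then have "eventually (\<lambda>r. norm (F (of_real r * y)) \<le> c1) (at_left 1)"
    proof eventually_elim
      case (elim r)
      then show ?case using small_above_sublevel[OF y, of "(1 - r) / 9" "1 - r"] \<delta>0 by simp
    qed
    then have "norm w \<le> c1"
      by (rule tendsto_upperbound[OF tendsto_norm[OF w(2)]]) simp
    then show False using w(1) c1 by simp
  qed
qed

end

section \<open>Fibres of the boundary map and Poisson kernels\<close>

definition poisson :: "complex \<Rightarrow> complex \<Rightarrow> real" where
  "poisson z w = (1 - (norm z)\<^sup>2) / (norm (w - z))\<^sup>2"

definition herglotz :: "complex \<Rightarrow> complex \<Rightarrow> complex" where
  "herglotz w z = (w + z) / (w - z)"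

lemma Re_herglotz:
  assumes "norm w = 1"
  shows "Re (herglotz w z) = poisson z w"
proof -
  have "herglotz w z = (w + z) * cnj (w - z) / of_real ((norm (w - z))\<^sup>2)"
    unfolding herglotz_def by (subst complex_div_cnj) simp
  then have "Re (herglotz w z) = Re ((w + z) * cnj (w - z)) / (norm (w - z))\<^sup>2"
    by (simp only: Re_divide_of_real)
  also have "Re ((w + z) * cnj (w - z)) = (norm w)\<^sup>2 - (norm z)\<^sup>2"
    by (simp only: cmod_power2) (simp add: algebra_simps power2_eq_square)
  finally show ?thesis using assms by (simp add: poisson_def)
qed

lemma poisson_nonneg: "norm z \<le> 1 \<Longrightarrow> poisson z w \<ge> 0"
  by (simp add: poisson_def power_le_one)

lemma poisson_bounds:
  assumes w: "norm w = 1" and z: "norm z < 1"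
  shows "poisson z w \<le> (1 + norm z) / (1 - norm z)" "(1 - norm z) / (1 + norm z) \<le> poisson z w"
proof -
  have a: "1 - norm z \<le> norm (w - z)" "norm (w - z) \<le> 1 + norm z"
    using norm_triangle_ineq2[of w z] norm_triangle_ineq4[of w z] w by simp_all
  have e: "1 - (norm z)\<^sup>2 = (1 - norm z) * (1 + norm z)" by (simp add: power2_eq_square algebra_simps)
  have "poisson z w \<le> (1 - norm z) * (1 + norm z) / (1 - norm z)\<^sup>2"
    unfolding poisson_def e using a z by (intro divide_left_mono power_mono mult_pos_pos zero_less_power) auto
  then show "poisson z w \<le> (1 + norm z) / (1 - norm z)" using z by (simp add: power2_eq_square)
  have "(1 - norm z) * (1 + norm z) / (1 + norm z)\<^sup>2 \<le> poisson z w"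
    unfolding poisson_def e using a z by (intro divide_left_mono power_mono mult_pos_pos) auto
  moreover have "1 + norm z \<noteq> 0" using norm_ge_zero[of z] by linarith
  ultimately show "(1 - norm z) / (1 + norm z) \<le> poisson z w" by (simp add: power2_eq_square)
qed

text \<open>
  By compactness of the circle the boundary bounds hold uniformly near it, and the minimum principle
  applies on a slightly smaller disc.
\<close>

lemma Re_nonneg_if_boundary_nonneg:
  assumes hol: "Q holomorphic_on ball 0 1"
    and bd: "\<And>\<zeta> e. norm \<zeta> = 1 \<Longrightarrow> e > 0 \<Longrightarrow> eventually (\<lambda>z. Re (Q z) \<ge> - e) (at \<zeta> within ball 0 1)"
    and z: "norm z < 1"
  shows "Re (Q z) \<ge> 0"
proof (rule field_le_epsilon)
  fix e :: real assume e: "e > 0"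
  have "\<exists>r<1. \<forall>w. r < norm w \<and> norm w < 1 \<longrightarrow> Re (Q w) \<ge> - e"
  proof (rule ccontr)
    assume *: "\<not> ?thesis"
    have "\<exists>w. 1 - 1 / real (Suc n) < norm w \<and> norm w < 1 \<and> Re (Q w) < - e" for n
      using *[unfolded not_ex, rule_format, of "1 - 1 / real (Suc n)"] by (force simp: not_le)
    then obtain w where w: "\<And>n. 1 - 1 / real (Suc n) < norm (w n)" "\<And>n. norm (w n) < 1" "\<And>n. Re (Q (w n)) < - e"
      by metis
    have "\<forall>n. w n \<in> cball 0 1" using w(2) by (simp add: less_imp_le)
    then obtain l s where l: "strict_mono s" "(w \<circ> s) \<longlonglongrightarrow> l"
      using compact_cball[of "0::complex" 1] unfolding compact_def by metis
    have "(\<lambda>n. norm (w n)) \<longlonglongrightarrow> 1"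
    proof (rule tendsto_sandwich[of "\<lambda>n. 1 - 1 / real (Suc n)" _ _ "\<lambda>n. 1"])
      show "(\<lambda>n. 1 - 1 / real (Suc n)) \<longlonglongrightarrow> 1" by real_asymp
    qed (use less_imp_le[OF w(1)] less_imp_le[OF w(2)] in \<open>auto intro!: always_eventually\<close>)
    then have "(\<lambda>n. norm ((w \<circ> s) n)) \<longlonglongrightarrow> 1" using LIMSEQ_subseq_LIMSEQ[OF _ l(1)] by (auto simp: o_def)
    with tendsto_norm[OF l(2)] have l1: "norm l = 1" using LIMSEQ_unique by blast
    have "filterlim (w \<circ> s) (at l within ball 0 1) sequentially"
      using l(2) w(2) l1 by (auto simp: filterlim_at intro!: always_eventually) (metis less_irrefl)
    from eventually_compose_filterlim[OF bd[OF l1 e] this]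
    obtain n where "Re (Q ((w \<circ> s) n)) \<ge> - e" by (auto simp: eventually_sequentially)
    then show False using w(3)[of "s n"] by simp
  qed
  then obtain r where r: "r < 1" "\<And>w. r < norm w \<Longrightarrow> norm w < 1 \<Longrightarrow> Re (Q w) \<ge> - e" by blast
  define t where "t = (max (max r (norm z)) 0 + 1) / 2"
  have t: "r < t" "norm z < t" "t < 1" "0 < t" using r(1) z by (auto simp: t_def max_def)
  have "Re (- Q z) \<le> e"
  proof (rule maximum_real_frontier[of "\<lambda>z. - Q z" "ball 0 t"])
    show "(\<lambda>z. - Q z) holomorphic_on interior (ball 0 t)"
      using t by (intro holomorphic_intros holomorphic_on_subset[OF hol]) auto
    show "continuous_on (closure (ball 0 t)) (\<lambda>z. - Q z)"
      using t by (intro continuous_intros continuous_on_subset[OF holomorphic_on_imp_continuous_on[OF hol]]) auto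
    show "Re (- Q w) \<le> e" if "w \<in> frontier (ball 0 t)" for w
      using r(2)[of w] that t by simp
  qed (use t in auto)
  then show "0 \<le> Re (Q z) + e" by simp
qed

lemma herglotz_tendsto:
  assumes "norm y = 1" "norm \<zeta> = 1" "\<zeta> \<noteq> y"
  shows "((\<lambda>z. Re (herglotz y z)) \<longlongrightarrow> 0) (at \<zeta> within S)"
proof -
  have "((\<lambda>z. Re (herglotz y z)) \<longlongrightarrow> Re (herglotz y \<zeta>)) (at \<zeta> within S)"
    unfolding herglotz_def using assms by (intro tendsto_intros) auto
  then show ?thesis using assms by (simp add: Re_herglotz poisson_def)
qed

context one_component
begin

definition "fibre x = {y \<in> regular. f y = x}"

text \<open>
  Both terms have a simple pole at \<zeta>, with the same residue by \<open>boundary_deriv_polar\<close>. So the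
  difference extends continuously to \<zeta>, and on the circle near \<zeta> both terms are purely imaginary.
\<close>

lemma herglotz_pole_cancel:
  assumes \<zeta>: "\<zeta> \<in> regular"
  shows "((\<lambda>z. Re (herglotz (f \<zeta>) (F z) - herglotz \<zeta> z / of_real (norm (f' \<zeta>)))) \<longlongrightarrow> 0) (at \<zeta> within ball 0 1)"
proof -
  define x where "x = f \<zeta>"
  define k where "k = norm (f' \<zeta>)"
  obtain g r where g: "r > 0" "g holomorphic_on ball \<zeta> r"
    "\<And>z. z \<in> ball \<zeta> r \<Longrightarrow> norm z < 1 \<Longrightarrow> g z = F z"
    "\<And>y. y \<in> ball \<zeta> r \<Longrightarrow> norm y = 1 \<Longrightarrow> f y = g y \<and> f' y = deriv g y \<and> norm (g y) = 1"
    using regularE[OF \<zeta>] by metis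
  have n: "norm \<zeta> = 1" "norm x = 1" using regular_norm[OF \<zeta>] by (auto simp: x_def)
  have gx: "g \<zeta> = x" "deriv g \<zeta> = f' \<zeta>" using g(1) g(4)[of \<zeta>] n by (auto simp: x_def)
  have k: "k \<ge> 1" "k > 0" using boundary_deriv_polar(2)[OF \<zeta>] by (auto simp: k_def)
  have polar: "f' \<zeta> * \<zeta> = of_real k * x"
  proof -
    have "cnj x * (f' \<zeta> * \<zeta>) = of_real k" using boundary_deriv_polar(1)[OF \<zeta>] by (simp add: x_def k_def mult.assoc)
    then have "x * (cnj x * (f' \<zeta> * \<zeta>)) = x * of_real k" by simp
    moreover have "x * cnj x = 1" using n(2) by (simp add: complex_norm_square[symmetric])
    ultimately show ?thesis by (metis mult.assoc mult.commute mult_1)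
  qed
  define B where "B = ball \<zeta> r"
  have in_int: "\<zeta> \<in> interior B" using g(1) by (simp add: B_def)
  have oB: "open B" "\<zeta> \<in> B" using g(1) by (simp_all add: B_def)
  define q where "q = (\<lambda>z. if z = \<zeta> then deriv g \<zeta> else (g z - g \<zeta>) / (z - \<zeta>))"
  have hq: "q holomorphic_on B" unfolding q_def by (rule pole_lemma[OF _ in_int]) (use g(2) in \<open>simp add: B_def\<close>)
  \<comment> \<open>N is the numerator of the difference over a common denominator with the factor z - \<zeta> cancelled; N2 cancels another.\<close>
  define N where "N = (\<lambda>z. (x + g z) * of_real k - (\<zeta> + z) * q z)"
  have hN: "N holomorphic_on B" unfolding N_def using g(2) hq by (auto intro!: holomorphic_intros simp: B_def)
  have N0: "N \<zeta> = 0" using polar by (simp add: N_def gx q_def algebra_simps)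
  define N2 where "N2 = (\<lambda>z. if z = \<zeta> then deriv N \<zeta> else (N z - N \<zeta>) / (z - \<zeta>))"
  have hN2: "N2 holomorphic_on B" unfolding N2_def by (rule pole_lemma[OF hN in_int])
  define E where "E = (\<lambda>z. - N2 z / (of_real k * q z))"
  have q\<zeta>: "q \<zeta> \<noteq> 0" using k by (auto simp: q_def gx k_def)
  have cq: "isCont q \<zeta>" and cN2: "isCont N2 \<zeta>"
    using holomorphic_on_imp_continuous_on[OF hq] holomorphic_on_imp_continuous_on[OF hN2] oB
    by (auto simp: continuous_on_eq_continuous_at)
  have cE: "isCont E \<zeta>" unfolding E_def using k q\<zeta>
    by (intro isCont_divide isCont_minus isCont_mult continuous_const cq cN2) simp
  have "eventually (\<lambda>z. q z \<noteq> 0) (nhds \<zeta>)"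
    by (rule tendsto_imp_eventually_ne[of q "q \<zeta>"]) (use cq q\<zeta> in \<open>auto simp: isCont_def tendsto_nhds_iff\<close>)
  moreover have "eventually (\<lambda>z. z \<in> B) (nhds \<zeta>)" by (rule eventually_nhds_in_open[OF oB])
  ultimately have ev: "eventually (\<lambda>z. q z \<noteq> 0 \<and> z \<in> B) (nhds \<zeta>)" by eventually_elim simp
  have E_eq: "E z = herglotz x (g z) - herglotz \<zeta> z / of_real k \<and> g z \<noteq> x" if "q z \<noteq> 0" "z \<noteq> \<zeta>" for z
  proof -
    define u where "u = z - \<zeta>"
    have u: "u \<noteq> 0" "\<zeta> - z = - u" using that by (auto simp: u_def)
    have gz: "x - g z = - (u * q z)" using that(2) by (simp add: q_def gx u_def)
    have "N2 z = N z / u" using that(2) N0 by (simp add: N2_def u_def)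
    then have "E z = - N z / (u * of_real k * q z)" by (simp add: E_def mult.assoc)
    also have "\<dots> = - ((x + g z) * of_real k - (\<zeta> + z) * q z) / (u * of_real k * q z)" by (simp only: N_def)
    also have "\<dots> = (x + g z) / (- (u * q z)) - (\<zeta> + z) / (- u) / of_real k"
      using u(1) that(1) k by (simp add: field_simps)
    finally show ?thesis using gz u that by (auto simp: herglotz_def)
  qed
  have "Re (E \<zeta>) = 0"
  proof -
    define s where "s = (\<lambda>n. \<zeta> * cis (1 / real (Suc n)))"
    have slim: "s \<longlonglongrightarrow> \<zeta>"
    proof -
      have "(\<lambda>n. 1 / real (Suc n)) \<longlonglongrightarrow> 0" by real_asymp
      moreover have "isCont cis 0"
        using continuous_on_cis[OF continuous_on_id, of UNIV] by (simp add: continuous_on_eq_continuous_at)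
      ultimately have "s \<longlonglongrightarrow> \<zeta> * cis 0" unfolding s_def
        by (intro tendsto_mult tendsto_const isCont_tendsto_compose[of 0 cis])
      then show ?thesis by simp
    qed
    have sn: "norm (s n) = 1" "s n \<noteq> \<zeta>" for n
    proof -
      show "norm (s n) = 1" using n by (simp add: s_def norm_mult)
      have "0 < 1 / real (Suc n)" "1 / real (Suc n) \<le> 1" by auto
      then have "sin (1 / real (Suc n)) > 0" using pi_gt3 by (intro sin_gt_zero) linarith+
      then have "cis (1 / real (Suc n)) \<noteq> 1" by (auto simp: complex_eq_iff)
      then show "s n \<noteq> \<zeta>" using n by (auto simp: s_def)
    qed
    have "eventually (\<lambda>n. q (s n) \<noteq> 0 \<and> s n \<in> B) sequentially"
      by (rule eventually_compose_filterlim[OF ev slim])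
    then have "eventually (\<lambda>n. Re (E (s n)) = 0) sequentially"
    proof eventually_elim
      case (elim m)
      have "norm (g (s m)) = 1" using g(4)[of "s m"] elim sn by (simp add: B_def)
      then show ?case using E_eq[of "s m"] elim sn n k by (simp add: Re_herglotz poisson_def)
    qed
    moreover have "(\<lambda>n. Re (E (s n))) \<longlonglongrightarrow> Re (E \<zeta>)"
      by (intro tendsto_Re isCont_tendsto_compose[OF cE slim])
    ultimately have "(\<lambda>n. 0) \<longlonglongrightarrow> Re (E \<zeta>)" by (rule Lim_transform_eventually[rotated])
    then show ?thesis by (simp add: LIMSEQ_const_iff)
  qed
  moreover have "((\<lambda>z. Re (E z)) \<longlongrightarrow> Re (E \<zeta>)) (at \<zeta> within ball 0 1)"
    using continuous_at_imp_continuous_at_within[OF cE] by (intro tendsto_Re) (simp add: continuous_within)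
  ultimately have lim0: "((\<lambda>z. Re (E z)) \<longlongrightarrow> 0) (at \<zeta> within ball 0 1)" by simp
  have "eventually (\<lambda>z. Re (E z) = Re (herglotz x (F z) - herglotz \<zeta> z / of_real k)) (at \<zeta> within ball 0 1)"
    unfolding eventually_at_filter using ev
  proof (eventually_elim, intro impI)
    fix z assume z: "q z \<noteq> 0 \<and> z \<in> B" "z \<noteq> \<zeta>" "z \<in> ball 0 1"
    then have "g z = F z" using g(3)[of z] by (simp add: B_def)
    then show "Re (E z) = Re (herglotz x (F z) - herglotz \<zeta> z / of_real k)"
      using E_eq[of z] z by simp
  qed
  from Lim_transform_eventually[OF lim0 this] show ?thesis unfolding x_def k_def .
qed

lemma herglotz_F_tendsto:
  assumes \<zeta>: "\<zeta> \<in> regular" and x: "norm x = 1" "f \<zeta> \<noteq> x"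
  shows "((\<lambda>z. Re (herglotz x (F z))) \<longlongrightarrow> 0) (at \<zeta> within ball 0 1)"
proof -
  obtain g where g: "analytic_extension_at F \<zeta> g" "f \<zeta> = g \<zeta>"
    using regularE[OF \<zeta>] regular_norm[OF \<zeta>] by (metis centre_in_ball)
  have "((\<lambda>z. Re (herglotz x (F z))) \<longlongrightarrow> Re (herglotz x (g \<zeta>))) (at \<zeta> within ball 0 1)"
    unfolding herglotz_def using x g by (intro tendsto_intros analytic_extension_tendsto) auto
  then show ?thesis using regular_norm(2)[OF \<zeta>] g x by (simp add: Re_herglotz poisson_def)
qed

text \<open>
  The real part is the Poisson kernel P_{F z}(x) minus the contribution of the points of Y, with their
  weights. It tends to 0 at every regular point except at the points of the fibre outside Y.
\<close>

definition remainder :: "complex \<Rightarrow> complex set \<Rightarrow> complex \<Rightarrow> complex" where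
  "remainder x Y z = herglotz x (F z) - (\<Sum>y\<in>Y. herglotz y z / of_real (norm (f' y)))"

lemma remainder_holomorphic:
  assumes "norm x = 1" "Y \<subseteq> fibre x"
  shows "remainder x Y holomorphic_on ball 0 1"
proof -
  have "x - F z \<noteq> 0" if "norm z < 1" for z using assms(1) maps[OF that] by auto
  moreover have "y - z \<noteq> 0" if "norm z < 1" "y \<in> Y" for y z
    using that assms(2) regular_norm by (force simp: fibre_def)
  moreover have "norm (f' y) \<noteq> 0" if "y \<in> Y" for y
    using boundary_deriv_polar(2)[of y] that assms(2) by (auto simp: fibre_def)
  ultimately show ?thesis
    unfolding remainder_def herglotz_def by (auto intro!: holomorphic_intros hol)
qed

lemma Re_remainder:
  assumes "norm x = 1" "Y \<subseteq> fibre x"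
  shows "Re (remainder x Y z) = poisson (F z) x - (\<Sum>y\<in>Y. poisson z y / norm (f' y))"
proof -
  have "Re (\<Sum>y\<in>Y. herglotz y z / of_real (norm (f' y))) = (\<Sum>y\<in>Y. poisson z y / norm (f' y))"
    unfolding Re_sum using assms(2) regular_norm
    by (intro sum.cong) (auto simp: fibre_def Re_herglotz)
  then show ?thesis using assms(1) by (simp add: remainder_def Re_herglotz)
qed

lemma other_poles_tendsto:
  assumes "finite Y" "Y \<subseteq> fibre x" "norm \<zeta> = 1"
  shows "((\<lambda>z. \<Sum>y\<in>Y - {\<zeta>}. Re (herglotz y z / of_real (norm (f' y)))) \<longlongrightarrow> 0) (at \<zeta> within ball 0 1)"
proof -
  have "((\<lambda>z. \<Sum>y\<in>Y - {\<zeta>}. Re (herglotz y z) / norm (f' y)) \<longlongrightarrow> (\<Sum>y\<in>Y - {\<zeta>}. 0 / norm (f' y))) (at \<zeta> within ball 0 1)"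
    using assms boundary_deriv_polar(2) regular_norm
    by (intro tendsto_sum tendsto_divide herglotz_tendsto tendsto_const) (force simp: fibre_def)+
  then show ?thesis by simp
qed

lemma remainder_tendsto_0:
  assumes "norm x = 1" "finite Y" "Y \<subseteq> fibre x" "\<zeta> \<in> regular" "\<zeta> \<in> Y \<or> f \<zeta> \<noteq> x"
  shows "((\<lambda>z. Re (remainder x Y z)) \<longlongrightarrow> 0) (at \<zeta> within ball 0 1)"
proof (cases "\<zeta> \<in> Y")
  case True
  then have "f \<zeta> = x" using assms by (auto simp: fibre_def)
  then have "((\<lambda>z. Re (herglotz x (F z) - herglotz \<zeta> z / of_real (norm (f' \<zeta>)))
      - (\<Sum>y\<in>Y - {\<zeta>}. Re (herglotz y z / of_real (norm (f' y))))) \<longlongrightarrow> 0 - 0) (at \<zeta> within ball 0 1)"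
    using herglotz_pole_cancel[OF assms(4)] other_poles_tendsto[OF assms(2,3) regular_norm(1)[OF assms(4)]]
    by (intro tendsto_diff) (simp only:)+
  moreover have "Re (herglotz x (F z) - herglotz \<zeta> z / of_real (norm (f' \<zeta>)))
      - (\<Sum>y\<in>Y - {\<zeta>}. Re (herglotz y z / of_real (norm (f' y)))) = Re (remainder x Y z)" for z
    unfolding remainder_def sum.remove[OF assms(2) True] by (simp only: minus_complex.sel plus_complex.sel Re_sum)
  ultimately show ?thesis by simp
next
  case False
  then have "((\<lambda>z. Re (herglotz x (F z))
      - (\<Sum>y\<in>Y - {\<zeta>}. Re (herglotz y z / of_real (norm (f' y))))) \<longlongrightarrow> 0 - 0) (at \<zeta> within ball 0 1)"
    using herglotz_F_tendsto[OF assms(4,1)] other_poles_tendsto[OF assms(2,3) regular_norm(1)[OF assms(4)]] assms(5)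
    by (intro tendsto_diff) auto
  moreover have "Y - {\<zeta>} = Y" using False by auto
  ultimately show ?thesis by (simp add: remainder_def)
qed

lemma fibre_sum_le:
  assumes x: "norm x = 1" and Y: "finite Y" "Y \<subseteq> fibre x" and z: "norm z < 1"
  shows "(\<Sum>y\<in>Y. poisson z y / norm (f' y)) \<le> poisson (F z) x"
proof -
  have "Re (remainder x Y z) \<ge> 0"
  proof (rule Re_nonneg_if_boundary_nonneg[OF remainder_holomorphic[OF x Y(2)] _ z])
    fix \<zeta> :: complex and e :: real assume \<zeta>: "norm \<zeta> = 1" and e: "e > 0"
    show "eventually (\<lambda>z. Re (remainder x Y z) \<ge> - e) (at \<zeta> within ball 0 1)"
    proof (cases "\<zeta> \<in> Y")
      case True
      then have "((\<lambda>z. Re (remainder x Y z)) \<longlongrightarrow> 0) (at \<zeta> within ball 0 1)"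
        using Y by (intro remainder_tendsto_0 x) (auto simp: fibre_def)
      then have "eventually (\<lambda>z. - e < Re (remainder x Y z)) (at \<zeta> within ball 0 1)"
        using e by (intro order_tendstoD) auto
      then show ?thesis by eventually_elim simp
    next
      case False
      have "eventually (\<lambda>z. (\<Sum>y\<in>Y - {\<zeta>}. Re (herglotz y z / of_real (norm (f' y)))) < e) (at \<zeta> within ball 0 1)"
        using e other_poles_tendsto[OF Y \<zeta>] by (intro order_tendstoD) auto
      moreover have "eventually (\<lambda>z. z \<in> ball 0 1) (at \<zeta> within ball 0 1)"
        by (simp add: eventually_at_filter)
      ultimately show ?thesis
      proof eventually_elim
        case (elim z)
        have "poisson (F z) x \<ge> 0" using elim maps[of z] by (intro poisson_nonneg) auto
        moreover have "Y - {\<zeta>} = Y" using False by auto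
        ultimately show ?case using elim x by (simp add: remainder_def Re_herglotz)
      qed
    qed
  qed
  then show ?thesis by (simp add: Re_remainder[OF x Y(2)])
qed

text \<open>
  Julia's inequality: the bound for a fibre applied to a single point.
\<close>

lemma julia:
  assumes y: "y \<in> regular" and z: "norm z < 1"
  shows "poisson z y \<le> norm (f' y) * poisson (F z) (f y)"
proof -
  have "poisson z y / norm (f' y) \<le> poisson (F z) (f y)"
    using fibre_sum_le[of "f y" "{y}" z] y z regular_norm by (simp add: fibre_def)
  moreover have "norm (f' y) > 0" using boundary_deriv_polar(2)[OF y] by linarith
  ultimately show ?thesis by (simp only: pos_divide_le_eq mult.commute)
qed

text \<open>
  The largest value of a Poisson kernel with pole parameter of modulus at most c1.
\<close>

definition "M = (1 + c1) / (1 - c1)"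

lemma M_ge_1: "M \<ge> 1" using c1 by (simp add: M_def)

lemma poisson_le_M: "norm w \<le> c1 \<Longrightarrow> norm x = 1 \<Longrightarrow> poisson w x \<le> M"
proof -
  assume w: "norm w \<le> c1" and x: "norm x = 1"
  have "poisson w x \<le> (1 + norm w) / (1 - norm w)" using w x c1 by (intro poisson_bounds) auto
  also have "\<dots> \<le> M" unfolding M_def using w c1 by (intro frac_le) auto
  finally show ?thesis .
qed

text \<open>
  At (1 - 9 s) y with s slightly above \<delta> y the Poisson kernel is about 1 / s at y, while its image
  under F has a Poisson kernel bounded by M. If \<delta> y is not small, |f'| \<ge> 1 suffices.
\<close>

lemma boundary_deriv_lower:
  assumes y: "y \<in> regular"
  shows "norm (f' y) \<ge> 1 / (45 * M * \<delta> y)"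
proof -
  have y1: "norm y = 1" and fy: "norm (f y) = 1" and \<delta>: "\<delta> y > 0"
    using y regular_norm \<delta>_pos_if_regular by auto
  show ?thesis
  proof (cases "\<delta> y < 1/45")
    case False
    then have "1 \<le> 45 * (M * \<delta> y)" using M_ge_1 mult_mono[of 1 M "1/45" "\<delta> y"] by simp
    then have "1 / (45 * M * \<delta> y) \<le> 1" using \<delta> M_ge_1 by (simp add: divide_le_eq mult.assoc)
    then show ?thesis using boundary_deriv_polar(2)[OF y] by linarith
  next
    case True
    have *: "1 / (9 * M * norm (f' y)) \<le> s" if s: "\<delta> y < s" "s < 1/45" for s
    proof -
      define z where "z = of_real (1 - 9 * s) * y"
      have s0: "s > 0" using s \<delta> by simp
      have nz: "norm z = 1 - 9 * s" using s s0 y1 unfolding z_def by (simp only: norm_mult norm_of_real) simp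
      have "y - z = of_real (9 * s) * y" by (simp add: z_def algebra_simps)
      then have d: "norm (y - z) = 9 * s" using s0 y1 by (simp only: norm_mult norm_of_real)
      have "norm (F z) \<le> c1" unfolding z_def by (rule small_above_sublevel[OF y1 s(1)]) (use s in auto)
      then have "poisson (F z) (f y) \<le> M" using fy by (rule poisson_le_M)
      then have "poisson z y \<le> norm (f' y) * M"
        using julia[OF y, of z] nz s0 by (smt (verit) mult_left_mono norm_ge_zero)
      moreover have "poisson z y = (2 - 9 * s) / (9 * s)"
        using s0 by (simp add: poisson_def nz d power2_eq_square field_simps)
      moreover have "1 / (9 * s) \<le> (2 - 9 * s) / (9 * s)" using s s0 by (intro divide_right_mono) auto
      ultimately have "1 / (9 * s) \<le> norm (f' y) * M" by linarith
      moreover have "0 < 9 * s" "0 < 9 * M * norm (f' y)"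
        using s0 M_ge_1 boundary_deriv_polar(2)[OF y] by (auto intro!: mult_pos_pos)
      ultimately show ?thesis by (simp only: pos_divide_le_eq mult.assoc mult.left_commute mult.commute)
    qed
    have "1 / (9 * M * norm (f' y)) \<le> \<delta> y"
      using True * by (rule dense_ge_bounded)
    moreover have "0 < 9 * M * norm (f' y)" "0 < 9 * M * \<delta> y"
      using \<delta> M_ge_1 boundary_deriv_polar(2)[OF y] by (auto intro!: mult_pos_pos)
    ultimately have "1 / (9 * M * \<delta> y) \<le> norm (f' y)"
      by (simp only: pos_divide_le_eq mult.assoc mult.left_commute mult.commute)
    moreover have "1 / (45 * M * \<delta> y) \<le> 1 / (9 * M * \<delta> y)"
      using \<delta> M_ge_1 by (intro divide_left_mono) auto
    ultimately show ?thesis by linarith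
  qed
qed

end

section \<open>Poisson integrals\<close>

lemma sphere_borel [measurable, simp]: "sphere (0::complex) 1 \<in> sets borel"
  by (simp add: borel_closed)

lemma set_integral_circle_continuous:
  fixes f :: "complex \<Rightarrow> real"
  assumes f: "continuous_on (sphere 0 1) f"
  shows "set_integrable circle_measure (sphere 0 1) f"
    and "(LINT z:sphere 0 1|circle_measure. f z) = integral {0..2*pi} (\<lambda>t. f (cis t)) / (2 * pi)"
proof -
  define h where "h = (\<lambda>z. indicator (sphere 0 1) z *\<^sub>R f z)"
  have hm [measurable]: "h \<in> borel_measurable borel"
    unfolding h_def by (rule borel_measurable_continuous_on_indicator) (use f in auto)
  have hc: "h (cis t) = f (cis t)" for t by (simp add: h_def)
  obtain B where B: "\<And>z. z \<in> sphere 0 1 \<Longrightarrow> norm (f z) \<le> B"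
    using compact_imp_bounded[OF compact_continuous_image[OF f compact_sphere]] unfolding bounded_iff by blast
  have "norm (h z) \<le> max B 0" for z using B[of z] by (auto simp: h_def indicator_def)
  then have "integrable circle_measure h"
    by (intro circle.integrable_const_bound[where B="max B 0"]) auto
  then show "set_integrable circle_measure (sphere 0 1) f" by (simp add: set_integrable_def h_def)
  have "(LINT z|circle_measure. h z) = (LINT t|uniform_measure lborel {0..2 * pi}. h (cis t))"
    unfolding circle_measure_def by (rule integral_distr) auto
  also have "\<dots> = (LINT t|lborel. (indicator {0..2*pi} t / (2 * pi)) *\<^sub>R h (cis t))"
  proof -
    have "uniform_measure lborel {0..2*pi} = density lborel (\<lambda>t. ennreal (indicator {0..2*pi} t / (2 * pi)))"
      unfolding uniform_measure_def
      by (intro density_cong) (auto simp: indicator_def divide_ennreal simp flip: ennreal_1)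
    then show ?thesis by (simp add: integral_density)
  qed
  also have "\<dots> = (LINT t|lborel. indicator {0..2*pi} t *\<^sub>R f (cis t)) / (2 * pi)"
    by (simp add: hc)
  also have "(LINT t|lborel. indicator {0..2*pi} t *\<^sub>R f (cis t)) = integral {0..2*pi} (\<lambda>t. f (cis t))"
  proof -
    have "set_integrable lborel {0..2 * pi} (\<lambda>t. f (cis t))"
      by (rule borel_integrable_atLeastAtMost', rule continuous_on_compose2[OF f])
         (auto intro!: continuous_intros)
    then show ?thesis
      using set_borel_integral_eq_integral(2)[of "{0..2*pi}" "\<lambda>t. f (cis t)"] by (simp add: set_lebesgue_integral_def)
  qed
  finally show "(LINT z:sphere 0 1|circle_measure. f z) = integral {0..2*pi} (\<lambda>t. f (cis t)) / (2 * pi)"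
    by (simp add: set_lebesgue_integral_def h_def)
qed

lemma poisson_continuous: "norm z < 1 \<Longrightarrow> continuous_on (sphere 0 1) (poisson z)"
  unfolding poisson_def by (intro continuous_intros) auto

lemma poisson_0: "norm w = 1 \<Longrightarrow> poisson 0 w = 1" by (simp add: poisson_def)

lemma cauchy_poisson_kernel:
  assumes w: "norm w = 1" and z: "norm z < 1"
  shows "(1 + cnj z * (w - z) / (1 - cnj z * w)) / (w - z) * w = of_real (poisson z w)"
proof -
  have ww: "w * cnj w = 1" using w by (simp add: complex_norm_square[symmetric])
  have wz: "w - z \<noteq> 0" "w \<noteq> 0" using w z by auto
  have "cnj z * w \<noteq> 1"
  proof
    assume "cnj z * w = 1"
    then have "norm (cnj z * w) = 1" by simp
    then show False using w z by (simp add: norm_mult)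
  qed
  then have nz: "1 - cnj z * w \<noteq> 0" by simp
  have "(1 + cnj z * (w - z) / (1 - cnj z * w)) / (w - z) * w
     = w * (1 - z * cnj z) / ((w - z) * (1 - cnj z * w))"
    using wz nz by (simp add: divide_simps) (simp add: algebra_simps)
  also have "\<dots> = w * (1 - z * cnj z) / ((w - z) * (w * cnj (w - z)))"
    using ww by (simp add: algebra_simps)
  also have "\<dots> = (1 - z * cnj z) / ((w - z) * cnj (w - z))"
    using wz by simp
  also have "\<dots> = of_real (poisson z w)"
    by (simp add: poisson_def complex_norm_square[symmetric] del: complex_cnj_diff)
  finally show ?thesis .
qed

text \<open>
  On the circle the Poisson kernel is the Cauchy kernel times the function
  1 + cnj z (w - z) / (1 - cnj z w), which is holomorphic in w and equal to 1 at w = z. So Cauchy's formula gives the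
  claim at once.
\<close>

lemma poisson_formula:
  assumes Q: "Q holomorphic_on ball 0 1" and r: "0 \<le> r" "r < 1" and z: "norm z < 1"
  shows "(LINT \<zeta>:sphere 0 1|circle_measure. poisson z \<zeta> * Re (Q (of_real r * \<zeta>))) = Re (Q (of_real r * z))"
    and "set_integrable circle_measure (sphere 0 1) (\<lambda>\<zeta>. poisson z \<zeta> * Re (Q (of_real r * \<zeta>)))"
proof -
  define h where "h = (\<lambda>w. Q (of_real r * w))"
  have rw: "norm (of_real r * w) < 1" if "norm w \<le> 1" for w :: complex
    using r mult_left_mono[OF that r(1)] by (simp add: norm_mult)
  have im: "(\<lambda>w. of_real r * w) ` cball 0 1 \<subseteq> ball (0::complex) 1"
    by (intro image_subsetI) (simp only: mem_ball mem_cball dist_0_norm rw)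
  have hc: "continuous_on (cball 0 1) h" unfolding h_def
    by (rule continuous_on_compose2[OF holomorphic_on_imp_continuous_on[OF Q] _ im])
       (intro continuous_intros)
  have "Q \<circ> (\<lambda>w. of_real r * w) holomorphic_on ball 0 1"
    by (rule holomorphic_on_compose_gen[OF _ Q order_trans[OF image_mono[OF ball_subset_cball] im]])
       (intro holomorphic_intros)
  then have hh: "h holomorphic_on ball 0 1" by (simp add: h_def o_def)
  have nz: "1 - cnj z * w \<noteq> 0" if "norm w \<le> 1" for w
  proof
    assume "1 - cnj z * w = 0"
    then have "norm (cnj z * w) = 1" by simp
    moreover have "norm z * norm w \<le> norm z * 1" using that by (intro mult_left_mono) auto
    ultimately show False using z by (simp add: norm_mult)
  qed
  define f where "f = (\<lambda>w. h w * (1 + cnj z * (w - z) / (1 - cnj z * w)))"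
  have "((\<lambda>u. f u / (u - z)) has_contour_integral (2 * of_real pi * \<i> * f z)) (circlepath 0 1)"
  proof (rule Cauchy_integral_circlepath)
    show "continuous_on (cball 0 1) f" unfolding f_def using nz by (intro continuous_intros hc) auto
    show "f holomorphic_on ball 0 1" unfolding f_def using nz by (intro holomorphic_intros hh) auto
  qed (use z in auto)
  then have "((\<lambda>t. f (cis t) / (cis t - z) * \<i> * cis t) has_integral (2 * of_real pi * \<i> * f z)) {0..2*pi}"
    unfolding circlepath_def by (subst (asm) has_contour_integral_part_circlepath_iff) (simp_all add: mult.assoc)
  then have "((\<lambda>t. - \<i> * (f (cis t) / (cis t - z) * \<i> * cis t)) has_integral - \<i> * (2 * of_real pi * \<i> * f z)) {0..2*pi}"
    by (rule has_integral_mult_right)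
  moreover have "- \<i> * (f (cis t) / (cis t - z) * \<i> * cis t) = of_real (poisson z (cis t)) * h (cis t)" for t
    unfolding cauchy_poisson_kernel[OF norm_cis z, symmetric] f_def by (simp add: algebra_simps)
  moreover have "- \<i> * (2 * of_real pi * \<i> * f z) = of_real (2 * pi) * h z" by (simp add: f_def algebra_simps)
  ultimately have "((\<lambda>t. of_real (poisson z (cis t)) * h (cis t)) has_integral of_real (2 * pi) * h z) {0..2*pi}"
    by (simp only:)
  from has_integral_linear[OF this bounded_linear_Re]
  have I: "((\<lambda>t. poisson z (cis t) * Re (h (cis t))) has_integral 2 * pi * Re (h z)) {0..2*pi}"
    by (simp add: o_def)
  have cont: "continuous_on (sphere 0 1) (\<lambda>\<zeta>. poisson z \<zeta> * Re (h \<zeta>))"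
    by (intro continuous_intros poisson_continuous z continuous_on_subset[OF hc]) auto
  show "(LINT \<zeta>:sphere 0 1|circle_measure. poisson z \<zeta> * Re (Q (of_real r * \<zeta>))) = Re (Q (of_real r * z))"
    using set_integral_circle_continuous(2)[OF cont] integral_unique[OF I] by (simp add: h_def)
  show "set_integrable circle_measure (sphere 0 1) (\<lambda>\<zeta>. poisson z \<zeta> * Re (Q (of_real r * \<zeta>)))"
    using set_integral_circle_continuous(1)[OF cont] by (simp add: h_def)
qed

lemma poisson_formula_nn:
  assumes Q: "Q holomorphic_on ball 0 1" and r: "0 \<le> r" "r < 1" and z: "norm z < 1"
    and pos: "\<And>w. norm w < 1 \<Longrightarrow> Re (Q w) \<ge> 0"
  shows "(\<integral>\<^sup>+\<zeta>. ennreal (indicator (sphere 0 1) \<zeta> * (poisson z \<zeta> * Re (Q (of_real r * \<zeta>)))) \<partial>circle_measure)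
       = ennreal (Re (Q (of_real r * z)))"
proof -
  have rw: "norm (of_real r * w) < 1" if "norm w = 1" for w :: complex
    using r that by (simp add: norm_mult)
  have "(\<integral>\<^sup>+\<zeta>. ennreal (indicator (sphere 0 1) \<zeta> * (poisson z \<zeta> * Re (Q (of_real r * \<zeta>)))) \<partial>circle_measure)
     = ennreal (LINT \<zeta>|circle_measure. indicator (sphere 0 1) \<zeta> * (poisson z \<zeta> * Re (Q (of_real r * \<zeta>))))"
    using poisson_formula(2)[OF assms(1-4)] pos rw poisson_nonneg[of z] z
    by (intro nn_integral_eq_integral) (auto simp: set_integrable_def indicator_def)
  then show ?thesis using poisson_formula(1)[OF assms(1-4)] by (simp add: set_lebesgue_integral_def)
qed

lemma harnack_at_zero:
  assumes Q: "Q holomorphic_on ball 0 1" and z: "norm z < 1"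
    and pos: "\<And>w. norm w < 1 \<Longrightarrow> Re (Q w) \<ge> 0"
  shows "Re (Q z) \<le> (1 + norm z) / (1 - norm z) * Re (Q 0)"
proof -
  define C where "C = (1 + norm z) / (1 - norm z)"
  have r: "Re (Q (of_real r * z)) \<le> C * Re (Q 0)" if r: "0 \<le> r" "r < 1" for r
  proof -
    have "Re (Q (of_real r * z)) = (LINT \<zeta>:sphere 0 1|circle_measure. poisson z \<zeta> * Re (Q (of_real r * \<zeta>)))"
      by (rule poisson_formula(1)[OF Q r z, symmetric])
    also have "\<dots> \<le> (LINT \<zeta>:sphere 0 1|circle_measure. C * (poisson 0 \<zeta> * Re (Q (of_real r * \<zeta>))))"
    proof (rule set_integral_mono)
      show "poisson z \<zeta> * Re (Q (of_real r * \<zeta>)) \<le> C * (poisson 0 \<zeta> * Re (Q (of_real r * \<zeta>)))" if "\<zeta> \<in> sphere 0 1" for \<zeta>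
      proof -
        have "poisson z \<zeta> \<le> C" "poisson 0 \<zeta> = 1" using poisson_bounds(1)[of \<zeta> z] that z by (simp_all add: C_def poisson_0)
        moreover have "Re (Q (of_real r * \<zeta>)) \<ge> 0" using that r by (intro pos) (simp add: norm_mult)
        ultimately show ?thesis by (simp add: mult_right_mono)
      qed
    qed (use poisson_formula(2)[OF Q r] z in \<open>auto intro!: set_integrable_mult_right\<close>)
    also have "\<dots> = C * Re (Q 0)" using poisson_formula(1)[OF Q r, of 0] by simp
    finally show ?thesis .
  qed
  have "isCont Q z" using holomorphic_on_imp_continuous_on[OF Q] z by (auto simp: continuous_on_eq_continuous_at)
  moreover have "((\<lambda>r::real. of_real r * z) \<longlongrightarrow> of_real 1 * z) (at_left 1)" by (intro tendsto_intros)
  ultimately have "((\<lambda>r::real. Re (Q (of_real r * z))) \<longlongrightarrow> Re (Q z)) (at_left 1)"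
    by (intro tendsto_Re isCont_tendsto_compose[of z Q]) auto
  moreover have "eventually (\<lambda>r::real. r \<in> {0<..<1}) (at_left 1)"
    by (rule eventually_at_left_real) simp
  then have "eventually (\<lambda>r::real. Re (Q (of_real r * z)) \<le> C * Re (Q 0)) (at_left 1)"
    by eventually_elim (use r in auto)
  ultimately show ?thesis unfolding C_def by (rule tendsto_upperbound) simp
qed

lemma poisson_measurable [measurable]:
  assumes [measurable]: "f \<in> borel_measurable N" "g \<in> borel_measurable N"
  shows "(\<lambda>x. poisson (f x) (g x)) \<in> borel_measurable N"
  unfolding poisson_def by measurable

text \<open>
  A covering argument in integral form. The points \<eta> with dist \<eta> \<zeta> < \<sigma> \<zeta> / 2 have measure at least
  \<sigma> \<zeta> / (8 \<pi>), and for each of them the Poisson kernel of the point at height 20 \<sigma> \<eta> above \<eta> is at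
  least 1 / (35 \<sigma> \<zeta>) at \<zeta>. The lemma bounds a quantity at \<zeta> by Poisson kernels of interior points, whose
  sums over fibres are known.
\<close>

lemma average_poisson_ge:
  fixes \<sigma> :: "complex \<Rightarrow> real" and h :: "complex \<Rightarrow> ennreal"
  assumes lip: "\<And>x y. \<bar>\<sigma> x - \<sigma> y\<bar> \<le> dist x y" and [measurable]: "\<sigma> \<in> borel_measurable borel" "h \<in> borel_measurable borel"
    and \<zeta>: "norm \<zeta> = 1" and \<sigma>: "0 < \<sigma> \<zeta>" "\<sigma> \<zeta> \<le> 1/30"
    and h: "\<And>\<eta>. norm \<eta> = 1 \<Longrightarrow> dist \<eta> \<zeta> < \<sigma> \<zeta> / 2 \<Longrightarrow> a \<le> h \<eta>"
  shows "a \<le> ennreal (280 * pi) * (\<integral>\<^sup>+\<eta>. ennreal (poisson (of_real (1 - 20 * \<sigma> \<eta>) * \<eta>) \<zeta>) * h \<eta> \<partial>circle_measure)"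
proof -
  define b where "b = \<sigma> \<zeta> / 2"
  have b: "0 < b" "b \<le> 1" using \<sigma> by (auto simp: b_def)
  have ker: "1 / (70 * b) \<le> poisson (of_real (1 - 20 * \<sigma> \<eta>) * \<eta>) \<zeta>" if \<eta>: "norm \<eta> = 1" "dist \<eta> \<zeta> < b" for \<eta>
  proof -
    define s where "s = \<sigma> \<eta>"
    have s: "b \<le> s" "s \<le> 3 * b" using lip[of \<eta> \<zeta>] \<eta>(2) by (auto simp: s_def b_def)
    have s20: "20 * s \<le> 1" using s \<sigma> by (simp add: b_def)
    define z where "z = of_real (1 - 20 * s) * \<eta>"
    have nz: "norm z = 1 - 20 * s" using s20 \<eta>(1) unfolding z_def by (simp only: norm_mult norm_of_real) simp
    have "\<eta> - z = of_real (20 * s) * \<eta>" by (simp add: z_def algebra_simps)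
    then have "norm (\<eta> - z) = 20 * s" using s b \<eta>(1) by (simp only: norm_mult norm_of_real)
    then have d: "norm (\<zeta> - z) \<le> 21 * s"
      using norm_triangle_ineq[of "\<zeta> - \<eta>" "\<eta> - z"] \<eta>(2) s by (simp add: dist_norm norm_minus_commute)
    have z1: "norm z < 1" using nz s b by simp
    then have d0: "norm (\<zeta> - z) > 0" using \<zeta> by auto
    have "(norm z)\<^sup>2 \<le> norm z * 1" unfolding power2_eq_square using z1 by (intro mult_left_mono) auto
    then have "20 * s \<le> 1 - (norm z)\<^sup>2" using nz by simp
    then have "20 * s / (21 * s)\<^sup>2 \<le> poisson z \<zeta>"
      unfolding poisson_def using d d0 s b by (intro frac_le power_mono) auto
    moreover have "1 / (70 * b) \<le> 20 * s / (21 * s)\<^sup>2"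
    proof -
      have "441 * s \<le> 1400 * b" using s b by linarith
      then have "s * (441 * s) \<le> s * (1400 * b)" using s b by (intro mult_left_mono) auto
      then show ?thesis using s b by (simp add: power2_eq_square divide_simps algebra_simps)
    qed
    ultimately show ?thesis by (simp add: z_def s_def)
  qed
  have "a \<le> ennreal (280 * pi) * (a * ennreal (1 / (70 * b)) * ennreal (b / 2 / (2 * pi)))"
  proof -
    have "ennreal (280 * pi) * (a * ennreal (1 / (70 * b)) * ennreal (b / 2 / (2 * pi)))
        = a * ennreal (280 * pi * (1 / (70 * b) * (b / 2 / (2 * pi))))"
      using b by (subst (1 2) ennreal_mult) (auto simp: mult_ac)
    also have "280 * pi * (1 / (70 * b) * (b / 2 / (2 * pi))) = 1" using b by (simp add: field_simps)
    finally show ?thesis by simp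
  qed
  also have "\<dots> \<le> ennreal (280 * pi) * (a * ennreal (1 / (70 * b)) * emeasure circle_measure (ball \<zeta> b))"
    using measure_circle_ball_ge[OF \<zeta> b]
    by (intro mult_left_mono) (auto simp: circle.emeasure_eq_measure intro!: ennreal_leI)
  also have "a * ennreal (1 / (70 * b)) * emeasure circle_measure (ball \<zeta> b)
      = (\<integral>\<^sup>+\<eta>. (a * ennreal (1 / (70 * b))) * indicator (ball \<zeta> b) \<eta> \<partial>circle_measure)"
    by (subst nn_integral_cmult_indicator) auto
  also have "\<dots> \<le> (\<integral>\<^sup>+\<eta>. ennreal (poisson (of_real (1 - 20 * \<sigma> \<eta>) * \<eta>) \<zeta>) * h \<eta> \<partial>circle_measure)"
    using AE_circle_in_sphere
  proof (intro nn_integral_mono_AE, eventually_elim)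
    fix \<eta> :: complex assume \<eta>: "\<eta> \<in> sphere 0 1"
    show "(a * ennreal (1 / (70 * b))) * indicator (ball \<zeta> b) \<eta> \<le> ennreal (poisson (of_real (1 - 20 * \<sigma> \<eta>) * \<eta>) \<zeta>) * h \<eta>"
      using \<eta> ker[of \<eta>] h[of \<eta>]
      by (auto simp: indicator_def dist_commute b_def mult.commute[of a] intro!: mult_mono ennreal_leI)
  qed
  finally show ?thesis by (simp add: mult_left_mono)
qed

section \<open>No mass of a fibre is lost in the singular set\<close>

context one_component
begin

lemma \<delta>_measurable [measurable]: "\<delta> \<in> borel_measurable borel"
  by (intro borel_measurable_continuous_onI continuous_\<delta>)

lemma finite_fibre_far:
  assumes x: "norm x = 1" and t: "t > 0"
  shows "finite {y \<in> fibre x. t \<le> \<delta> y}"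
proof (rule ccontr)
  assume inf: "infinite {y \<in> fibre x. t \<le> \<delta> y}"
  obtain n :: nat where n: "2 / (c * t) < real n" using reals_Archimedean2 by blast
  obtain Y where Y: "finite Y" "card Y = n" "Y \<subseteq> {y \<in> fibre x. t \<le> \<delta> y}"
    using infinite_arbitrarily_large[OF inf] by blast
  have "real (card Y) * (c * t / 2) \<le> (\<Sum>y\<in>Y. poisson 0 y / norm (f' y))"
  proof (rule sum_bounded_below)
    fix y assume "y \<in> Y"
    then have y: "y \<in> regular" "t \<le> \<delta> y" using Y(3) by (auto simp: fibre_def)
    have "norm (f' y) \<le> 2 / (c * \<delta> y)" using regular_if_\<delta>_pos regular_iff y(1) by blast
    also have "\<dots> \<le> 2 / (c * t)" using y(2) t c by (intro divide_left_mono mult_left_mono mult_pos_pos) auto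
    finally have "1 / (2 / (c * t)) \<le> 1 / norm (f' y)"
      using boundary_deriv_polar(2)[OF y(1)] t c by (intro divide_left_mono mult_pos_pos) auto
    then show "c * t / 2 \<le> poisson 0 y / norm (f' y)" using regular_norm[OF y(1)] by (simp add: poisson_0)
  qed
  also have "\<dots> \<le> poisson (F 0) x" using Y by (intro fibre_sum_le x) auto
  also have "\<dots> = 1" using x by (simp add: F0 poisson_0)
  finally show False using n Y(2) c t by (simp add: field_simps)
qed

lemma herglotz_F_holomorphic: "norm x = 1 \<Longrightarrow> (\<lambda>w. herglotz x (F w)) holomorphic_on ball 0 1"
proof -
  assume x: "norm x = 1"
  have "x - F z \<noteq> 0" if "norm z < 1" for z using x maps[OF that] by auto
  then show ?thesis unfolding herglotz_def by (auto intro!: holomorphic_intros hol)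
qed

interpretation pair_sigma_finite circle_measure circle_measure ..

lemma poisson_F_measurable:
  assumes x: "norm x = 1" and r: "0 \<le> r" "r < 1"
  shows "(\<lambda>\<zeta>. indicator (sphere 0 1) \<zeta> * poisson (F (of_real r * \<zeta>)) x) \<in> borel_measurable borel"
proof -
  have rw: "norm (of_real r * w) < 1" if "norm w = 1" for w :: complex
    using r that by (simp add: norm_mult)
  have im: "(\<lambda>\<zeta>. of_real r * \<zeta>) ` sphere 0 1 \<subseteq> ball (0::complex) 1"
    by (intro image_subsetI) (simp only: mem_ball mem_sphere dist_0_norm rw)
  have "continuous_on (sphere 0 1) (\<lambda>\<zeta>. F (of_real r * \<zeta>))"
    by (rule continuous_on_compose2[OF holomorphic_on_imp_continuous_on[OF hol] _ im]) (intro continuous_intros)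
  moreover have "x - F (of_real r * \<zeta>) \<noteq> 0" if "\<zeta> \<in> sphere 0 1" for \<zeta>
    using maps[OF rw[of \<zeta>]] that x by auto
  ultimately have "continuous_on (sphere 0 1) (\<lambda>\<zeta>. poisson (F (of_real r * \<zeta>)) x)"
    unfolding poisson_def by (auto intro!: continuous_intros)
  from borel_measurable_continuous_on_indicator[OF _ this] show ?thesis by simp
qed

text \<open>
  Where \<delta> \<eta> < 2 t, the image under F of the point at height about 20 t above \<eta> has modulus at most c1, so the
  Poisson kernel there is at most M. Averaging over such \<eta> controls the integral near the singular set,
  uniformly in r.
\<close>

lemma mass_near_singular_set:
  assumes x: "norm x = 1" and t: "0 < t" "t \<le> 1/200" and r: "9/10 \<le> r" "r < 1"
  shows "(\<integral>\<^sup>+\<zeta>. ennreal (indicator (sphere 0 1) \<zeta> * poisson (F (of_real r * \<zeta>)) x) * indicator {\<zeta>. \<delta> \<zeta> < t} \<zeta> \<partial>circle_measure)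
     \<le> ennreal (280 * pi * M) * emeasure circle_measure {\<eta>. \<delta> \<eta> < 2 * t}"
proof -
  define p where "p = (\<lambda>\<zeta>. indicator (sphere 0 1) \<zeta> * poisson (F (of_real r * \<zeta>)) x)"
  have p_measurable [measurable]: "p \<in> borel_measurable borel"
    unfolding p_def by (rule poisson_F_measurable) (use x r in auto)
  have rw: "norm (of_real r * w) < 1" if "norm w = 1" for w :: complex
    using r that by (simp add: norm_mult)
  have p_nonneg: "p \<zeta> \<ge> 0" for \<zeta>
    using poisson_nonneg[OF less_imp_le[OF maps[OF rw[of \<zeta>]]]] by (auto simp: p_def indicator_def)
  define s where "s = (\<lambda>\<eta>::complex. of_real (1 - 20 * t) * \<eta>)"
  have s_measurable [measurable]: "s \<in> borel_measurable borel" unfolding s_def by measurable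
  have average: "indicator {\<zeta>. \<delta> \<zeta> < t} \<zeta>
      \<le> ennreal (280 * pi) * (\<integral>\<^sup>+\<eta>. ennreal (poisson (s \<eta>) \<zeta>) * indicator {\<eta>. \<delta> \<eta> < 2 * t} \<eta> \<partial>circle_measure)"
    if \<zeta>: "norm \<zeta> = 1" for \<zeta>
    unfolding s_def
  proof (rule average_poisson_ge[where \<sigma> = "\<lambda>_. t"])
    fix \<eta> :: complex assume "dist \<eta> \<zeta> < t / 2"
    then have "\<delta> \<zeta> < t \<Longrightarrow> \<delta> \<eta> < 2 * t" using \<delta>_lipschitz[of \<eta> \<zeta>] t by simp
    then show "indicator {\<zeta>. \<delta> \<zeta> < t} \<zeta> \<le> (indicator {\<eta>. \<delta> \<eta> < 2 * t} \<eta> :: ennreal)"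
      by (auto simp: indicator_def)
  qed (use t \<zeta> in auto)
  have "(\<integral>\<^sup>+\<zeta>. ennreal (p \<zeta>) * indicator {\<zeta>. \<delta> \<zeta> < t} \<zeta> \<partial>circle_measure)
     \<le> (\<integral>\<^sup>+\<zeta>. (\<integral>\<^sup>+\<eta>. ennreal (p \<zeta>) * (ennreal (280 * pi) * (ennreal (poisson (s \<eta>) \<zeta>) * indicator {\<eta>. \<delta> \<eta> < 2 * t} \<eta>)) \<partial>circle_measure) \<partial>circle_measure)"
    using AE_circle_in_sphere
  proof (intro nn_integral_mono_AE, eventually_elim)
    fix \<zeta> :: complex assume "\<zeta> \<in> sphere 0 1"
    then show "ennreal (p \<zeta>) * indicator {\<zeta>. \<delta> \<zeta> < t} \<zeta>
      \<le> (\<integral>\<^sup>+\<eta>. ennreal (p \<zeta>) * (ennreal (280 * pi) * (ennreal (poisson (s \<eta>) \<zeta>) * indicator {\<eta>. \<delta> \<eta> < 2 * t} \<eta>)) \<partial>circle_measure)"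
      using average[of \<zeta>] by (simp add: nn_integral_cmult mult_left_mono)
  qed
  also have "\<dots> = (\<integral>\<^sup>+\<eta>. (\<integral>\<^sup>+\<zeta>. ennreal (p \<zeta>) * (ennreal (280 * pi) * (ennreal (poisson (s \<eta>) \<zeta>) * indicator {\<eta>. \<delta> \<eta> < 2 * t} \<eta>)) \<partial>circle_measure) \<partial>circle_measure)"
    by (rule Fubini'[symmetric]) measurable
  also have "\<dots> \<le> (\<integral>\<^sup>+\<eta>. ennreal (280 * pi * M) * indicator {\<eta>. \<delta> \<eta> < 2 * t} \<eta> \<partial>circle_measure)"
    using AE_circle_in_sphere
  proof (intro nn_integral_mono_AE, eventually_elim)
    fix \<eta> :: complex assume "\<eta> \<in> sphere 0 1"
    then have \<eta>: "norm \<eta> = 1" by simp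
    have s1: "norm (s \<eta>) < 1" using t \<eta> unfolding s_def by (simp only: norm_mult norm_of_real) simp
    have "(\<integral>\<^sup>+\<zeta>. ennreal (p \<zeta>) * (ennreal (280 * pi) * (ennreal (poisson (s \<eta>) \<zeta>) * indicator {\<eta>. \<delta> \<eta> < 2 * t} \<eta>)) \<partial>circle_measure)
       = (\<integral>\<^sup>+\<zeta>. (ennreal (280 * pi) * indicator {\<eta>. \<delta> \<eta> < 2 * t} \<eta>) * ennreal (indicator (sphere 0 1) \<zeta> * (poisson (s \<eta>) \<zeta> * Re (herglotz x (F (of_real r * \<zeta>))))) \<partial>circle_measure)"
    proof (rule nn_integral_cong)
      fix \<zeta> :: complex
      have "ennreal (p \<zeta>) * ennreal (poisson (s \<eta>) \<zeta>) = ennreal (p \<zeta> * poisson (s \<eta>) \<zeta>)"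
        using p_nonneg poisson_nonneg[of "s \<eta>" \<zeta>] s1 by (simp add: ennreal_mult)
      also have "p \<zeta> * poisson (s \<eta>) \<zeta> = indicator (sphere 0 1) \<zeta> * (poisson (s \<eta>) \<zeta> * Re (herglotz x (F (of_real r * \<zeta>))))"
        using x by (simp add: p_def Re_herglotz)
      finally show "ennreal (p \<zeta>) * (ennreal (280 * pi) * (ennreal (poisson (s \<eta>) \<zeta>) * indicator {\<eta>. \<delta> \<eta> < 2 * t} \<eta>))
          = (ennreal (280 * pi) * indicator {\<eta>. \<delta> \<eta> < 2 * t} \<eta>) * ennreal (indicator (sphere 0 1) \<zeta> * (poisson (s \<eta>) \<zeta> * Re (herglotz x (F (of_real r * \<zeta>)))))"
        by (metis (no_types, lifting) mult.assoc mult.commute mult.left_commute)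
    qed
    also have "\<dots> = (ennreal (280 * pi) * indicator {\<eta>. \<delta> \<eta> < 2 * t} \<eta>) * ennreal (Re (herglotz x (F (of_real r * s \<eta>))))"
    proof (subst nn_integral_cmult)
      have "(\<lambda>\<zeta>. p \<zeta> * poisson (s \<eta>) \<zeta>) \<in> borel_measurable borel" by measurable
      moreover have "p \<zeta> * poisson (s \<eta>) \<zeta> = indicator (sphere 0 1) \<zeta> * (poisson (s \<eta>) \<zeta> * Re (herglotz x (F (of_real r * \<zeta>))))" for \<zeta>
        using x by (simp add: p_def Re_herglotz)
      ultimately show "(\<lambda>\<zeta>. ennreal (indicator (sphere 0 1) \<zeta> * (poisson (s \<eta>) \<zeta> * Re (herglotz x (F (of_real r * \<zeta>)))))) \<in> borel_measurable circle_measure"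
        by simp
      have "(\<integral>\<^sup>+\<zeta>. ennreal (indicator (sphere 0 1) \<zeta> * (poisson (s \<eta>) \<zeta> * Re (herglotz x (F (of_real r * \<zeta>))))) \<partial>circle_measure)
        = ennreal (Re (herglotz x (F (of_real r * s \<eta>))))"
        by (rule poisson_formula_nn[OF herglotz_F_holomorphic[OF x]])
           (use r s1 x poisson_nonneg[OF less_imp_le[OF maps]] in \<open>auto simp: Re_herglotz\<close>)
      then show "ennreal (280 * pi) * indicator {\<eta>. \<delta> \<eta> < 2 * t} \<eta> *
          (\<integral>\<^sup>+\<zeta>. ennreal (indicator (sphere 0 1) \<zeta> * (poisson (s \<eta>) \<zeta> * Re (herglotz x (F (of_real r * \<zeta>))))) \<partial>circle_measure)
        = (ennreal (280 * pi) * indicator {\<eta>. \<delta> \<eta> < 2 * t} \<eta>) * ennreal (Re (herglotz x (F (of_real r * s \<eta>))))"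
        by simp
    qed
    also have "\<dots> \<le> ennreal (280 * pi * M) * indicator {\<eta>. \<delta> \<eta> < 2 * t} \<eta>"
    proof (cases "\<delta> \<eta> < 2 * t")
      case True
      have s_eq: "of_real r * s \<eta> = of_real (1 - (1 - r * (1 - 20 * t))) * \<eta>" by (simp add: s_def)
      have "norm (F (of_real (1 - (1 - r * (1 - 20 * t))) * \<eta>)) \<le> c1"
      proof (rule small_above_sublevel[OF \<eta> True])
        define w where "w = r * (1 - 20 * t)"
        have "w \<le> 1 * (1 - 20 * t)" unfolding w_def using r t by (intro mult_right_mono) auto
        then have "w \<le> 1 - 20 * t" by simp
        moreover have "18 * t \<le> 20 * t" using t(1) by simp
        ultimately have "18 * t \<le> 1 - w" by linarith
        then have "9 * (2 * t) \<le> 1 - w" by simp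
        then show "9 * (2 * t) \<le> 1 - r * (1 - 20 * t)" by (simp only: w_def)
        have "9/10 * (9/10) \<le> r * (1 - 20 * t)" using r t by (intro mult_mono) auto
        then show "1 - r * (1 - 20 * t) \<le> 1/5" by simp
      qed
      then have "norm (F (of_real r * s \<eta>)) \<le> c1" unfolding s_eq .
      then have "Re (herglotz x (F (of_real r * s \<eta>))) \<le> M" using x by (simp add: Re_herglotz poisson_le_M)
      then show ?thesis using True M_ge_1
        by (simp add: ennreal_mult'' mult_left_mono ennreal_leI)
    qed simp
    finally show "(\<integral>\<^sup>+\<zeta>. ennreal (p \<zeta>) * (ennreal (280 * pi) * (ennreal (poisson (s \<eta>) \<zeta>) * indicator {\<eta>. \<delta> \<eta> < 2 * t} \<eta>)) \<partial>circle_measure)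
      \<le> ennreal (280 * pi * M) * indicator {\<eta>. \<delta> \<eta> < 2 * t} \<eta>" .
  qed
  also have "\<dots> = ennreal (280 * pi * M) * emeasure circle_measure {\<eta>. \<delta> \<eta> < 2 * t}"
    by (subst nn_integral_cmult_indicator) (auto simp: pred_def)
  finally show ?thesis by (simp add: p_def)
qed

text \<open>
  Compactness: the remainder tends to 0 at each point with \<delta> \<ge> t, as all points of the fibre there are in Y.
\<close>

lemma uniform_boundary_values:
  assumes x: "norm x = 1" and t: "t > 0" and e: "e > 0"
  defines "Y \<equiv> {y \<in> fibre x. t \<le> \<delta> y}"
  obtains r where "9/10 \<le> r" "r < 1" "\<And>\<zeta>. norm \<zeta> = 1 \<Longrightarrow> t \<le> \<delta> \<zeta> \<Longrightarrow> Re (remainder x Y (of_real r * \<zeta>)) \<le> e"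
proof -
  have Y: "finite Y" "Y \<subseteq> fibre x" using finite_fibre_far[OF x t] by (auto simp: Y_def)
  have "\<exists>r. 9/10 \<le> r \<and> r < 1 \<and> (\<forall>\<zeta>. norm \<zeta> = 1 \<and> t \<le> \<delta> \<zeta> \<longrightarrow> Re (remainder x Y (of_real r * \<zeta>)) \<le> e)"
  proof (rule ccontr)
    assume *: "\<not> ?thesis"
    have "\<exists>\<zeta>. norm \<zeta> = 1 \<and> t \<le> \<delta> \<zeta> \<and> Re (remainder x Y (of_real (1 - 1 / (real n + 10)) * \<zeta>)) > e" for n
      using *[unfolded not_ex, rule_format, of "1 - 1 / (real n + 10)"] by (auto simp: not_le field_simps)
    then obtain w where w: "\<And>n. norm (w n) = 1" "\<And>n. t \<le> \<delta> (w n)"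
        "\<And>n. Re (remainder x Y (of_real (1 - 1 / (real n + 10)) * w n)) > e" by metis
    have "\<forall>n. w n \<in> sphere 0 1" using w(1) by simp
    then obtain l s where l: "l \<in> sphere 0 1" "strict_mono s" "(w \<circ> s) \<longlonglongrightarrow> l"
      using compact_sphere[of "0::complex" 1] unfolding compact_def by metis
    have "(\<lambda>n. \<delta> ((w \<circ> s) n)) \<longlonglongrightarrow> \<delta> l"
      by (rule continuous_on_tendsto_compose[OF continuous_\<delta>[of UNIV] l(3)]) auto
    then have \<delta>l: "t \<le> \<delta> l" by (rule LIMSEQ_le_const) (use w in auto)
    then have lr: "l \<in> regular" using l(1) t by (auto simp: regular_iff)
    have lim0: "((\<lambda>z. Re (remainder x Y z)) \<longlongrightarrow> 0) (at l within ball 0 1)"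
      by (rule remainder_tendsto_0[OF x Y lr]) (use \<delta>l lr in \<open>auto simp: Y_def fibre_def\<close>)
    define v where "v = (\<lambda>n. of_real (1 - 1 / (real (s n) + 10)) * w (s n))"
    have "(\<lambda>n. 1 - 1 / (real n + 10)) \<longlonglongrightarrow> 1" by real_asymp
    from LIMSEQ_subseq_LIMSEQ[OF this l(2)]
    have "(\<lambda>n. complex_of_real (1 - 1 / (real (s n) + 10))) \<longlonglongrightarrow> of_real 1"
      by (intro tendsto_of_real) (simp add: o_def)
    from tendsto_mult[OF this l(3)] have vl: "v \<longlonglongrightarrow> l" by (simp add: v_def o_def)
    have v1: "norm (v n) < 1" for n
      unfolding v_def using w(1)[of "s n"] by (simp only: norm_mult norm_of_real) (simp add: field_simps)
    have "filterlim v (at l within ball 0 1) sequentially"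
      unfolding filterlim_at using vl v1 l(1) by (auto intro!: always_eventually) (metis less_irrefl)
    from filterlim_compose[OF lim0 this]
    have "(\<lambda>n. Re (remainder x Y (v n))) \<longlonglongrightarrow> 0" .
    then have "e \<le> 0" by (rule LIMSEQ_le_const) (use w(3) in \<open>auto simp: v_def less_imp_le intro!: exI[of _ 0]\<close>)
    then show False using e by simp
  qed
  then show ?thesis using that by blast
qed

lemma remainder_nonneg:
  assumes "norm x = 1" "finite Y" "Y \<subseteq> fibre x" "norm z < 1"
  shows "Re (remainder x Y z) \<ge> 0"
  using fibre_sum_le[OF assms] by (simp add: Re_remainder assms)

text \<open>
  The value at 0 is the mean over the circle of radius r. As r tends to 1, the part over \<delta> \<ge> t
  tends to 0, because there all points of the fibre have been removed.
\<close>

lemma remainder_at_0_le: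
  assumes x: "norm x = 1" and t: "0 < t" "t \<le> 1/200"
  shows "Re (remainder x {y \<in> fibre x. t \<le> \<delta> y} 0) \<le> 280 * pi * M * measure circle_measure {\<eta>. \<delta> \<eta> < 2 * t}"
proof (rule field_le_epsilon)
  fix e :: real assume e: "e > 0"
  define Y where "Y = {y \<in> fibre x. t \<le> \<delta> y}"
  have Y: "finite Y" "Y \<subseteq> fibre x" using finite_fibre_far[OF x t(1)] by (auto simp: Y_def)
  obtain r where r: "9/10 \<le> r" "r < 1" "\<And>\<zeta>. norm \<zeta> = 1 \<Longrightarrow> t \<le> \<delta> \<zeta> \<Longrightarrow> Re (remainder x Y (of_real r * \<zeta>)) \<le> e"
    using uniform_boundary_values[OF x t(1) e] unfolding Y_def by metis
  have rw: "norm (of_real r * w) < 1" if "norm w = 1" for w :: complex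
    using r that by (simp add: norm_mult)
  define p where "p = (\<lambda>\<zeta>. ennreal (indicator (sphere 0 1) \<zeta> * poisson (F (of_real r * \<zeta>)) x) * indicator {\<zeta>. \<delta> \<zeta> < t} \<zeta>)"
  have "ennreal (Re (remainder x Y 0)) = ennreal (Re (remainder x Y (of_real r * 0)))" by simp
  also have "\<dots> = (\<integral>\<^sup>+\<zeta>. ennreal (indicator (sphere 0 1) \<zeta> * (poisson 0 \<zeta> * Re (remainder x Y (of_real r * \<zeta>)))) \<partial>circle_measure)"
    by (rule poisson_formula_nn[symmetric])
       (use r x Y in \<open>auto intro!: remainder_holomorphic remainder_nonneg\<close>)
  also have "\<dots> \<le> (\<integral>\<^sup>+\<zeta>. ennreal e + p \<zeta> \<partial>circle_measure)"
  proof (rule nn_integral_mono)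
    fix \<zeta> :: complex
    show "ennreal (indicator (sphere 0 1) \<zeta> * (poisson 0 \<zeta> * Re (remainder x Y (of_real r * \<zeta>)))) \<le> ennreal e + p \<zeta>"
    proof (cases "norm \<zeta> = 1")
      case True
      note z = rw[OF True]
      show ?thesis
      proof (cases "\<delta> \<zeta> < t")
        case less: True
        have "0 \<le> (\<Sum>y\<in>Y. poisson (of_real r * \<zeta>) y / norm (f' y))"
          using z by (intro sum_nonneg divide_nonneg_nonneg poisson_nonneg) auto
        then have "Re (remainder x Y (of_real r * \<zeta>)) \<le> poisson (F (of_real r * \<zeta>)) x"
          by (simp add: Re_remainder[OF x Y(2)])
        then have "ennreal (indicator (sphere 0 1) \<zeta> * (poisson 0 \<zeta> * Re (remainder x Y (of_real r * \<zeta>)))) \<le> p \<zeta>"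
          using True less by (simp add: p_def poisson_0 ennreal_leI)
        then show ?thesis by (simp add: add_increasing)
      next
        case False
        then show ?thesis using r(3)[OF True] True by (simp add: poisson_0 ennreal_leI add_increasing2)
      qed
    qed (simp add: indicator_def)
  qed
  also have "\<dots> \<le> ennreal e + ennreal (280 * pi * M) * emeasure circle_measure {\<eta>. \<delta> \<eta> < 2 * t}"
  proof -
    have "(\<integral>\<^sup>+\<zeta>. ennreal e + p \<zeta> \<partial>circle_measure) \<le> (\<integral>\<^sup>+\<zeta>. ennreal e \<partial>circle_measure) + (\<integral>\<^sup>+\<zeta>. p \<zeta> \<partial>circle_measure)"
    proof (subst nn_integral_add)
      have "(\<lambda>\<zeta>. indicator (sphere 0 1) \<zeta> * poisson (F (of_real r * \<zeta>)) x) \<in> borel_measurable borel"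
        by (rule poisson_F_measurable) (use x r in auto)
      then show "p \<in> borel_measurable circle_measure" unfolding p_def by measurable
    qed auto
    moreover have "(\<integral>\<^sup>+\<zeta>. ennreal e \<partial>circle_measure) = ennreal e" by (simp add: circle.emeasure_space_1[simplified])
    ultimately show ?thesis
      using mass_near_singular_set[OF x t r(1,2)] unfolding p_def by (metis (no_types, lifting) add_left_mono order_trans)
  qed
  also have "\<dots> = ennreal (e + 280 * pi * M * measure circle_measure {\<eta>. \<delta> \<eta> < 2 * t})"
    using e M_ge_1 by (subst ennreal_plus) (auto simp: circle.emeasure_eq_measure ennreal_mult'')
  finally show "Re (remainder x Y 0) \<le> 280 * pi * M * measure circle_measure {\<eta>. \<delta> \<eta> < 2 * t} + e"
    using e M_ge_1 by (subst (asm) ennreal_le_iff) (auto simp: add.commute)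
qed

lemma measure_near_singular_set_small:
  assumes e: "e > 0"
  obtains t0 where "t0 > 0" "\<And>t. t \<le> t0 \<Longrightarrow> measure circle_measure {\<eta>. \<delta> \<eta> < t} < e"
proof -
  define A where "A = (\<lambda>n. {\<eta>. \<delta> \<eta> < 1 / real (Suc n)})"
  have A: "range A \<subseteq> sets circle_measure" by (auto simp: A_def pred_def)
  have "decseq A" unfolding decseq_def A_def
    by (auto intro: order_less_le_trans simp: frac_le)
  from circle.finite_Lim_measure_decseq[OF A this]
  have "(\<lambda>n. measure circle_measure (A n)) \<longlonglongrightarrow> measure circle_measure (\<Inter>n. A n)" .
  moreover have "measure circle_measure (\<Inter>n. A n) = 0"
  proof (subst circle.prob_eq_0)
    show "(\<Inter>n. A n) \<in> sets circle_measure" using A by auto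
    show "AE \<eta> in circle_measure. \<eta> \<notin> (\<Inter>n. A n)"
      using AE_regular
    proof eventually_elim
      fix \<eta> assume "\<eta> \<in> regular"
      then have "\<delta> \<eta> > 0" by (rule \<delta>_pos_if_regular)
      then obtain n where "1 / real (Suc n) < \<delta> \<eta>" using nat_approx_posE by blast
      then show "\<eta> \<notin> (\<Inter>n. A n)" by (auto simp: A_def not_less intro!: exI[of _ n])
    qed
  qed
  ultimately have "eventually (\<lambda>n. measure circle_measure (A n) < e) sequentially"
    using e by (auto intro: order_tendstoD)
  then obtain n where n: "measure circle_measure (A n) < e" by (auto simp: eventually_sequentially)
  show ?thesis
  proof (rule that[of "1 / real (Suc n)"])
    fix t assume t: "t \<le> 1 / real (Suc n)"
    have "measure circle_measure {\<eta>. \<delta> \<eta> < t} \<le> measure circle_measure (A n)"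
      using t A by (intro circle.finite_measure_mono) (auto simp: A_def)
    then show "measure circle_measure {\<eta>. \<delta> \<eta> < t} < e" using n by simp
  qed simp
qed

text \<open>
  The Clark measure of F at x has no mass on the singular set: the remainder after
  removing the points with \<delta> \<ge> t is small at 0, and by Harnack's inequality small at z.
\<close>

lemma fibre_has_sum:
  assumes x: "norm x = 1" and z: "norm z < 1"
  shows "((\<lambda>y. poisson z y / norm (f' y)) has_sum poisson (F z) x) (fibre x)"
  unfolding has_sum_def
proof (rule tendstoI)
  fix e :: real assume e: "e > 0"
  define C where "C = (1 + norm z) / (1 - norm z)"
  have C: "C > 0" using z unfolding C_def by (intro divide_pos_pos) (auto intro: add_pos_nonneg)
  define D where "D = C * (280 * pi * M)"
  have D: "D > 0" using C M_ge_1 by (simp add: D_def)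
  obtain t0 where t0: "t0 > 0" "\<And>t. t \<le> t0 \<Longrightarrow> measure circle_measure {\<eta>. \<delta> \<eta> < t} < e / D"
    using measure_near_singular_set_small[of "e / D"] e D by auto
  define t where "t = min (t0 / 2) (1 / 200)"
  have t: "0 < t" "t \<le> 1/200" "2 * t \<le> t0" using t0(1) by (auto simp: t_def)
  define Y where "Y = {y \<in> fibre x. t \<le> \<delta> y}"
  have Y: "finite Y" "Y \<subseteq> fibre x" using finite_fibre_far[OF x t(1)] by (auto simp: Y_def)
  have "Re (remainder x Y z) \<le> C * Re (remainder x Y 0)" unfolding C_def
    by (rule harnack_at_zero[OF remainder_holomorphic[OF x Y(2)] z]) (rule remainder_nonneg[OF x Y])
  also have "\<dots> \<le> C * (280 * pi * M * measure circle_measure {\<eta>. \<delta> \<eta> < 2 * t})"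
    using remainder_at_0_le[OF x t(1,2)] C by (intro mult_left_mono) (auto simp: Y_def)
  also have "\<dots> = D * measure circle_measure {\<eta>. \<delta> \<eta> < 2 * t}" by (simp add: D_def)
  also have "\<dots> < e" using t0(2)[OF t(3)] D by (simp add: pos_less_divide_eq mult.commute)
  finally have small: "poisson (F z) x - (\<Sum>y\<in>Y. poisson z y / norm (f' y)) < e"
    by (simp add: Re_remainder[OF x Y(2)])
  show "eventually (\<lambda>X. dist (\<Sum>y\<in>X. poisson z y / norm (f' y)) (poisson (F z) x) < e) (finite_subsets_at_top (fibre x))"
    unfolding eventually_finite_subsets_at_top
  proof (intro exI[of _ Y] conjI allI impI)
    fix X assume X: "finite X \<and> Y \<subseteq> X \<and> X \<subseteq> fibre x"
    have "(\<Sum>y\<in>Y. poisson z y / norm (f' y)) \<le> (\<Sum>y\<in>X. poisson z y / norm (f' y))"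
      using X z by (intro sum_mono2) (auto intro!: divide_nonneg_nonneg poisson_nonneg)
    moreover have "(\<Sum>y\<in>X. poisson z y / norm (f' y)) \<le> poisson (F z) x"
      using X by (intro fibre_sum_le x z) auto
    ultimately show "dist (\<Sum>y\<in>X. poisson z y / norm (f' y)) (poisson (F z) x) < e"
      using small by (simp add: dist_real_def)
  qed (use Y in auto)
qed

end

section \<open>Equidistribution of backward orbits\<close>

lemma nn_integral_pmf_count_space:
  "(\<integral>\<^sup>+y. g y \<partial>measure_pmf p) = (\<integral>\<^sup>+y. ennreal (pmf p y) * g y \<partial>count_space (set_pmf p))"
  unfolding nn_integral_measure_pmf by (rule nn_integral_count_space_eq) (auto simp: set_pmf_eq)

lemma nn_integral_pmf_swap:
  fixes g :: "'a \<Rightarrow> 'b \<Rightarrow> ennreal"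
  assumes [measurable]: "\<And>y. g y \<in> borel_measurable M"
  shows "(\<integral>\<^sup>+y. (\<integral>\<^sup>+\<eta>. g y \<eta> \<partial>M) \<partial>measure_pmf p) = (\<integral>\<^sup>+\<eta>. (\<integral>\<^sup>+y. g y \<eta> \<partial>measure_pmf p) \<partial>M)"
proof -
  have "(\<integral>\<^sup>+y. (\<integral>\<^sup>+\<eta>. g y \<eta> \<partial>M) \<partial>measure_pmf p)
     = (\<integral>\<^sup>+y. (\<integral>\<^sup>+\<eta>. ennreal (pmf p y) * g y \<eta> \<partial>M) \<partial>count_space (set_pmf p))"
    by (simp add: nn_integral_pmf_count_space nn_integral_cmult)
  also have "\<dots> = (\<integral>\<^sup>+\<eta>. (\<integral>\<^sup>+y. ennreal (pmf p y) * g y \<eta> \<partial>count_space (set_pmf p)) \<partial>M)"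
    by (rule nn_integral_count_space_nn_integral[symmetric]) (auto simp: countable_set_pmf)
  finally show ?thesis by (simp add: nn_integral_pmf_count_space)
qed

lemma nn_integral_count_space_has_sum:
  fixes g :: "'a \<Rightarrow> real"
  assumes "(g has_sum s) A" "\<And>y. y \<in> A \<Longrightarrow> g y \<ge> 0"
  shows "(\<integral>\<^sup>+y. ennreal (g y) \<partial>count_space A) = ennreal s"
proof -
  have "(\<lambda>y. norm (g y)) summable_on A \<longleftrightarrow> g summable_on A"
    by (rule summable_on_cong) (use assms(2) in simp)
  then have *: "Infinite_Set_Sum.abs_summable_on g A"
    unfolding abs_summable_equivalent[symmetric] using assms(1) has_sum_imp_summable by blast
  have "(\<integral>\<^sup>+y. ennreal (g y) \<partial>count_space A) = ennreal (infsetsum g A)"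
    by (rule nn_integral_conv_infsetsum[OF *]) (use assms(2) in simp)
  also have "infsetsum g A = s" using infsetsum_infsum[OF *] infsumI[OF assms(1)] by simp
  finally show ?thesis .
qed

lemma poisson_symmetric:
  assumes "norm \<zeta> = 1" "norm \<eta> = 1"
  shows "poisson (of_real r * \<zeta>) \<eta> = poisson (of_real r * \<eta>) \<zeta>"
proof -
  have "(norm (\<eta> - of_real r * \<zeta>))\<^sup>2 = (norm (\<zeta> - of_real r * \<eta>))\<^sup>2"
  proof -
    have n: "(Re \<zeta>)\<^sup>2 + (Im \<zeta>)\<^sup>2 = 1" "(Re \<eta>)\<^sup>2 + (Im \<eta>)\<^sup>2 = 1" using assms cmod_power2[of \<zeta>] cmod_power2[of \<eta>] by auto
    have "(norm (\<eta> - of_real r * \<zeta>))\<^sup>2 = ((Re \<eta>)\<^sup>2 + (Im \<eta>)\<^sup>2) + r\<^sup>2 * ((Re \<zeta>)\<^sup>2 + (Im \<zeta>)\<^sup>2) - 2 * r * (Re \<eta> * Re \<zeta> + Im \<eta> * Im \<zeta>)"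
      by (simp only: cmod_power2) (simp add: power2_eq_square algebra_simps)
    moreover have "(norm (\<zeta> - of_real r * \<eta>))\<^sup>2 = ((Re \<zeta>)\<^sup>2 + (Im \<zeta>)\<^sup>2) + r\<^sup>2 * ((Re \<eta>)\<^sup>2 + (Im \<eta>)\<^sup>2) - 2 * r * (Re \<eta> * Re \<zeta> + Im \<eta> * Im \<zeta>)"
      by (simp only: cmod_power2) (simp add: power2_eq_square algebra_simps)
    ultimately show ?thesis using n by simp
  qed
  then show ?thesis using assms by (simp add: poisson_def norm_mult)
qed

lemma poisson_integral_1: "norm z < 1 \<Longrightarrow> (LINT \<eta>:sphere 0 1|circle_measure. poisson z \<eta>) = 1"
  using poisson_formula(1)[of "\<lambda>_. 1" 0 z] by simp

lemma sphere_integral_const: "(LINT \<eta>:sphere 0 1|circle_measure. (b::real)) = b"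
  using set_integral_circle_continuous(2)[of "\<lambda>_. b"] by simp

text \<open>
  By symmetry the kernel may be read as a probability density in \<eta> that concentrates at \<zeta> as r tends to 1,
  uniformly in \<zeta>.
\<close>

lemma poisson_approximation:
  fixes g :: "complex \<Rightarrow> real"
  assumes g: "continuous_on (sphere 0 1) g" and e: "e > 0"
  obtains r where "0 < r" "r < 1"
    "\<And>\<zeta>. norm \<zeta> = 1 \<Longrightarrow> g \<zeta> \<le> e + (LINT \<eta>:sphere 0 1|circle_measure. poisson (of_real r * \<eta>) \<zeta> * g \<eta>)"
proof -
  obtain B where B: "B > 0" "\<And>z. z \<in> sphere 0 1 \<Longrightarrow> \<bar>g z\<bar> \<le> B"
  proof -
    obtain B where B: "\<And>z. z \<in> sphere 0 1 \<Longrightarrow> norm (g z) \<le> B"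
      using compact_imp_bounded[OF compact_continuous_image[OF g compact_sphere]] unfolding bounded_iff by blast
    show ?thesis by (rule that[of "max B 1"]) (use B in \<open>auto intro: le_max_iff_disj[THEN iffD2]\<close>)
  qed
  have "uniformly_continuous_on (sphere 0 1) g" by (rule compact_uniformly_continuous[OF g compact_sphere])
  then obtain d where d: "d > 0" "\<And>\<zeta> \<eta>. \<zeta> \<in> sphere 0 1 \<Longrightarrow> \<eta> \<in> sphere 0 1 \<Longrightarrow> dist \<eta> \<zeta> < d \<Longrightarrow> dist (g \<eta>) (g \<zeta>) < e / 2"
    unfolding uniformly_continuous_on_def using e half_gt_zero by metis
  \<comment> \<open>The last bound makes the kernel at most e / (4 B) at distance d or more from its pole.\<close>
  define t where "t = min (min (d / 2) (1 / 2)) (e * d\<^sup>2 / (32 * B))"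
  have t: "0 < t" "t \<le> d / 2" "t \<le> 1/2" "t \<le> e * d\<^sup>2 / (32 * B)" using d(1) e B(1) by (auto simp: t_def)
  define r where "r = 1 - t"
  have r: "0 < r" "r < 1" using t by (auto simp: r_def)
  have r2: "1 - r\<^sup>2 \<le> 2 * t" by (simp add: r_def power2_eq_square algebra_simps)
  have "g \<zeta> \<le> e + (LINT \<eta>:sphere 0 1|circle_measure. poisson (of_real r * \<eta>) \<zeta> * g \<eta>)" if \<zeta>: "norm \<zeta> = 1" for \<zeta>
  proof -
    have z1: "norm (of_real r * \<zeta>) < 1" using r \<zeta> by (simp add: norm_mult)
    have sym: "(LINT \<eta>:sphere 0 1|circle_measure. poisson (of_real r * \<eta>) \<zeta> * g \<eta>)
        = (LINT \<eta>:sphere 0 1|circle_measure. poisson (of_real r * \<zeta>) \<eta> * g \<eta>)"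
      by (rule set_lebesgue_integral_cong) (auto simp: poisson_symmetric \<zeta>)
    have i1: "set_integrable circle_measure (sphere 0 1) (\<lambda>\<eta>. g \<zeta> * poisson (of_real r * \<zeta>) \<eta>)"
      and i2: "set_integrable circle_measure (sphere 0 1) (\<lambda>\<eta>. poisson (of_real r * \<zeta>) \<eta> * g \<eta>)"
      and i3: "set_integrable circle_measure (sphere 0 1) (\<lambda>\<eta>. e / 2 * poisson (of_real r * \<zeta>) \<eta> + e / 2)"
      and i4: "set_integrable circle_measure (sphere 0 1) (\<lambda>\<eta>. e / 2 * poisson (of_real r * \<zeta>) \<eta>)"
      and i5: "set_integrable circle_measure (sphere 0 1) (\<lambda>\<eta>. e / 2)"
      by (intro set_integral_circle_continuous continuous_intros poisson_continuous[OF z1] g)+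
    have "g \<zeta> - (LINT \<eta>:sphere 0 1|circle_measure. poisson (of_real r * \<zeta>) \<eta> * g \<eta>)
        = (LINT \<eta>:sphere 0 1|circle_measure. g \<zeta> * poisson (of_real r * \<zeta>) \<eta> - poisson (of_real r * \<zeta>) \<eta> * g \<eta>)"
      by (subst set_integral_diff(2)[OF i1 i2]) (simp add: poisson_integral_1 z1)
    also have "\<dots> \<le> (LINT \<eta>:sphere 0 1|circle_measure. e / 2 * poisson (of_real r * \<zeta>) \<eta> + e / 2)"
    proof (rule set_integral_mono[OF set_integral_diff(1)[OF i1 i2] i3])
      fix \<eta> :: complex assume \<eta>: "\<eta> \<in> sphere 0 1"
      define p where "p = poisson (of_real r * \<zeta>) \<eta>"
      have p: "p \<ge> 0" unfolding p_def using z1 by (intro poisson_nonneg) simp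
      show "g \<zeta> * p - p * g \<eta> \<le> e / 2 * p + e / 2"
      proof (cases "dist \<eta> \<zeta> < d")
        case True
        have "dist (g \<eta>) (g \<zeta>) < e / 2" by (rule d(2)[OF _ \<eta> True]) (use \<zeta> in simp)
        then have "g \<zeta> - g \<eta> \<le> e / 2" unfolding dist_real_def by linarith
        then have "p * (g \<zeta> - g \<eta>) \<le> p * (e / 2)" using p by (rule mult_left_mono)
        then show ?thesis using e by (simp add: algebra_simps)
      next
        case False
        have "norm (\<eta> - \<zeta>) \<le> norm (\<eta> - of_real r * \<zeta>) + norm (of_real r * \<zeta> - \<zeta>)"
          using norm_triangle_ineq[of "\<eta> - of_real r * \<zeta>" "of_real r * \<zeta> - \<zeta>"] by simp
        moreover have "norm (of_real r * \<zeta> - \<zeta>) = t"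
        proof -
          have "of_real r * \<zeta> - \<zeta> = of_real (- t) * \<zeta>" by (simp add: r_def algebra_simps)
          then show ?thesis using t(1) \<zeta> by (simp add: norm_mult)
        qed
        ultimately have far: "norm (\<eta> - of_real r * \<zeta>) \<ge> d / 2" using False t(2) by (simp add: dist_norm)
        have "p \<le> 2 * t / (d / 2)\<^sup>2"
          unfolding p_def poisson_def using far d(1) r2 r t(1) \<zeta>
          by (intro frac_le power_mono) (auto simp: norm_mult)
        also have "\<dots> \<le> 2 * (e * d\<^sup>2 / (32 * B)) / (d / 2)\<^sup>2" using t(4) d(1) by (intro divide_right_mono mult_left_mono) auto
        also have "\<dots> = e / (4 * B)" using d(1) by (simp add: power2_eq_square field_simps)
        finally have pB: "p * (2 * B) \<le> e / 2" using B(1) by (simp add: field_simps)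
        have "g \<zeta> - g \<eta> \<le> 2 * B" using B(2)[of \<zeta>] B(2)[of \<eta>] \<zeta> \<eta> by auto
        then have "p * (g \<zeta> - g \<eta>) \<le> p * (2 * B)" using p by (rule mult_left_mono)
        then have "p * (g \<zeta> - g \<eta>) \<le> e / 2" using pB by linarith
        moreover have "0 \<le> e / 2 * p" using e p by simp
        ultimately show ?thesis by (simp add: algebra_simps)
      qed
    qed
    also have "\<dots> = e"
      by (subst set_integral_add(2)[OF i4 i5]) (simp add: poisson_integral_1 z1 sphere_integral_const)
    finally show ?thesis by (simp add: sym)
  qed
  then show ?thesis using that r by blast
qed

locale finite_entropy_one_component = one_component +
  assumes nonrot: "\<not> is_rotation F"
    and finite_entropy: "integrable circle_measure (\<lambda>z. ln (norm (boundary_deriv F z)))"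
begin

definition \<phi> :: "complex \<Rightarrow> real" where "\<phi> y = ln (norm (f' y))"

text \<open>
  The quotient F z / z has modulus less than 1 by the strict form of the Schwarz lemma, hence is bounded
  away from 1 on compact discs.
\<close>

lemma uniform_contraction:
  assumes r: "0 < r" "r < 1"
  obtains q where "0 < q" "q < 1" "\<And>z. norm z \<le> r \<Longrightarrow> norm (F z) \<le> q * norm z"
proof -
  define G where "G = (\<lambda>z. if z = 0 then deriv F 0 else (F z - F 0) / (z - 0))"
  have hG: "G holomorphic_on ball 0 1" unfolding G_def by (rule pole_lemma[OF hol]) auto
  have no_rot: "\<not> ((\<exists>z. norm z < 1 \<and> z \<noteq> 0 \<and> norm (F z) = norm z) \<or> norm (deriv F 0) = 1)"
    using Schwarz_Lemma(3)[OF hol F0 maps, of 0] nonrot by (fastforce simp: is_rotation_def)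
  have G1: "norm (G z) < 1" if "norm z < 1" for z
  proof (cases "z = 0")
    case True
    have "norm (deriv F 0) \<le> 1" using Schwarz_Lemma(2)[OF hol F0 maps, of 0] by simp
    then show ?thesis using True no_rot by (auto simp: G_def)
  next
    case False
    then have "norm (F z) < norm z" using Schwarz[OF that] no_rot that by fastforce
    then show ?thesis using False by (simp add: G_def F0 norm_divide)
  qed
  have "continuous_on (cball 0 r) (\<lambda>z. norm (G z))"
    by (intro continuous_intros continuous_on_subset[OF holomorphic_on_imp_continuous_on[OF hG]]) (use r in auto)
  then obtain w where w: "w \<in> cball 0 r" "\<And>z. z \<in> cball 0 r \<Longrightarrow> norm (G z) \<le> norm (G w)"
    using continuous_attains_sup[OF compact_cball, of 0 r "\<lambda>z. norm (G z)"] r by auto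
  define q where "q = max (norm (G w)) (1/2)"
  show ?thesis
  proof (rule that[of q])
    show "0 < q" "q < 1" using G1[of w] w(1) r by (auto simp: q_def)
    fix z :: complex assume z: "norm z \<le> r"
    show "norm (F z) \<le> q * norm z"
    proof (cases "z = 0")
      case False
      have "norm (G z) \<le> q" using w(2)[of z] z by (simp add: q_def)
      then show ?thesis using False by (simp add: G_def F0 norm_divide divide_le_eq)
    qed (simp add: F0)
  qed
qed

lemma iterates_in_disc: "norm z < 1 \<Longrightarrow> norm ((F ^^ n) z) < 1"
  by (induction n) (auto intro: maps)

lemma iterates_contract:
  assumes r: "0 < r" "r < 1" and q: "0 < q" "q < 1" "\<And>z. norm z \<le> r \<Longrightarrow> norm (F z) \<le> q * norm z" and z: "norm z \<le> r"
  shows "norm ((F ^^ n) z) \<le> q ^ n"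
proof -
  have "norm ((F ^^ n) z) \<le> q ^ n * norm z"
  proof (induction n)
    case (Suc n)
    have "q ^ n * norm z \<le> 1 * r" using q(1,2) z by (intro mult_mono power_le_one) auto
    then have "norm (F ((F ^^ n) z)) \<le> q * norm ((F ^^ n) z)" using Suc by (intro q(3)) simp
    also have "\<dots> \<le> q * (q ^ n * norm z)" using Suc q(1) by (intro mult_left_mono) auto
    finally show ?case by simp
  qed simp
  also have "\<dots> \<le> q ^ n * 1" using q(1) z r by (intro mult_left_mono) auto
  finally show ?thesis by simp
qed

text \<open>
  Julia's inequality at the midpoint y/2 of the radius, which F contracts towards 0 by a definite factor.
\<close>

lemma uniform_expansion: "\<exists>l>0. \<forall>y\<in>regular. l \<le> \<phi> y"
proof -
  obtain q where q: "0 < q" "q < 1" "\<And>z. norm z \<le> 1/2 \<Longrightarrow> norm (F z) \<le> q * norm z"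
    using uniform_contraction[of "1/2"] by auto
  define k where "k = 3 * ((1 - q/2) / (1 + q/2))"
  have k: "k > 1" using q by (simp add: k_def field_simps)
  have "ln k \<le> \<phi> y" if y: "y \<in> regular" for y
  proof -
    define z where "z = of_real (1/2) * y"
    have nz: "norm z = 1/2" using regular_norm(1)[OF y] by (simp add: z_def norm_mult norm_divide)
    have "y - z = of_real (1/2) * y" by (simp add: z_def)
    then have "norm (y - z) = 1/2" using regular_norm(1)[OF y] by (simp add: norm_mult norm_divide)
    then have p: "poisson z y = 3" by (simp only: poisson_def nz) (simp add: power2_eq_square)
    have Fz: "norm (F z) \<le> q / 2" using q(3)[of z] nz by simp
    have "poisson (F z) (f y) \<le> (1 + norm (F z)) / (1 - norm (F z))"
      using regular_norm(2)[OF y] maps[of z] nz by (intro poisson_bounds) auto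
    also have "\<dots> \<le> (1 + q/2) / (1 - q/2)" using Fz q by (intro frac_le) auto
    finally have "norm (f' y) * poisson (F z) (f y) \<le> norm (f' y) * ((1 + q/2) / (1 - q/2))"
      by (intro mult_left_mono) auto
    then have "3 \<le> norm (f' y) * ((1 + q/2) / (1 - q/2))"
      using julia[OF y, of z] nz p by simp
    then have "k \<le> norm (f' y)" using q by (simp add: k_def field_simps)
    then show ?thesis unfolding \<phi>_def using k by (intro ln_mono) auto
  qed
  then show ?thesis using k by (intro exI[of _ "ln k"]) auto
qed

lemma \<phi>_nonneg: "y \<in> regular \<Longrightarrow> \<phi> y \<ge> 0"
  using boundary_deriv_polar(2)[of y] by (simp add: \<phi>_def)

lemma \<phi>_measurable [measurable]: "\<phi> \<in> borel_measurable borel"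
  using borel_measurable_integrable[OF finite_entropy] unfolding \<phi>_def by simp

text \<open>
  One backward step: the weights add up to 1 because F 0 = 0, by \<open>fibre_has_sum\<close> at z = 0.
\<close>

definition K :: "complex \<Rightarrow> complex pmf" where
  "K x = embed_pmf (\<lambda>y. if y \<in> fibre x then 1 / norm (f' y) else 0)"

lemma pmf_K:
  assumes x: "norm x = 1"
  shows "pmf (K x) y = (if y \<in> fibre x then 1 / norm (f' y) else 0)"
  unfolding K_def
proof (rule pmf_embed_pmf)
  have "((\<lambda>y. 1 / norm (f' y)) has_sum 1) (fibre x)"
  proof -
    have "((\<lambda>y. poisson 0 y / norm (f' y)) has_sum 1) (fibre x)"
      using fibre_has_sum[OF x, of 0] x by (simp add: poisson_0 F0)
    moreover have "poisson 0 y / norm (f' y) = 1 / norm (f' y)" if "y \<in> fibre x" for y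
      using that regular_norm(1)[of y] by (simp add: fibre_def poisson_0)
    ultimately show ?thesis by (simp only: has_sum_cong[of "fibre x" "\<lambda>y. poisson 0 y / norm (f' y)" "\<lambda>y. 1 / norm (f' y)"])
  qed
  then have "(\<integral>\<^sup>+y. ennreal (1 / norm (f' y)) \<partial>count_space (fibre x)) = 1"
    by (subst nn_integral_count_space_has_sum) auto
  also have "(\<integral>\<^sup>+y. ennreal (1 / norm (f' y)) \<partial>count_space (fibre x))
      = (\<integral>\<^sup>+y. ennreal (if y \<in> fibre x then 1 / norm (f' y) else 0) \<partial>count_space (fibre x))"
    by (intro nn_integral_cong) simp
  also have "\<dots> = (\<integral>\<^sup>+y. ennreal (if y \<in> fibre x then 1 / norm (f' y) else 0) \<partial>count_space UNIV)"
    by (rule nn_integral_count_space_eq) auto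
  finally show "(\<integral>\<^sup>+y. ennreal (if y \<in> fibre x then 1 / norm (f' y) else 0) \<partial>count_space UNIV) = 1" .
qed simp

lemma set_pmf_K: "norm x = 1 \<Longrightarrow> set_pmf (K x) = fibre x"
proof -
  assume x: "norm x = 1"
  have "norm (f' y) \<noteq> 0" if "y \<in> fibre x" for y
    using boundary_deriv_polar(2)[of y] that by (auto simp: fibre_def)
  then show "set_pmf (K x) = fibre x" by (auto simp: set_pmf_eq pmf_K[OF x])
qed

sublocale backward_chain K "sphere 0 1" f
  by unfold_locales (auto simp: set_pmf_K fibre_def regular_norm)

lemma nn_integral_K_poisson:
  assumes x: "norm x = 1" and z: "norm z < 1"
  shows "(\<integral>\<^sup>+y. ennreal (poisson z y) \<partial>K x) = ennreal (poisson (F z) x)"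
proof -
  have "(\<integral>\<^sup>+y. ennreal (poisson z y) \<partial>K x) = (\<integral>\<^sup>+y. ennreal (poisson z y / norm (f' y)) \<partial>count_space (fibre x))"
    unfolding nn_integral_pmf_count_space set_pmf_K[OF x]
    by (intro nn_integral_cong)
       (use poisson_nonneg z in \<open>auto simp: pmf_K[OF x] ennreal_mult[symmetric] less_imp_le\<close>)
  also have "\<dots> = ennreal (poisson (F z) x)"
    using poisson_nonneg[of z] z by (intro nn_integral_count_space_has_sum fibre_has_sum x) auto
  finally show ?thesis .
qed

lemma nn_integral_P_poisson:
  assumes x: "norm x = 1" and z: "norm z < 1"
  shows "(\<integral>\<^sup>+y. ennreal (poisson z y) \<partial>P n x) = ennreal (poisson ((F ^^ n) z) x)"
  using x
proof (induction n arbitrary: x)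
  case (Suc n)
  have "(\<integral>\<^sup>+y. ennreal (poisson z y) \<partial>P (Suc n) x) = (\<integral>\<^sup>+u. ennreal (poisson ((F ^^ n) z) u) \<partial>K x)"
    using K_in[of x] Suc.prems by (auto intro!: nn_integral_cong_AE simp: AE_measure_pmf_iff Suc.IH)
  also have "\<dots> = ennreal (poisson ((F ^^ Suc n) z) x)"
    using nn_integral_K_poisson[OF Suc.prems iterates_in_disc[OF z]] by simp
  finally show ?case .
qed simp

text \<open>
  Up to e/2, g is an integral of Poisson kernels of the points r \<eta>, with density g. Under n backward
  steps these become the kernels of F^n (r \<eta>), which are close to 1 uniformly in the starting point. An upper
  bound is enough, since it can be applied to a constant minus the function as well.
\<close>

lemma equidistribution_upper:
  fixes g :: "complex \<Rightarrow> real"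
  assumes g: "continuous_on (sphere 0 1) g" "\<And>y. y \<in> sphere 0 1 \<Longrightarrow> g y \<ge> 0" and e: "e > 0"
  obtains n0 where "\<And>n x. n \<ge> n0 \<Longrightarrow> norm x = 1 \<Longrightarrow>
    (\<integral>\<^sup>+y. ennreal (g y) \<partial>P n x) \<le> ennreal ((LINT \<eta>:sphere 0 1|circle_measure. g \<eta>) + e)"
proof -
  define I where "I = (LINT \<eta>:sphere 0 1|circle_measure. g \<eta>)"
  have ig: "set_integrable circle_measure (sphere 0 1) g" by (rule set_integral_circle_continuous[OF g(1)])
  have I: "I \<ge> 0" unfolding I_def set_lebesgue_integral_def using g(2) by (intro integral_nonneg_AE) (auto simp: indicator_def)
  obtain r where r: "0 < r" "r < 1"
    "\<And>\<zeta>. norm \<zeta> = 1 \<Longrightarrow> g \<zeta> \<le> e / 2 + (LINT \<eta>:sphere 0 1|circle_measure. poisson (of_real r * \<eta>) \<zeta> * g \<eta>)"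
    using poisson_approximation[OF g(1), of "e/2"] e by auto
  obtain q where q: "0 < q" "q < 1" "\<And>z. norm z \<le> r \<Longrightarrow> norm (F z) \<le> q * norm z"
    using uniform_contraction[OF r(1,2)] by auto
  have "(\<lambda>n. (1 + q ^ n) / (1 - q ^ n) * I) \<longlonglongrightarrow> (1 + 0) / (1 - 0) * I"
    by (intro tendsto_intros LIMSEQ_power_zero) (use q in auto)
  then have "eventually (\<lambda>n. (1 + q ^ n) / (1 - q ^ n) * I < I + e / 2) sequentially"
    using e by (intro order_tendstoD) auto
  then obtain n0 where n0: "\<And>n. n \<ge> n0 \<Longrightarrow> (1 + q ^ n) / (1 - q ^ n) * I < I + e / 2"
    by (auto simp: eventually_sequentially)
  define h where "h = (\<lambda>\<eta>. indicator (sphere 0 1) \<eta> * g \<eta>)"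
  have h_measurable [measurable]: "h \<in> borel_measurable borel"
    using borel_measurable_continuous_on_indicator[OF _ g(1)] by (simp add: h_def)
  have h0: "h \<eta> \<ge> 0" for \<eta> using g(2) by (auto simp: h_def indicator_def)
  have hI: "(\<integral>\<^sup>+\<eta>. ennreal (h \<eta>) \<partial>circle_measure) = ennreal I"
    unfolding I_def set_lebesgue_integral_def using ig h0
    by (subst nn_integral_eq_integral) (auto simp: h_def set_integrable_def)
  have rn: "norm (of_real r * \<eta>) = r" if "norm \<eta> = 1" for \<eta> :: complex
    using r that by (simp add: norm_mult)
  show ?thesis
  proof (rule that[of "max n0 1"], fold I_def)
    fix n and x :: complex assume n: "n \<ge> max n0 1" and x: "norm x = 1"
    have qn: "q ^ n < 1" using q n by (intro power_less_one_iff[THEN iffD2]) auto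
    have "(\<integral>\<^sup>+y. ennreal (g y) \<partial>P n x)
       \<le> (\<integral>\<^sup>+y. ennreal (e / 2) + (\<integral>\<^sup>+\<eta>. ennreal (poisson (of_real r * \<eta>) y) * ennreal (h \<eta>) \<partial>circle_measure) \<partial>P n x)"
    proof (rule nn_integral_mono_AE, subst AE_measure_pmf_iff, rule ballI)
      fix y assume "y \<in> set_pmf (P n x)"
      then have y: "norm y = 1" using P_support[of x y n] x by simp
      have cont: "continuous_on (sphere 0 1) (\<lambda>\<eta>. poisson (of_real r * \<eta>) y * g \<eta>)"
      proof (intro continuous_intros g(1))
        have "y - of_real r * \<eta> \<noteq> 0" if "\<eta> \<in> sphere 0 1" for \<eta>
          using rn[of \<eta>] that y r by auto
        then show "continuous_on (sphere 0 1) (\<lambda>\<eta>. poisson (of_real r * \<eta>) y)"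
          unfolding poisson_def by (intro continuous_intros) auto
      qed
      have p0: "poisson (of_real r * \<eta>) y \<ge> 0" if "norm \<eta> = 1" for \<eta> using rn[OF that] r by (intro poisson_nonneg) simp
      have "(\<integral>\<^sup>+\<eta>. ennreal (poisson (of_real r * \<eta>) y) * ennreal (h \<eta>) \<partial>circle_measure)
          = (\<integral>\<^sup>+\<eta>. ennreal (indicator (sphere 0 1) \<eta> *\<^sub>R (poisson (of_real r * \<eta>) y * g \<eta>)) \<partial>circle_measure)"
        by (intro nn_integral_cong) (auto simp: h_def indicator_def ennreal_mult p0 g(2))
      also have "\<dots> = ennreal (LINT \<eta>:sphere 0 1|circle_measure. poisson (of_real r * \<eta>) y * g \<eta>)"
        unfolding set_lebesgue_integral_def
        using set_integral_circle_continuous(1)[OF cont] p0 g(2)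
        by (intro nn_integral_eq_integral) (auto simp: set_integrable_def indicator_def)
      finally have *: "(\<integral>\<^sup>+\<eta>. ennreal (poisson (of_real r * \<eta>) y) * ennreal (h \<eta>) \<partial>circle_measure)
          = ennreal (LINT \<eta>:sphere 0 1|circle_measure. poisson (of_real r * \<eta>) y * g \<eta>)" .
      have "0 \<le> (LINT \<eta>:sphere 0 1|circle_measure. poisson (of_real r * \<eta>) y * g \<eta>)"
        unfolding set_lebesgue_integral_def using p0 g(2) by (intro integral_nonneg_AE) (auto simp: indicator_def)
      then have "ennreal (e / 2 + (LINT \<eta>:sphere 0 1|circle_measure. poisson (of_real r * \<eta>) y * g \<eta>))
          = ennreal (e / 2) + ennreal (LINT \<eta>:sphere 0 1|circle_measure. poisson (of_real r * \<eta>) y * g \<eta>)"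
        using e by (intro ennreal_plus) auto
      then show "ennreal (g y) \<le> ennreal (e / 2) + (\<integral>\<^sup>+\<eta>. ennreal (poisson (of_real r * \<eta>) y) * ennreal (h \<eta>) \<partial>circle_measure)"
        unfolding * using ennreal_leI[OF r(3)[OF y]] by simp
    qed
    also have "\<dots> = ennreal (e / 2) + (\<integral>\<^sup>+\<eta>. (\<integral>\<^sup>+y. ennreal (poisson (of_real r * \<eta>) y) * ennreal (h \<eta>) \<partial>P n x) \<partial>circle_measure)"
      by (subst nn_integral_add) (simp_all add: nn_integral_pmf_swap)
    also have "(\<integral>\<^sup>+\<eta>. (\<integral>\<^sup>+y. ennreal (poisson (of_real r * \<eta>) y) * ennreal (h \<eta>) \<partial>P n x) \<partial>circle_measure)
       \<le> (\<integral>\<^sup>+\<eta>. ennreal ((1 + q ^ n) / (1 - q ^ n)) * ennreal (h \<eta>) \<partial>circle_measure)"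
      using AE_circle_in_sphere
    proof (intro nn_integral_mono_AE, eventually_elim)
      fix \<eta> :: complex assume "\<eta> \<in> sphere 0 1"
      then have \<eta>: "norm \<eta> = 1" by simp
      define w where "w = (F ^^ n) (of_real r * \<eta>)"
      have w: "norm w \<le> q ^ n" unfolding w_def by (rule iterates_contract[OF r(1,2) q]) (simp_all add: rn \<eta>)
      have "(\<integral>\<^sup>+y. ennreal (poisson (of_real r * \<eta>) y) \<partial>P n x) = ennreal (poisson w x)"
        unfolding w_def by (rule nn_integral_P_poisson[OF x]) (use rn[OF \<eta>] r in simp)
      moreover have "poisson w x \<le> (1 + norm w) / (1 - norm w)" using w qn x by (intro poisson_bounds) auto
      moreover have "(1 + norm w) / (1 - norm w) \<le> (1 + q ^ n) / (1 - q ^ n)" using w qn q(1) by (intro frac_le add_nonneg_nonneg) auto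
      ultimately show "(\<integral>\<^sup>+y. ennreal (poisson (of_real r * \<eta>) y) * ennreal (h \<eta>) \<partial>P n x)
          \<le> ennreal ((1 + q ^ n) / (1 - q ^ n)) * ennreal (h \<eta>)"
        by (simp add: nn_integral_multc mult_right_mono ennreal_leI)
    qed
    also have "\<dots> = ennreal ((1 + q ^ n) / (1 - q ^ n) * I)"
    proof -
      have "0 \<le> (1 + q ^ n) / (1 - q ^ n)" using qn q(1) by simp
      then have "ennreal ((1 + q ^ n) / (1 - q ^ n) * I) = ennreal ((1 + q ^ n) / (1 - q ^ n)) * ennreal I"
        using I by (rule ennreal_mult)
      then show ?thesis by (simp only:) (simp add: nn_integral_cmult hI)
    qed
    also have "ennreal (e / 2) + \<dots> \<le> ennreal (e / 2) + ennreal (I + e / 2)"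
      using n0[of n] n by (intro add_left_mono ennreal_leI) auto
    also have "\<dots> = ennreal (I + e)" using e I by (subst ennreal_plus[symmetric]) auto
    finally show "(\<integral>\<^sup>+y. ennreal (g y) \<partial>P n x) \<le> ennreal (I + e)" by (simp add: add_left_mono)
  qed
qed

end

section \<open>The law of large numbers for the logarithm of the derivative\<close>

context finite_entropy_one_component
begin

definition entropy :: real where "entropy = (LINT z|circle_measure. \<phi> z)"

lemma integrable_\<phi>: "integrable circle_measure \<phi>"
  using finite_entropy unfolding \<phi>_def .

lemma entropy_near_singular_set:
  assumes C: "C \<ge> 0" and e: "e > 0"
  obtains \<epsilon> where "\<epsilon> > 0" "(\<integral>\<^sup>+\<eta>. ennreal (\<phi> \<eta> + C) * indicator {\<eta>. \<delta> \<eta> < \<epsilon>} \<eta> \<partial>circle_measure) \<le> ennreal e"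
proof -
  define w where "w = (\<lambda>\<eta>. ennreal (\<bar>\<phi> \<eta>\<bar> + C))"
  have wfin: "(\<integral>\<^sup>+\<eta>. w \<eta> \<partial>circle_measure) < \<infinity>"
  proof -
    have "integrable circle_measure (\<lambda>\<eta>. \<bar>\<phi> \<eta>\<bar> + C)" using integrable_\<phi> by simp
    from this[THEN nn_integral_eq_integral] show ?thesis using C by (simp add: w_def)
  qed
  define u where "u = (\<lambda>n::nat. \<lambda>\<eta>. ennreal (\<phi> \<eta> + C) * indicator {\<eta>. \<delta> \<eta> < 1 / real (Suc n)} \<eta>)"
  have "(\<lambda>n. \<integral>\<^sup>+\<eta>. u n \<eta> \<partial>circle_measure) \<longlonglongrightarrow> (\<integral>\<^sup>+\<eta>. 0 \<partial>circle_measure)"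
  proof (rule nn_integral_dominated_convergence[where w = w])
    show "AE \<eta> in circle_measure. (\<lambda>n. u n \<eta>) \<longlonglongrightarrow> 0"
      using AE_regular
    proof eventually_elim
      fix \<eta> assume "\<eta> \<in> regular"
      then have "\<delta> \<eta> > 0" by (rule \<delta>_pos_if_regular)
      then obtain n0 where n0: "1 / real (Suc n0) < \<delta> \<eta>" using nat_approx_posE by blast
      have "u n \<eta> = 0" if "n \<ge> n0" for n
      proof -
        have "1 / real (Suc n) \<le> 1 / real (Suc n0)" using that by (simp add: frac_le)
        then show ?thesis using n0 by (simp add: u_def indicator_def)
      qed
      then show "(\<lambda>n. u n \<eta>) \<longlonglongrightarrow> 0"
        by (intro tendsto_eventually) (auto simp: eventually_sequentially)
    qed
    show "AE \<eta> in circle_measure. u n \<eta> \<le> w \<eta>" for n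
      by (intro AE_I2) (auto simp: u_def w_def indicator_def intro!: ennreal_leI)
  qed (use wfin in \<open>auto simp: u_def w_def\<close>)
  then have "eventually (\<lambda>n. (\<integral>\<^sup>+\<eta>. u n \<eta> \<partial>circle_measure) < ennreal e) sequentially"
    using e by (intro order_tendstoD) auto
  then obtain n where "(\<integral>\<^sup>+\<eta>. u n \<eta> \<partial>circle_measure) < ennreal e" by (auto simp: eventually_sequentially)
  then show ?thesis by (intro that[of "1 / real (Suc n)"]) (auto simp: u_def)
qed

text \<open>
  Both derivatives are comparable to 1/\<delta>, and \<delta> changes at most by a factor on this ball.
\<close>

lemma \<phi>_slowly_varying:
  assumes y: "y \<in> regular" and \<eta>: "norm \<eta> = 1" "dist \<eta> y < \<delta> y / 2"
  shows "\<phi> y \<le> \<phi> \<eta> + ln (135 * M / c)"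
proof -
  have \<delta>y: "\<delta> y > 0" using y by (rule \<delta>_pos_if_regular)
  have d: "\<delta> \<eta> \<le> 3/2 * \<delta> y" "\<delta> y / 2 \<le> \<delta> \<eta>"
    using \<delta>_lipschitz[of \<eta> y] \<delta>_lipschitz[of y \<eta>] \<eta>(2) by (simp_all add: dist_commute)
  then have \<delta>\<eta>: "\<delta> \<eta> > 0" using \<delta>y by simp
  then have r\<eta>: "\<eta> \<in> regular" using \<eta>(1) by (simp add: regular_iff)
  have M: "M > 0" using M_ge_1 by simp
  have "norm (f' y) \<le> 2 / (c * \<delta> y)" by (rule regular_if_\<delta>_pos(2)[OF regular_norm(1)[OF y] \<delta>y])
  also have "\<dots> \<le> 2 / (c * (2/3 * \<delta> \<eta>))" using d(1) \<delta>\<eta> \<delta>y c by (intro divide_left_mono mult_left_mono) auto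
  also have "\<dots> = 135 * M / c * (1 / (45 * M * \<delta> \<eta>))" using M c \<delta>\<eta> by (simp add: field_simps)
  also have "\<dots> \<le> 135 * M / c * norm (f' \<eta>)" using boundary_deriv_lower[OF r\<eta>] M c by (intro mult_left_mono) auto
  finally have le: "norm (f' y) \<le> 135 * M / c * norm (f' \<eta>)" .
  have pos: "norm (f' y) > 0" "norm (f' \<eta>) > 0" using boundary_deriv_polar(2)[OF y] boundary_deriv_polar(2)[OF r\<eta>] by linarith+
  have "\<phi> y \<le> ln (135 * M / c * norm (f' \<eta>))" unfolding \<phi>_def using le pos by (intro ln_mono) auto
  also have "\<dots> = ln (135 * M / c) + \<phi> \<eta>" unfolding \<phi>_def using M c pos by (subst ln_mult) auto
  finally show ?thesis by simp
qed

text \<open>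
  At y the function \<phi> is at most \<phi> \<eta> + C for all \<eta> close to y on the scale \<delta> y. So
  \<open>average_poisson_ge\<close> bounds it by Poisson kernels of points above \<eta>, whose expectation under K x is at most M. The bound left is
  an integral of \<phi> + C over the set where \<delta> is small, which does not depend on x.
\<close>

lemma transfer_tail:
  assumes e: "e > 0"
  obtains \<epsilon> where "\<epsilon> > 0"
    "\<And>x. norm x = 1 \<Longrightarrow> (\<integral>\<^sup>+y. ennreal (\<phi> y) * indicator {y. \<delta> y < \<epsilon>} y \<partial>K x) \<le> ennreal e"
proof -
  define C where "C = ln (135 * M / c)"
  have C: "C \<ge> 0" unfolding C_def using M_ge_1 c by (intro ln_ge_zero) (simp add: le_divide_eq)
  define A where "A = 280 * pi * M"
  have A: "A > 0" using M_ge_1 by (simp add: A_def)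
  obtain \<epsilon>1 where \<epsilon>1: "\<epsilon>1 > 0"
    "(\<integral>\<^sup>+\<eta>. ennreal (\<phi> \<eta> + C) * indicator {\<eta>. \<delta> \<eta> < \<epsilon>1} \<eta> \<partial>circle_measure) \<le> ennreal (e / A)"
    using entropy_near_singular_set[OF C, of "e / A"] e A by auto
  define \<epsilon> where "\<epsilon> = min (\<epsilon>1 / 2) (1 / 200)"
  have \<epsilon>: "\<epsilon> > 0" "2 * \<epsilon> \<le> \<epsilon>1" "\<epsilon> \<le> 1/200" using \<epsilon>1(1) by (auto simp: \<epsilon>_def)
  define h where "h = (\<lambda>\<eta>. ennreal (\<phi> \<eta> + C) * indicator {\<eta>. \<delta> \<eta> < 2 * \<epsilon>} \<eta>)"
  have h_measurable [measurable]: "h \<in> borel_measurable borel" unfolding h_def by measurable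
  define s where "s = (\<lambda>\<eta>. of_real (1 - 20 * \<delta> \<eta>) * \<eta>)"
  have s_measurable [measurable]: "s \<in> borel_measurable borel" unfolding s_def by measurable
  have "(\<integral>\<^sup>+y. ennreal (\<phi> y) * indicator {y. \<delta> y < \<epsilon>} y \<partial>K x) \<le> ennreal e" if x: "norm x = 1" for x
  proof -
    have "(\<integral>\<^sup>+y. ennreal (\<phi> y) * indicator {y. \<delta> y < \<epsilon>} y \<partial>K x)
       \<le> (\<integral>\<^sup>+y. ennreal (280 * pi) * (\<integral>\<^sup>+\<eta>. ennreal (poisson (s \<eta>) y) * h \<eta> \<partial>circle_measure) \<partial>K x)"
    proof (rule nn_integral_mono_AE, subst AE_measure_pmf_iff, rule ballI)
      fix y assume "y \<in> set_pmf (K x)"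
      then have y: "y \<in> regular" by (simp add: set_pmf_K[OF x] fibre_def)
      show "ennreal (\<phi> y) * indicator {y. \<delta> y < \<epsilon>} y
          \<le> ennreal (280 * pi) * (\<integral>\<^sup>+\<eta>. ennreal (poisson (s \<eta>) y) * h \<eta> \<partial>circle_measure)"
      proof (cases "\<delta> y < \<epsilon>")
        case True
        have "ennreal (\<phi> y) \<le> ennreal (280 * pi) * (\<integral>\<^sup>+\<eta>. ennreal (poisson (of_real (1 - 20 * \<delta> \<eta>) * \<eta>) y) * h \<eta> \<partial>circle_measure)"
        proof (rule average_poisson_ge)
          show "\<bar>\<delta> u - \<delta> v\<bar> \<le> dist u v" for u v
            using \<delta>_lipschitz[of u v] \<delta>_lipschitz[of v u] by (simp add: dist_commute)
          show "0 < \<delta> y" "norm y = 1" using y by (auto simp: regular_iff)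
          show "\<delta> y \<le> 1/30" using True \<epsilon> by simp
          fix \<eta> :: complex assume \<eta>: "norm \<eta> = 1" "dist \<eta> y < \<delta> y / 2"
          have "\<delta> \<eta> < 2 * \<epsilon>" using \<delta>_lipschitz[of \<eta> y] \<eta>(2) True \<epsilon>(1) by linarith
          then show "ennreal (\<phi> y) \<le> h \<eta>"
            using \<phi>_slowly_varying[OF y \<eta>] by (simp add: h_def C_def ennreal_leI)
        qed measurable
        then show ?thesis using True by (simp add: s_def)
      qed simp
    qed
    also have "\<dots> = ennreal (280 * pi) * (\<integral>\<^sup>+\<eta>. (\<integral>\<^sup>+y. ennreal (poisson (s \<eta>) y) * h \<eta> \<partial>K x) \<partial>circle_measure)"
      by (simp add: nn_integral_cmult nn_integral_pmf_swap)
    also have "(\<integral>\<^sup>+\<eta>. (\<integral>\<^sup>+y. ennreal (poisson (s \<eta>) y) * h \<eta> \<partial>K x) \<partial>circle_measure)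
        \<le> (\<integral>\<^sup>+\<eta>. ennreal M * (ennreal (\<phi> \<eta> + C) * indicator {\<eta>. \<delta> \<eta> < \<epsilon>1} \<eta>) \<partial>circle_measure)"
      using AE_regular
    proof (intro nn_integral_mono_AE, eventually_elim)
      fix \<eta> assume \<eta>: "\<eta> \<in> regular"
      have \<eta>1: "norm \<eta> = 1" "\<delta> \<eta> > 0" using \<eta> by (auto simp: regular_iff)
      show "(\<integral>\<^sup>+y. ennreal (poisson (s \<eta>) y) * h \<eta> \<partial>K x) \<le> ennreal M * (ennreal (\<phi> \<eta> + C) * indicator {\<eta>. \<delta> \<eta> < \<epsilon>1} \<eta>)"
      proof (cases "\<delta> \<eta> < 2 * \<epsilon>")
        case True
        have s1: "norm (s \<eta>) < 1" using \<eta>1 True \<epsilon> unfolding s_def by (simp only: norm_mult norm_of_real) simp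
        have "norm (F (s \<eta>)) \<le> c1" unfolding s_def
          by (rule small_above_sublevel[OF \<eta>1(1), of "2 * \<delta> \<eta>"]) (use \<eta>1 True \<epsilon> in auto)
        then have "poisson (F (s \<eta>)) x \<le> M" using x by (rule poisson_le_M)
        then have "(\<integral>\<^sup>+y. ennreal (poisson (s \<eta>) y) \<partial>K x) \<le> ennreal M"
          unfolding nn_integral_K_poisson[OF x s1] by (rule ennreal_leI)
        then have "(\<integral>\<^sup>+y. ennreal (poisson (s \<eta>) y) * h \<eta> \<partial>K x) \<le> ennreal M * h \<eta>"
          by (simp add: nn_integral_multc mult_right_mono)
        moreover have "h \<eta> = ennreal (\<phi> \<eta> + C) * indicator {\<eta>. \<delta> \<eta> < \<epsilon>1} \<eta>"
          using True \<epsilon>(2) by (simp add: h_def)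
        ultimately show ?thesis by simp
      qed (simp add: h_def)
    qed
    also have "\<dots> = ennreal M * (\<integral>\<^sup>+\<eta>. ennreal (\<phi> \<eta> + C) * indicator {\<eta>. \<delta> \<eta> < \<epsilon>1} \<eta> \<partial>circle_measure)"
      by (rule nn_integral_cmult) measurable
    also have "ennreal (280 * pi) * \<dots> \<le> ennreal (280 * pi) * (ennreal M * ennreal (e / A))"
      by (intro mult_left_mono \<epsilon>1(2)) auto
    also have "\<dots> = ennreal (280 * pi * (M * (e / A)))"
    proof -
      have "ennreal (280 * pi * (M * (e / A))) = ennreal (280 * pi) * ennreal (M * (e / A))"
        using M_ge_1 e A by (intro ennreal_mult) auto
      moreover have "ennreal (M * (e / A)) = ennreal M * ennreal (e / A)"
        using M_ge_1 e A by (intro ennreal_mult) auto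
      ultimately show ?thesis by (simp only:)
    qed
    also have "280 * pi * (M * (e / A)) = A * (e / A)" by (simp only: A_def mult.assoc)
    also have "A * (e / A) = e" using A by simp
    finally show ?thesis by (simp add: mult_left_mono)
  qed
  then show ?thesis using that \<epsilon>(1) by blast
qed

lemma orbit_regular:
  assumes "norm x = 1" "y \<in> set_pmf (P n x)" "k < n"
  shows "(f ^^ k) y \<in> regular"
  using assms
proof (induction n arbitrary: x)
  case (Suc n)
  then obtain u where u: "u \<in> set_pmf (K x)" "y \<in> set_pmf (P n u)" by auto
  have u1: "u \<in> regular" using u(1) Suc.prems(1) by (simp add: set_pmf_K fibre_def)
  show ?case
  proof (cases "k = n")
    case True
    have "(f ^^ n) y = u" using P_support[of u y n] u(2) regular_norm(1)[OF u1] by simp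
    then show ?thesis using True u1 by simp
  next
    case False
    then show ?thesis using Suc.IH[OF regular_norm(1)[OF u1] u(2)] Suc.prems(3) by simp
  qed
qed simp

lemma L_power_upper:
  fixes \<psi> :: "complex \<Rightarrow> real"
  assumes \<psi>: "continuous_on (sphere 0 1) \<psi>" "(LINT \<eta>:sphere 0 1|circle_measure. \<psi> \<eta>) = 0" and e: "e > 0"
  obtains n0 where "\<And>n x. n \<ge> n0 \<Longrightarrow> norm x = 1 \<Longrightarrow> (L ^^ n) \<psi> x \<le> e"
proof -
  obtain B where B: "\<And>z. z \<in> sphere 0 1 \<Longrightarrow> norm (\<psi> z) \<le> B"
    using compact_imp_bounded[OF compact_continuous_image[OF \<psi>(1) compact_sphere]] unfolding bounded_iff by blast
  then have Bb: "\<forall>y\<in>sphere 0 1. \<bar>\<psi> y\<bar> \<le> B" by simp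
  have B0: "B \<ge> 0" using B[of 1] by simp
  define g where "g = (\<lambda>y. B + \<psi> y)"
  have g0: "g y \<ge> 0" if "y \<in> sphere 0 1" for y using bspec[OF Bb that] by (simp add: g_def)
  have gI: "(LINT \<eta>:sphere 0 1|circle_measure. g \<eta>) = B"
    unfolding g_def using \<psi>
    by (subst set_integral_add(2)) (auto intro!: set_integral_circle_continuous(1) continuous_intros simp: sphere_integral_const)
  obtain n0 where n0: "\<And>n x. n \<ge> n0 \<Longrightarrow> norm x = 1 \<Longrightarrow> (\<integral>\<^sup>+y. ennreal (g y) \<partial>P n x) \<le> ennreal (B + e)"
  proof -
    have cg: "continuous_on (sphere 0 1) g" unfolding g_def using \<psi>(1) by (intro continuous_intros)
    show ?thesis using that equidistribution_upper[OF cg g0 e] unfolding gI by metis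
  qed
  have "(L ^^ n) \<psi> x \<le> e" if n: "n \<ge> n0" and x: "norm x = 1" for n x
  proof -
    have xs: "x \<in> sphere 0 1" using x by simp
    have S: "y \<in> sphere 0 1" if "y \<in> set_pmf (P n x)" for y using P_support[OF xs that] by blast
    have int: "integrable (measure_pmf (P n x)) \<psi>"
      using B S by (intro measure_pmf.integrable_const_bound[where B=B]) (auto simp: AE_measure_pmf_iff)
    have "(\<integral>\<^sup>+y. ennreal (g y) \<partial>P n x) = ennreal (measure_pmf.expectation (P n x) g)"
      using int g0 S by (intro nn_integral_eq_integral) (auto simp: g_def AE_measure_pmf_iff)
    also have "measure_pmf.expectation (P n x) g = B + (L ^^ n) \<psi> x"
      using int expectation_P[OF xs Bb, of n] by (simp add: g_def)
    finally have "ennreal (B + (L ^^ n) \<psi> x) \<le> ennreal (B + e)" using n0[OF n x] by simp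
    then show ?thesis using B0 e by (subst (asm) ennreal_le_iff) auto
  qed
  then show ?thesis using that by blast
qed

lemma L_power_small:
  fixes \<psi> :: "complex \<Rightarrow> real"
  assumes \<psi>: "continuous_on (sphere 0 1) \<psi>" "(LINT \<eta>:sphere 0 1|circle_measure. \<psi> \<eta>) = 0" and e: "e > 0"
  obtains N where "\<forall>x\<in>sphere 0 1. \<bar>(L ^^ N) \<psi> x\<bar> \<le> e"
proof -
  obtain n1 where n1: "\<And>n x. n \<ge> n1 \<Longrightarrow> norm x = 1 \<Longrightarrow> (L ^^ n) \<psi> x \<le> e"
    using L_power_upper[OF \<psi> e] by metis
  have c2: "continuous_on (sphere 0 1) (\<lambda>y. - \<psi> y)" using \<psi>(1) by (intro continuous_intros)
  have i2: "(LINT \<eta>:sphere 0 1|circle_measure. - \<psi> \<eta>) = 0"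
    using \<psi>(2) by (simp add: set_lebesgue_integral_def)
  obtain n2 where n2: "\<And>n x. n \<ge> n2 \<Longrightarrow> norm x = 1 \<Longrightarrow> (L ^^ n) (\<lambda>y. - \<psi> y) x \<le> e"
    using L_power_upper[OF c2 i2 e] by metis
  have "(L ^^ n) (\<lambda>y. - \<psi> y) = (\<lambda>x. - (L ^^ n) \<psi> x)" for n
    by (induction n) (auto simp: L_def)
  then have "\<forall>x\<in>sphere 0 1. \<bar>(L ^^ max n1 n2) \<psi> x\<bar> \<le> e"
    using n1[of "max n1 n2"] n2[of "max n1 n2"] by (auto simp: abs_le_iff)
  then show ?thesis using that by blast
qed

lemma LLN_continuous:
  fixes \<psi> :: "complex \<Rightarrow> real"
  assumes \<psi>: "continuous_on (sphere 0 1) \<psi>" and e: "e > 0"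
  defines "a \<equiv> (LINT \<eta>:sphere 0 1|circle_measure. \<psi> \<eta>)"
  obtains n0 where "\<And>n x. n \<ge> n0 \<Longrightarrow> norm x = 1 \<Longrightarrow>
     (\<integral>\<^sup>+y. ennreal \<bar>birkhoff \<psi> n y - real n * a\<bar> \<partial>P n x) \<le> ennreal (real n * e)"
proof -
  define g where "g = (\<lambda>y. \<psi> y - a)"
  have cg: "continuous_on (sphere 0 1) g" unfolding g_def using \<psi> by (intro continuous_intros)
  have gI: "(LINT \<eta>:sphere 0 1|circle_measure. g \<eta>) = 0"
    unfolding g_def a_def using \<psi>
    by (subst set_integral_diff(2)) (auto intro!: set_integral_circle_continuous(1) continuous_intros simp: sphere_integral_const)
  obtain N where N: "\<forall>x\<in>sphere 0 1. \<bar>(L ^^ N) g x\<bar> \<le> e / 2"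
    using L_power_small[OF cg gI, of "e/2"] e by auto
  obtain B where B: "\<And>z. z \<in> sphere 0 1 \<Longrightarrow> norm (g z) \<le> B"
    using compact_imp_bounded[OF compact_continuous_image[OF cg compact_sphere]] unfolding bounded_iff by blast
  then have Bb: "\<forall>y\<in>sphere 0 1. \<bar>g y\<bar> \<le> B" by simp
  define A where "A = real N * B"
  have "((\<lambda>n. (sqrt (real n) * (2 * A) + 2 * A) / real n) \<longlongrightarrow> 0) sequentially" by real_asymp
  then have "eventually (\<lambda>n. (sqrt (real n) * (2 * A) + 2 * A) / real n < e / 2) sequentially"
    using e by (intro order_tendstoD) auto
  then obtain n0 where n0: "\<And>n. n \<ge> n0 \<Longrightarrow> (sqrt (real n) * (2 * A) + 2 * A) / real n < e / 2"
    by (auto simp: eventually_sequentially)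
  show ?thesis
  proof (rule that[of "max n0 1"])
    fix n and x :: complex assume n: "n \<ge> max n0 1" and x: "norm x = 1"
    have "birkhoff \<psi> n y - real n * a = birkhoff g n y" for y
      by (simp add: birkhoff_def g_def sum_subtractf)
    then have "(\<integral>\<^sup>+y. ennreal \<bar>birkhoff \<psi> n y - real n * a\<bar> \<partial>P n x) = (\<integral>\<^sup>+y. ennreal \<bar>birkhoff g n y\<bar> \<partial>P n x)" by simp
    also have "\<dots> \<le> ennreal (sqrt (real n) * (2 * (real N * B)) + 2 * (real N * B) + real n * (e / 2))"
      by (rule birkhoff_mean_le[OF Bb N]) (use x in simp)
    also have "\<dots> \<le> ennreal (real n * e)"
    proof (rule ennreal_leI, fold A_def)
      have "real n > 0" using n by simp
      then have "sqrt (real n) * (2 * A) + 2 * A < e / 2 * real n" using n0[of n] n by (simp add: pos_divide_less_eq)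
      then show "sqrt (real n) * (2 * A) + 2 * A + real n * (e / 2) \<le> real n * e" by (simp add: algebra_simps)
    qed
    finally show "(\<integral>\<^sup>+y. ennreal \<bar>birkhoff \<psi> n y - real n * a\<bar> \<partial>P n x) \<le> ennreal (real n * e)" .
  qed
qed

lemma continuous_on_\<phi>: "continuous_on regular \<phi>"
  unfolding \<phi>_def
  by (intro continuous_intros continuous_on_boundary_deriv) (use boundary_deriv_polar(2) in fastforce)

text \<open>
  At regular points the value lies between 0 and \<phi>, and it is \<phi> where \<delta> \<ge> 2 \<epsilon>. The gap between \<epsilon> and
  2 \<epsilon> makes the function continuous on the whole circle.
\<close>

definition cutoff :: "real \<Rightarrow> complex \<Rightarrow> real" where
  "cutoff \<epsilon> y = (if \<delta> y \<le> \<epsilon> then 0 else \<phi> y * min 1 (\<delta> y / \<epsilon> - 1))"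

lemma continuous_on_cutoff:
  assumes \<epsilon>: "\<epsilon> > 0"
  shows "continuous_on (sphere 0 1) (cutoff \<epsilon>)"
  unfolding cutoff_def
proof (rule continuous_on_cases_le)
  have "{y \<in> sphere 0 1. \<epsilon> \<le> \<delta> y} \<subseteq> regular" using \<epsilon> by (auto simp: regular_iff)
  then show "continuous_on {y \<in> sphere 0 1. \<epsilon> \<le> \<delta> y} (\<lambda>y. \<phi> y * min 1 (\<delta> y / \<epsilon> - 1))"
    using \<epsilon> by (intro continuous_intros continuous_\<delta> continuous_on_subset[OF continuous_on_\<phi>]) auto
qed (use \<epsilon> in \<open>auto intro!: continuous_\<delta>\<close>)

lemma cutoff_bounds:
  assumes "\<epsilon> > 0" "y \<in> regular"
  shows "0 \<le> cutoff \<epsilon> y" "cutoff \<epsilon> y \<le> \<phi> y" "\<phi> y - cutoff \<epsilon> y \<le> \<phi> y * indicator {y. \<delta> y < 2 * \<epsilon>} y"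
proof -
  have p: "\<phi> y \<ge> 0" by (rule \<phi>_nonneg[OF assms(2)])
  have d: "\<delta> y / \<epsilon> - 1 \<ge> 0" if "\<not> \<delta> y \<le> \<epsilon>" using that assms(1) by (simp add: le_divide_eq)
  show "0 \<le> cutoff \<epsilon> y" using p d by (auto simp: cutoff_def)
  show "cutoff \<epsilon> y \<le> \<phi> y" using p d by (auto simp: cutoff_def intro!: mult_left_le)
  show "\<phi> y - cutoff \<epsilon> y \<le> \<phi> y * indicator {y. \<delta> y < 2 * \<epsilon>} y"
  proof (cases "\<delta> y < 2 * \<epsilon>")
    case True
    then show ?thesis using \<open>0 \<le> cutoff \<epsilon> y\<close> by simp
  next
    case False
    then have "\<delta> y / \<epsilon> - 1 \<ge> 1" "\<not> \<delta> y \<le> \<epsilon>" using assms(1) by (auto simp: le_divide_eq)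
    then show ?thesis using False by (simp add: cutoff_def)
  qed
qed

text \<open>
  The cut-off function obeys the law of large numbers, and \<open>transfer_tail\<close> bounds the
  expectation of what the cut-off removes, at each step of the walk.
\<close>

lemma law_of_large_numbers:
  assumes e: "e > 0"
  obtains n0 where "\<And>n x. n \<ge> n0 \<Longrightarrow> norm x = 1 \<Longrightarrow>
     (\<integral>\<^sup>+y. ennreal \<bar>birkhoff \<phi> n y - real n * entropy\<bar> \<partial>P n x) \<le> ennreal (real n * e)"
proof -
  obtain \<epsilon>1 where \<epsilon>1: "\<epsilon>1 > 0"
    "\<And>x. norm x = 1 \<Longrightarrow> (\<integral>\<^sup>+y. ennreal (\<phi> y) * indicator {y. \<delta> y < \<epsilon>1} y \<partial>K x) \<le> ennreal (e / 3)"
    using transfer_tail[of "e/3"] e by auto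
  obtain \<epsilon>2 where \<epsilon>2: "\<epsilon>2 > 0"
    "(\<integral>\<^sup>+\<eta>. ennreal (\<phi> \<eta> + 0) * indicator {\<eta>. \<delta> \<eta> < \<epsilon>2} \<eta> \<partial>circle_measure) \<le> ennreal (e / 3)"
    using entropy_near_singular_set[of 0 "e/3"] e by auto
  define \<epsilon> where "\<epsilon> = min \<epsilon>1 \<epsilon>2 / 2"
  have \<epsilon>: "\<epsilon> > 0" "2 * \<epsilon> \<le> \<epsilon>1" "2 * \<epsilon> \<le> \<epsilon>2" using \<epsilon>1(1) \<epsilon>2(1) by (auto simp: \<epsilon>_def)
  define \<tau> where "\<tau> = (\<lambda>y. \<phi> y * indicator {y. \<delta> y < 2 * \<epsilon>} y)"
  define a where "a = (LINT \<eta>:sphere 0 1|circle_measure. cutoff \<epsilon> \<eta>)"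
  obtain n0 where n0: "\<And>n x. n \<ge> n0 \<Longrightarrow> norm x = 1 \<Longrightarrow>
     (\<integral>\<^sup>+y. ennreal \<bar>birkhoff (cutoff \<epsilon>) n y - real n * a\<bar> \<partial>P n x) \<le> ennreal (real n * (e / 3))"
    using LLN_continuous[OF continuous_on_cutoff[OF \<epsilon>(1)], of "e/3"] e unfolding a_def by auto
  have mean: "\<bar>entropy - a\<bar> \<le> e / 3"
  proof -
    have ic: "integrable circle_measure (\<lambda>\<eta>. indicator (sphere 0 1) \<eta> * cutoff \<epsilon> \<eta>)"
      using set_integral_circle_continuous(1)[OF continuous_on_cutoff[OF \<epsilon>(1)]] by (simp add: set_integrable_def)
    have id: "integrable circle_measure (\<lambda>\<eta>. \<phi> \<eta> - indicator (sphere 0 1) \<eta> * cutoff \<epsilon> \<eta>)"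
      by (intro Bochner_Integration.integrable_diff integrable_\<phi> ic)
    have nn: "AE \<eta> in circle_measure. 0 \<le> \<phi> \<eta> - indicator (sphere 0 1) \<eta> * cutoff \<epsilon> \<eta>"
      using AE_regular by eventually_elim (use cutoff_bounds \<epsilon>(1) in \<open>auto simp: regular_iff indicator_def\<close>)
    have diff: "entropy - a = (LINT \<eta>|circle_measure. \<phi> \<eta> - indicator (sphere 0 1) \<eta> * cutoff \<epsilon> \<eta>)"
      using ic integrable_\<phi> by (simp add: entropy_def a_def set_lebesgue_integral_def)
    have "ennreal (entropy - a) = (\<integral>\<^sup>+\<eta>. ennreal (\<phi> \<eta> - indicator (sphere 0 1) \<eta> * cutoff \<epsilon> \<eta>) \<partial>circle_measure)"
      unfolding diff by (rule nn_integral_eq_integral[OF id nn, symmetric])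
    also have "\<dots> \<le> (\<integral>\<^sup>+\<eta>. ennreal (\<phi> \<eta> + 0) * indicator {\<eta>. \<delta> \<eta> < \<epsilon>2} \<eta> \<partial>circle_measure)"
      using AE_regular
    proof (intro nn_integral_mono_AE, eventually_elim)
      fix \<eta> assume \<eta>: "\<eta> \<in> regular"
      have "\<phi> \<eta> - indicator (sphere 0 1) \<eta> * cutoff \<epsilon> \<eta> \<le> \<phi> \<eta> * indicator {y. \<delta> y < 2 * \<epsilon>} \<eta>"
        using cutoff_bounds(3)[OF \<epsilon>(1) \<eta>] \<eta> by (simp add: regular_iff)
      moreover have "0 \<le> cutoff \<epsilon> \<eta>" by (rule cutoff_bounds(1)[OF \<epsilon>(1) \<eta>])
      ultimately show "ennreal (\<phi> \<eta> - indicator (sphere 0 1) \<eta> * cutoff \<epsilon> \<eta>) \<le> ennreal (\<phi> \<eta> + 0) * indicator {\<eta>. \<delta> \<eta> < \<epsilon>2} \<eta>"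
        using \<epsilon>(3) by (auto simp: indicator_def ennreal_neg intro!: ennreal_leI split: if_splits)
    qed
    also have "\<dots> \<le> ennreal (e / 3)" by (rule \<epsilon>2(2))
    finally have "entropy - a \<le> e / 3" using e by (subst (asm) ennreal_le_iff) auto
    moreover have "0 \<le> entropy - a" unfolding diff by (rule integral_nonneg_AE[OF nn])
    ultimately show ?thesis by simp
  qed
  show ?thesis
  proof (rule that[of n0])
    fix n and x :: complex assume n: "n \<ge> n0" and x: "norm x = 1"
    have pointwise: "\<bar>birkhoff \<phi> n y - real n * entropy\<bar> \<le> \<bar>birkhoff (cutoff \<epsilon>) n y - real n * a\<bar> + (\<Sum>k<n. \<tau> ((f ^^ k) y)) + real n * (e / 3)"
      if y: "y \<in> set_pmf (P n x)" for y
    proof -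
      have r: "(f ^^ k) y \<in> regular" if "k < n" for k by (rule orbit_regular[OF x y that])
      have "birkhoff (cutoff \<epsilon>) n y \<le> birkhoff \<phi> n y"
        unfolding birkhoff_def using cutoff_bounds(2)[OF \<epsilon>(1) r] by (intro sum_mono) auto
      moreover have "birkhoff \<phi> n y - birkhoff (cutoff \<epsilon>) n y \<le> (\<Sum>k<n. \<tau> ((f ^^ k) y))"
        unfolding birkhoff_def sum_subtractf[symmetric] \<tau>_def using cutoff_bounds(3)[OF \<epsilon>(1) r] by (intro sum_mono) auto
      moreover have "\<bar>real n * a - real n * entropy\<bar> \<le> real n * (e / 3)"
      proof -
        have "\<bar>real n * a - real n * entropy\<bar> = real n * \<bar>entropy - a\<bar>"
          by (simp add: abs_minus_commute abs_mult flip: right_diff_distrib)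
        also have "\<dots> \<le> real n * (e / 3)" by (intro mult_left_mono mean) simp
        finally show ?thesis .
      qed
      ultimately show ?thesis by linarith
    qed
    have \<tau>0: "\<tau> ((f ^^ k) y) \<ge> 0" if "y \<in> set_pmf (P n x)" "k < n" for y k
      using \<phi>_nonneg[OF orbit_regular[OF x that]] by (simp add: \<tau>_def indicator_def)
    have "(\<integral>\<^sup>+y. ennreal \<bar>birkhoff \<phi> n y - real n * entropy\<bar> \<partial>P n x)
       \<le> (\<integral>\<^sup>+y. ennreal \<bar>birkhoff (cutoff \<epsilon>) n y - real n * a\<bar> + (\<Sum>k<n. ennreal (\<tau> ((f ^^ k) y))) + ennreal (real n * (e / 3)) \<partial>P n x)"
    proof (rule nn_integral_mono_AE, subst AE_measure_pmf_iff, rule ballI)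
      fix y assume y: "y \<in> set_pmf (P n x)"
      have s: "(\<Sum>k<n. ennreal (\<tau> ((f ^^ k) y))) = ennreal (\<Sum>k<n. \<tau> ((f ^^ k) y))" using \<tau>0[OF y] by (subst sum_ennreal) auto
      have "0 \<le> (\<Sum>k<n. \<tau> ((f ^^ k) y))" using \<tau>0[OF y] by (intro sum_nonneg) auto
      then have "ennreal \<bar>birkhoff (cutoff \<epsilon>) n y - real n * a\<bar> + (\<Sum>k<n. ennreal (\<tau> ((f ^^ k) y))) + ennreal (real n * (e / 3))
         = ennreal (\<bar>birkhoff (cutoff \<epsilon>) n y - real n * a\<bar> + (\<Sum>k<n. \<tau> ((f ^^ k) y)) + real n * (e / 3))"
        unfolding s using e by simp
      then show "ennreal \<bar>birkhoff \<phi> n y - real n * entropy\<bar>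
        \<le> ennreal \<bar>birkhoff (cutoff \<epsilon>) n y - real n * a\<bar> + (\<Sum>k<n. ennreal (\<tau> ((f ^^ k) y))) + ennreal (real n * (e / 3))"
        using ennreal_leI[OF pointwise[OF y]] by (simp only:)
    qed
    also have "\<dots> = (\<integral>\<^sup>+y. ennreal \<bar>birkhoff (cutoff \<epsilon>) n y - real n * a\<bar> \<partial>P n x)
        + (\<integral>\<^sup>+y. (\<Sum>k<n. ennreal (\<tau> ((f ^^ k) y))) \<partial>P n x) + ennreal (real n * (e / 3))"
      by (simp add: nn_integral_add)
    also have "\<dots> \<le> ennreal (real n * (e / 3)) + of_nat n * ennreal (e / 3) + ennreal (real n * (e / 3))"
    proof (intro add_mono n0 n x order_refl)
      have "\<forall>x\<in>sphere 0 1. (\<integral>\<^sup>+y. ennreal (\<tau> y) \<partial>K x) \<le> ennreal (e / 3)"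
      proof
        fix u :: complex assume u: "u \<in> sphere 0 1"
        have "(\<integral>\<^sup>+y. ennreal (\<tau> y) \<partial>K u) \<le> (\<integral>\<^sup>+y. ennreal (\<phi> y) * indicator {y. \<delta> y < \<epsilon>1} y \<partial>K u)"
          using \<epsilon>(2) by (intro nn_integral_mono) (auto simp: \<tau>_def indicator_def)
        also have "\<dots> \<le> ennreal (e / 3)" using u by (intro \<epsilon>1(2)) simp
        finally show "(\<integral>\<^sup>+y. ennreal (\<tau> y) \<partial>K u) \<le> ennreal (e / 3)" .
      qed
      then show "(\<integral>\<^sup>+y. (\<Sum>k<n. ennreal (\<tau> ((f ^^ k) y))) \<partial>P n x) \<le> of_nat n * ennreal (e / 3)"
        by (rule birkhoff_nn_integral_le) (use x in simp)
    qed
    also have "\<dots> = ennreal (real n * (e / 3) + real n * (e / 3) + real n * (e / 3))"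
    proof -
      have "of_nat n * ennreal (e / 3) = ennreal (real n * (e / 3))"
        using e by (simp only: ennreal_of_nat_eq_real_of_nat) (intro ennreal_mult[symmetric]; simp)
      then show ?thesis using e by (simp only:) (subst ennreal_plus[symmetric]; simp del: ennreal_plus)+
    qed
    also have "real n * (e / 3) + real n * (e / 3) + real n * (e / 3) = real n * e" by simp
    finally show "(\<integral>\<^sup>+y. ennreal \<bar>birkhoff \<phi> n y - real n * entropy\<bar> \<partial>P n x) \<le> ennreal (real n * e)" .
  qed
qed

end

section \<open>Counting\<close>

lemma analytic_extension_compose:
  assumes G: "analytic_extension_at H y G" and g: "analytic_extension_at F (G y) g" and Gy: "norm (G y) = 1"
    and maps: "\<And>z. norm z < 1 \<Longrightarrow> norm (H z) < 1"
  shows "analytic_extension_at (\<lambda>z. F (H z)) y (\<lambda>z. g (G z))"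
proof -
  have "g \<circ> G analytic_on {y}"
    by (rule analytic_on_compose) (use G g in \<open>simp_all add: analytic_extension_at_def\<close>)
  moreover have "eventually (\<lambda>w. g (G w) = F (H w)) (at y within ball 0 1)"
  proof -
    obtain r where r: "r > 0" "\<And>w. w \<in> ball (G y) r \<inter> ball 0 1 - {G y} \<Longrightarrow> g w = F w"
      using analytic_extension_atE[OF g] by metis
    have "eventually (\<lambda>w. dist (H w) (G y) < r) (at y within ball 0 1)"
      using tendstoD[OF analytic_extension_tendsto[OF G] r(1)] .
    moreover have "eventually (\<lambda>w. G w = H w) (at y within ball 0 1)"
      using G by (simp add: analytic_extension_at_def)
    moreover have "eventually (\<lambda>w. w \<in> ball 0 1) (at y within ball 0 1)" by (simp add: eventually_at_filter)
    ultimately show ?thesis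
    proof eventually_elim
      case (elim w)
      have "norm (H w) < 1" using maps elim by simp
      then have "H w \<in> ball (G y) r \<inter> ball 0 1 - {G y}" using elim Gy by (auto simp: dist_commute)
      then show ?case using r(2) elim by simp
    qed
  qed
  ultimately show ?thesis by (simp add: analytic_extension_at_def o_def)
qed

context finite_entropy_one_component
begin

definition branches :: "nat \<Rightarrow> complex \<Rightarrow> complex set" where
  "branches n x = {y. norm y = 1 \<and> (\<forall>k<n. (f ^^ k) y \<in> regular) \<and> (f ^^ n) y = x}"

text \<open>
  Chain rule along the orbit: the iterate on the disc extends analytically to y by composing the local
  extensions at the successive points.
\<close>

lemma iterate_extension:
  assumes "norm y = 1" "\<forall>k<n. (f ^^ k) y \<in> regular"
  shows "\<exists>G. analytic_extension_at (F ^^ n) y G \<and> G y = (f ^^ n) y \<and> norm (G y) = 1 \<and> norm (deriv G y) = exp (birkhoff \<phi> n y)"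
  using assms(2)
proof (induction n)
  case 0
  show ?case
    by (rule exI[of _ "\<lambda>z. z"]) (use assms(1) in \<open>simp add: analytic_extension_at_def birkhoff_def\<close>)
next
  case (Suc n)
  then obtain G where G: "analytic_extension_at (F ^^ n) y G" "G y = (f ^^ n) y" "norm (G y) = 1" "norm (deriv G y) = exp (birkhoff \<phi> n y)"
    by auto
  have reg: "G y \<in> regular" using Suc.prems G(2) by simp
  obtain g where g: "analytic_extension_at F (G y) g" "f (G y) = g (G y)" "f' (G y) = deriv g (G y)"
    using regularE[OF reg] G(3) by (metis centre_in_ball)
  have "analytic_extension_at (\<lambda>z. F ((F ^^ n) z)) y (\<lambda>z. g (G z))"
    by (rule analytic_extension_compose[OF G(1) g(1) G(3)]) (rule iterates_in_disc)
  then have ext: "analytic_extension_at (F ^^ Suc n) y (\<lambda>z. g (G z))" by (simp add: o_def)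
  have "deriv (g \<circ> G) y = deriv g (G y) * deriv G y"
    using G(1) g(1) unfolding analytic_extension_at_def
    by (intro deriv_chain) (auto intro: analytic_on_imp_differentiable_at)
  then have "norm (deriv (\<lambda>z. g (G z)) y) = norm (f' (G y)) * exp (birkhoff \<phi> n y)"
    using G(4) g(3) by (simp add: o_def norm_mult)
  also have "norm (f' (G y)) = exp (\<phi> (G y))"
    using boundary_deriv_polar(2)[OF reg] unfolding \<phi>_def by (subst exp_ln) linarith+
  finally have "norm (deriv (\<lambda>z. g (G z)) y) = exp (birkhoff \<phi> (Suc n) y)"
    using G(2) by (simp add: birkhoff_def exp_add)
  moreover have "norm (g (G y)) = 1" using regular_norm(2)[OF reg] g(2) by simp
  moreover have "g (G y) = (f ^^ Suc n) y" using g(2) G(2) by simp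
  ultimately show ?case using ext by blast
qed

lemma ln_iterate_deriv:
  assumes "y \<in> branches n x"
  shows "ln (norm (boundary_deriv (F ^^ n) y)) = birkhoff \<phi> n y"
proof -
  have y: "norm y = 1" using assms by (simp add: branches_def)
  obtain G where "analytic_extension_at (F ^^ n) y G" "norm (deriv G y) = exp (birkhoff \<phi> n y)"
    using iterate_extension[of y n] assms by (auto simp: branches_def)
  then show ?thesis using boundary_deriv_eq[OF _ y] by simp
qed

lemma branches_iff:
  assumes "norm y = 1"
  shows "y \<in> branches n x \<longleftrightarrow> (\<forall>k<n. (f ^^ k) y \<notin> singular_set F) \<and> (f ^^ n) y = x"
proof -
  have "(f ^^ k) y \<in> regular" if ns: "\<forall>k<n. (f ^^ k) y \<notin> singular_set F" and k: "k < n" for k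
  proof -
    have "norm ((f ^^ j) y) = 1" if "j \<le> n" for j
      using that
    proof (induction j)
      case (Suc j)
      then have "(f ^^ j) y \<in> regular" using ns by (simp add: regular_def)
      then show ?case using regular_norm(2) by simp
    qed (use assms in simp)
    then show ?thesis using ns k by (simp add: regular_def)
  qed
  then show ?thesis using assms by (auto simp: branches_def regular_def)
qed

text \<open>
  Only the step through the point f^n y can lead to y, so the probabilities multiply along the orbit.
\<close>

lemma pmf_P:
  assumes "norm x = 1"
  shows "pmf (P n x) y = (if y \<in> branches n x then exp (- birkhoff \<phi> n y) else 0)"
  using assms
proof (induction n arbitrary: x)
  case 0
  then show ?case by (auto simp: branches_def birkhoff_def indicator_def)
next
  case (Suc n)
  have IH: "pmf (P n u) y = (if y \<in> branches n u then exp (- birkhoff \<phi> n y) else 0)" if "u \<in> set_pmf (K x)" for u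
    using Suc.IH[of u] K_in[of x u] Suc.prems that by simp
  have "pmf (P (Suc n) x) y = (LINT u|K x. pmf (P n u) y)" by (simp add: pmf_bind)
  also have "\<dots> = (\<Sum>u\<in>{(f ^^ n) y}. pmf (K x) u *\<^sub>R pmf (P n u) y)"
    by (rule integral_measure_pmf) (use IH in \<open>auto simp: branches_def split: if_splits\<close>)
  finally have eq: "pmf (P (Suc n) x) y = pmf (K x) ((f ^^ n) y) * pmf (P n ((f ^^ n) y)) y" by simp
  show ?case
  proof (cases "(f ^^ n) y \<in> fibre x")
    case True
    then have r: "(f ^^ n) y \<in> regular" "f ((f ^^ n) y) = x" by (auto simp: fibre_def)
    have "y \<in> branches (Suc n) x \<longleftrightarrow> y \<in> branches n ((f ^^ n) y)"
      using r by (auto simp: branches_def less_Suc_eq)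
    moreover have "1 / norm (f' ((f ^^ n) y)) = exp (- \<phi> ((f ^^ n) y))"
    proof -
      have "0 < norm (f' ((f ^^ n) y))" using boundary_deriv_polar(2)[OF r(1)] by linarith
      then show ?thesis by (simp add: \<phi>_def exp_minus inverse_eq_divide)
    qed
    moreover have "(f ^^ n) y \<in> set_pmf (K x)" using True Suc.prems by (simp add: set_pmf_K)
    ultimately show ?thesis unfolding eq pmf_K[OF Suc.prems]
      using True IH by (simp add: birkhoff_def exp_add[symmetric] exp_diff[symmetric])
  next
    case False
    then have "y \<notin> branches (Suc n) x" by (auto simp: branches_def fibre_def)
    then show ?thesis unfolding eq pmf_K[OF Suc.prems] using False by simp
  qed
qed

lemma birkhoff_ge:
  assumes l: "\<forall>y\<in>regular. l \<le> \<phi> y" and y: "y \<in> branches n x"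
  shows "real n * l \<le> birkhoff \<phi> n y"
proof -
  have "(\<Sum>k<n. l) \<le> birkhoff \<phi> n y"
    unfolding birkhoff_def using y l by (intro sum_mono) (auto simp: branches_def)
  then show ?thesis by simp
qed

lemma birkhoff_\<phi>_nonneg: "y \<in> branches n x \<Longrightarrow> 0 \<le> birkhoff \<phi> n y"
  using birkhoff_ge[of 0 y n x] \<phi>_nonneg by simp

lemma set_pmf_P: "norm x = 1 \<Longrightarrow> set_pmf (P n x) = branches n x"
  by (auto simp: set_pmf_eq pmf_P)

text \<open>
  The contribution of one preimage with log-derivative S to the integrated count.
\<close>

lemma exponential_window_integral:
  assumes S: "0 \<le> S" and T: "0 \<le> T"
  shows "(\<integral>\<^sup>+t. ennreal (exp (- t)) * indicator {0..T} t * indicator {S<..} t \<partial>lborel)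
     = ennreal (exp (- S)) * ennreal (max 0 (1 - exp (S - T)))"
proof (cases "S \<le> T")
  case True
  have "AE t in lborel. t \<noteq> S" by (rule AE_lborel_singleton)
  then have "(\<integral>\<^sup>+t. ennreal (exp (- t)) * indicator {0..T} t * indicator {S<..} t \<partial>lborel)
     = (\<integral>\<^sup>+t. ennreal (exp (- t)) * indicator {S..T} t \<partial>lborel)"
    using S by (intro nn_integral_cong_AE) (auto simp: indicator_def elim!: eventually_mono)
  also have "\<dots> = ennreal (- exp (- T) - (- exp (- S)))"
    by (rule nn_integral_FTC_Icc) (use True in \<open>auto intro!: derivative_eq_intros\<close>)
  also have "- exp (- T) - (- exp (- S)) = exp (- S) * (1 - exp (S - T))"
    by (simp add: right_diff_distrib exp_add[symmetric])
  also have "ennreal \<dots> = ennreal (exp (- S)) * ennreal (max 0 (1 - exp (S - T)))"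
    using True by (subst ennreal_mult) (auto simp: max_def)
  finally show ?thesis .
next
  case False
  have "(\<integral>\<^sup>+t. ennreal (exp (- t)) * indicator {0..T} t * indicator {S<..} t \<partial>lborel) = (\<integral>\<^sup>+t. 0 \<partial>(lborel :: real measure))"
    using False by (intro nn_integral_cong) (auto simp: indicator_def)
  then show ?thesis using False by (simp add: max_def)
qed

lemma counting_integral:
  assumes x: "norm x = 1" and B: "B \<subseteq> sphere 0 1" and T: "T \<ge> 0"
  shows "(\<integral>\<^sup>+t\<in>{0..T}. preimage_count F x t B / ennreal (exp t) \<partial>lborel)
    = (\<Sum>n. \<integral>\<^sup>+y. ennreal (indicator B y * max 0 (1 - exp (birkhoff \<phi> n y - T))) \<partial>P n x)"
proof -
  define A where "A = {(n, y). y \<in> B \<and> y \<in> branches n x}"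
  define S where "S = (\<lambda>p. birkhoff \<phi> (fst p) (snd p))"
  have S0: "S p \<ge> 0" if "p \<in> A" for p using that birkhoff_\<phi>_nonneg by (auto simp: A_def S_def)
  have cA: "countable A"
  proof (rule countable_subset)
    show "A \<subseteq> (SIGMA n:UNIV. set_pmf (P n x))" using x by (auto simp: A_def set_pmf_P)
  qed (auto simp: countable_set_pmf)
  have count: "preimage_count F x t B = (\<integral>\<^sup>+p. indicator {S p<..} t \<partial>count_space A)" for t
  proof -
    have "{(n, y). y \<in> B \<and> (\<forall>k<n. (f ^^ k) y \<notin> singular_set F) \<and> (f ^^ n) y = x \<and> ln (norm (boundary_deriv (F ^^ n) y)) < t}
       = {p \<in> A. S p < t}"
      using B branches_iff ln_iterate_deriv by (auto simp: A_def S_def subset_iff)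
    then have "preimage_count F x t B = emeasure (count_space UNIV) {p \<in> A. S p < t}" by (simp add: preimage_count_def)
    also have "\<dots> = emeasure (count_space A) {p \<in> A. S p < t}" by (simp add: emeasure_count_space)
    also have "\<dots> = (\<integral>\<^sup>+p. indicator {p \<in> A. S p < t} p \<partial>count_space A)" by simp
    also have "\<dots> = (\<integral>\<^sup>+p. indicator {S p<..} t \<partial>count_space A)"
      by (rule nn_integral_cong) (auto simp: indicator_def)
    finally show ?thesis .
  qed
  have "(\<integral>\<^sup>+t\<in>{0..T}. preimage_count F x t B / ennreal (exp t) \<partial>lborel)
     = (\<integral>\<^sup>+t. (\<integral>\<^sup>+p. ennreal (exp (- t)) * indicator {0..T} t * indicator {S p<..} t \<partial>count_space A) \<partial>lborel)"
  proof (rule nn_integral_cong)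
    fix t :: real
    have "preimage_count F x t B / ennreal (exp t) * indicator {0..T} t
       = (ennreal (exp (- t)) * indicator {0..T} t) * (\<integral>\<^sup>+p. indicator {S p<..} t \<partial>count_space A)"
      unfolding count by (simp add: divide_ennreal_def inverse_ennreal exp_minus mult_ac)
    then show "preimage_count F x t B / ennreal (exp t) * indicator {0..T} t
       = (\<integral>\<^sup>+p. ennreal (exp (- t)) * indicator {0..T} t * indicator {S p<..} t \<partial>count_space A)"
      by (simp add: nn_integral_cmult)
  qed
  also have "\<dots> = (\<integral>\<^sup>+p. (\<integral>\<^sup>+t. ennreal (exp (- t)) * indicator {0..T} t * indicator {S p<..} t \<partial>lborel) \<partial>count_space A)"
    by (rule nn_integral_count_space_nn_integral[OF cA]) measurable
  also have "\<dots> = (\<integral>\<^sup>+p. ennreal (exp (- S p)) * ennreal (max 0 (1 - exp (S p - T))) \<partial>count_space A)"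
    using S0 T by (intro nn_integral_cong) (simp add: exponential_window_integral)
  also have "\<dots> = (\<integral>\<^sup>+p. ennreal (exp (- S p)) * ennreal (max 0 (1 - exp (S p - T))) * indicator A p \<partial>count_space UNIV)"
    by (rule nn_integral_count_space_indicator) simp
  also have "\<dots> = (\<integral>\<^sup>+n. (\<integral>\<^sup>+y. ennreal (exp (- S (n, y))) * ennreal (max 0 (1 - exp (S (n, y) - T))) * indicator A (n, y) \<partial>count_space UNIV) \<partial>count_space UNIV)"
    by (rule nn_integral_fst_count_space[symmetric])
  also have "\<dots> = (\<Sum>n. \<integral>\<^sup>+y. ennreal (exp (- S (n, y))) * ennreal (max 0 (1 - exp (S (n, y) - T))) * indicator A (n, y) \<partial>count_space UNIV)"
    by (rule nn_integral_count_space_nat)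
  also have "\<dots> = (\<Sum>n. \<integral>\<^sup>+y. ennreal (indicator B y * max 0 (1 - exp (birkhoff \<phi> n y - T))) \<partial>P n x)"
    unfolding nn_integral_measure_pmf
    by (intro suminf_cong nn_integral_cong) (auto simp: pmf_P[OF x] A_def S_def indicator_def)
  finally show ?thesis .
qed

text \<open>
  Markov's inequality for the law of large numbers.
\<close>

lemma deviation_probability:
  assumes x: "norm x = 1" and e: "e > 0"
  shows "(\<lambda>n. measure (measure_pmf (P n x)) {y. real n * e \<le> \<bar>birkhoff \<phi> n y - real n * entropy\<bar>}) \<longlonglongrightarrow> 0"
proof (rule tendstoI)
  fix r :: real assume r: "r > 0"
  obtain n0 where n0: "\<And>n x. n \<ge> n0 \<Longrightarrow> norm x = 1 \<Longrightarrow>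
     (\<integral>\<^sup>+y. ennreal \<bar>birkhoff \<phi> n y - real n * entropy\<bar> \<partial>P n x) \<le> ennreal (real n * (e * r / 2))"
    using law_of_large_numbers[of "e * r / 2"] e r by auto
  show "eventually (\<lambda>n. dist (measure (measure_pmf (P n x)) {y. real n * e \<le> \<bar>birkhoff \<phi> n y - real n * entropy\<bar>}) 0 < r) sequentially"
    using eventually_ge_at_top[of "max n0 1"]
  proof eventually_elim
    case (elim n)
    define D where "D = {y. real n * e \<le> \<bar>birkhoff \<phi> n y - real n * entropy\<bar>}"
    have "ennreal (real n * e) * emeasure (measure_pmf (P n x)) D = (\<integral>\<^sup>+y. ennreal (real n * e) * indicator D y \<partial>P n x)"
      by (simp add: nn_integral_cmult_indicator)
    also have "\<dots> \<le> (\<integral>\<^sup>+y. ennreal \<bar>birkhoff \<phi> n y - real n * entropy\<bar> \<partial>P n x)"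
      by (intro nn_integral_mono) (auto simp: D_def indicator_def intro: ennreal_leI)
    also have "\<dots> \<le> ennreal (real n * (e * r / 2))" using elim x by (intro n0) auto
    finally have "ennreal (real n * e * measure (measure_pmf (P n x)) D) \<le> ennreal (real n * (e * r / 2))"
      using e by (simp add: measure_pmf.emeasure_eq_measure ennreal_mult)
    then have "real n * e * measure (measure_pmf (P n x)) D \<le> real n * e * (r / 2)"
      using e r by (subst (asm) ennreal_le_iff) (auto simp: mult.assoc)
    moreover have "0 < real n * e" using elim e by simp
    ultimately have "measure (measure_pmf (P n x)) D \<le> r / 2" by (rule mult_left_le_imp_le)
    then show ?case using r by (simp add: D_def)
  qed
qed

text \<open>
  The indicator of the closure is the limit of continuous functions from above.
\<close>

lemma visits_upper:
  assumes x: "norm x = 1" and A: "A \<subseteq> sphere 0 1" and e: "e > 0"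
  shows "eventually (\<lambda>n. measure (measure_pmf (P n x)) A \<le> measure circle_measure (closure A) + e) sequentially"
proof (cases "A = {}")
  case False
  have clS: "closure A \<subseteq> sphere 0 1" using A by (intro closure_minimal) auto
  define g where "g = (\<lambda>k::nat. \<lambda>\<zeta>. max 0 (1 - real k * infdist \<zeta> (closure A)))"
  have g01: "0 \<le> g k \<zeta>" "g k \<zeta> \<le> 1" for k \<zeta> by (auto simp: g_def infdist_nonneg)
  have gc: "continuous_on S (g k)" for S k unfolding g_def by (intro continuous_intros)
  have gm [measurable]: "g k \<in> borel_measurable borel" for k by (intro borel_measurable_continuous_onI gc)
  have lim: "(\<lambda>k. g k \<zeta>) \<longlonglongrightarrow> indicator (closure A) \<zeta>" for \<zeta>
  proof (cases "\<zeta> \<in> closure A")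
    case True
    then show ?thesis by (simp add: g_def)
  next
    case out: False
    have "infdist \<zeta> (closure A) > 0"
      using out False in_closed_iff_infdist_zero[of "closure A" \<zeta>] infdist_nonneg[of \<zeta> "closure A"] by force
    then obtain k0 :: nat where k0: "1 < real k0 * infdist \<zeta> (closure A)" using reals_Archimedean3 by blast
    have "g k \<zeta> = 0" if "k \<ge> k0" for k
    proof -
      have "real k0 * infdist \<zeta> (closure A) \<le> real k * infdist \<zeta> (closure A)"
        using that by (intro mult_right_mono infdist_nonneg) auto
      then show ?thesis using k0 by (simp add: g_def)
    qed
    then show ?thesis using out by (intro tendsto_eventually) (auto simp: eventually_sequentially)
  qed
  have "(\<lambda>k. LINT \<zeta>|circle_measure. indicator (sphere 0 1) \<zeta> *\<^sub>R g k \<zeta>) \<longlonglongrightarrow> (LINT \<zeta>|circle_measure. indicator (closure A) \<zeta>)"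
  proof (rule integral_dominated_convergence[where w = "\<lambda>_. 1"])
    show "AE \<zeta> in circle_measure. (\<lambda>k. indicator (sphere 0 1) \<zeta> *\<^sub>R g k \<zeta>) \<longlonglongrightarrow> indicator (closure A) \<zeta>"
      using AE_circle_in_sphere by eventually_elim (use lim in simp)
    show "(indicator (closure A) :: complex \<Rightarrow> real) \<in> borel_measurable circle_measure"
      by (intro borel_measurable_indicator) simp
    show "AE \<zeta> in circle_measure. norm (indicator (sphere 0 1) \<zeta> *\<^sub>R g k \<zeta>) \<le> 1" for k
      using g01 by (intro AE_I2) (auto simp: indicator_def)
  qed auto
  then have "(\<lambda>k. LINT \<zeta>:sphere 0 1|circle_measure. g k \<zeta>) \<longlonglongrightarrow> measure circle_measure (closure A)"
    by (simp add: set_lebesgue_integral_def)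
  then have "eventually (\<lambda>k. (LINT \<zeta>:sphere 0 1|circle_measure. g k \<zeta>) < measure circle_measure (closure A) + e / 2) sequentially"
    using e by (intro order_tendstoD) auto
  then obtain k where k: "(LINT \<zeta>:sphere 0 1|circle_measure. g k \<zeta>) < measure circle_measure (closure A) + e / 2"
    by (auto simp: eventually_sequentially)
  obtain n0 where n0: "\<And>n x. n \<ge> n0 \<Longrightarrow> norm x = 1 \<Longrightarrow>
    (\<integral>\<^sup>+y. ennreal (g k y) \<partial>P n x) \<le> ennreal ((LINT \<eta>:sphere 0 1|circle_measure. g k \<eta>) + e / 2)"
    using equidistribution_upper[OF gc, of k "e/2"] g01 e by (metis half_gt_zero)
  show ?thesis using eventually_ge_at_top[of n0]
  proof eventually_elim
    case (elim n)
    have "ennreal (measure (measure_pmf (P n x)) A) = (\<integral>\<^sup>+y. indicator A y \<partial>P n x)"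
      by (simp add: measure_pmf.emeasure_eq_measure)
    also have "\<dots> \<le> (\<integral>\<^sup>+y. ennreal (g k y) \<partial>P n x)"
      using closure_subset[of A] by (intro nn_integral_mono) (auto simp: indicator_def g_def)
    also have "\<dots> \<le> ennreal ((LINT \<eta>:sphere 0 1|circle_measure. g k \<eta>) + e / 2)" by (rule n0[OF elim x])
    also have "\<dots> \<le> ennreal (measure circle_measure (closure A) + e)" using k by (intro ennreal_leI) simp
    finally show ?case using e by (subst (asm) ennreal_le_iff) (auto intro: add_nonneg_nonneg)
  qed
qed (use e in simp)

text \<open>
  The upper bound is applied to B and to its complement in the circle; their closures have the measures of
  B and of the complement, because they exceed these sets only by boundary points.
\<close>

lemma visits_tendsto:
  assumes x: "norm x = 1" and B: "B \<in> sets borel" "B \<subseteq> sphere 0 1"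
    and bd: "measure circle_measure (top_of_set (sphere 0 1) frontier_of B) = 0"
  shows "(\<lambda>n. measure (measure_pmf (P n x)) B) \<longlonglongrightarrow> measure circle_measure B"
proof -
  define B' where "B' = sphere 0 1 - B"
  have cl: "closure B \<subseteq> sphere 0 1" "closure B' \<subseteq> sphere 0 1"
    using B by (intro closure_minimal; simp add: B'_def)+
  have fr: "top_of_set (sphere 0 1) frontier_of B = closure B \<inter> closure B'"
  proof -
    have "sphere 0 1 \<inter> B = B" "sphere 0 1 \<inter> B' = B'" using B by (auto simp: B'_def)
    then show ?thesis
      unfolding frontier_of_closures using cl by (auto simp: closure_of_subtopology B'_def[symmetric])
  qed
  have cm [measurable]: "closure B \<in> sets borel" "closure B' \<in> sets borel" "B' \<in> sets borel"
    using B by (auto simp: B'_def)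
  have null: "measure circle_measure (closure B \<inter> closure B') = 0" using bd by (simp add: fr)
  have up: "measure circle_measure (closure C) \<le> measure circle_measure C"
    if "C \<in> sets borel" "closure C \<subseteq> C \<union> (closure B \<inter> closure B')" for C
  proof -
    have "measure circle_measure (closure C) \<le> measure circle_measure (C \<union> (closure B \<inter> closure B'))"
      using that cm by (intro circle.finite_measure_mono) auto
    also have "\<dots> \<le> measure circle_measure C + measure circle_measure (closure B \<inter> closure B')"
      using that cm by (intro measure_subadditive) (auto simp: circle.emeasure_eq_measure)
    finally show ?thesis using null by simp
  qed
  have upB: "measure circle_measure (closure B) \<le> measure circle_measure B"
    by (rule up[OF B(1)]) (use cl closure_subset[of B'] in \<open>auto simp: B'_def\<close>)
  have upB': "measure circle_measure (closure B') \<le> measure circle_measure B'"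
    by (rule up) (use cl closure_subset[of B] cm in \<open>auto simp: B'_def\<close>)
  have mB': "measure circle_measure B' = 1 - measure circle_measure B"
  proof -
    have "measure circle_measure (sphere 0 1) = 1"
      using AE_circle_in_sphere by (subst circle.prob_eq_1) auto
    then show ?thesis unfolding B'_def using B by (subst circle.finite_measure_Diff) auto
  qed
  have pB': "measure (measure_pmf (P n x)) B' = 1 - measure (measure_pmf (P n x)) B" for n
  proof -
    have "set_pmf (P n x) \<subseteq> sphere 0 1" using x by (auto simp: set_pmf_P branches_def)
    then have "measure (measure_pmf (P n x)) (sphere 0 1) = 1"
      by (subst measure_pmf.prob_eq_1) (auto simp: AE_measure_pmf_iff)
    then show ?thesis unfolding B'_def using B by (subst measure_pmf.finite_measure_Diff) auto
  qed
  show ?thesis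
  proof (rule tendstoI)
    fix e :: real assume e: "e > 0"
    have "B' \<subseteq> sphere 0 1" by (simp add: B'_def)
    from visits_upper[OF x B(2), of "e/2"] visits_upper[OF x this, of "e/2"] e
    have "eventually (\<lambda>n. measure (measure_pmf (P n x)) B \<le> measure circle_measure (closure B) + e/2) sequentially"
      "eventually (\<lambda>n. measure (measure_pmf (P n x)) B' \<le> measure circle_measure (closure B') + e/2) sequentially" by auto
    then show "eventually (\<lambda>n. dist (measure (measure_pmf (P n x)) B) (measure circle_measure B) < e) sequentially"
    proof eventually_elim
      case (elim n)
      then show ?case using upB upB' mB' pB'[of n] e unfolding dist_real_def by linarith
    qed
  qed
qed

lemma entropy_ge:
  assumes "\<forall>y\<in>regular. l \<le> \<phi> y"
  shows "l \<le> entropy"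
proof -
  have "(LINT z|circle_measure. l) \<le> entropy"
    unfolding entropy_def
    by (rule integral_mono_AE[OF _ integrable_\<phi>]) (use AE_regular assms in \<open>auto elim!: eventually_mono\<close>)
  moreover have "measure circle_measure UNIV = 1" using circle.prob_space by simp
  ultimately show ?thesis by simp
qed

text \<open>
  Early terms are compared with the probability of B up to a deviation of the Birkhoff sum and an error
  exp (- n e / 2), which comes from the factor 1 - exp (S - T); late terms are bounded by the probability of a deviation.
\<close>

theorem averaged_orbit_counting:
  assumes x: "norm x = 1" and B: "B \<in> sets borel" "B \<subseteq> sphere 0 1"
    and bd: "measure circle_measure (top_of_set (sphere 0 1) frontier_of B) = 0"
  shows "((\<lambda>T::real. (\<integral>\<^sup>+t\<in>{0..T}. preimage_count F x t B / ennreal (exp t) \<partial>lborel) / ennreal T)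
           \<longlongrightarrow> ennreal (1 / entropy * measure circle_measure B)) at_top"
proof -
  obtain l where l: "l > 0" "\<forall>y\<in>regular. l \<le> \<phi> y" using uniform_expansion by blast
  have lX: "l \<le> entropy" by (rule entropy_ge[OF l(2)])
  then have X: "entropy > 0" using l(1) by simp
  define \<beta> where "\<beta> = measure circle_measure B"
  define h where "h = (\<lambda>n T y. indicator B y * max 0 (1 - exp (birkhoff \<phi> n y - T)) :: real)"
  have h01: "0 \<le> h n T y" "h n T y \<le> 1" for n T y by (auto simp: h_def indicator_def)
  define \<alpha> where "\<alpha> = (\<lambda>n T. measure_pmf.expectation (P n x) (h n T))"
  have hint: "integrable (measure_pmf (P n x)) (h n T)" for n T
    using h01 by (intro measure_pmf.integrable_const_bound[where B=1]) auto
  have \<alpha>eq: "(\<integral>\<^sup>+y. ennreal (h n T y) \<partial>P n x) = ennreal (\<alpha> n T)" for n T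
    unfolding \<alpha>_def using hint h01 by (intro nn_integral_eq_integral) auto
  have \<alpha>0: "0 \<le> \<alpha> n T" for n T unfolding \<alpha>_def using h01 by (intro integral_nonneg_AE AE_I2) auto
  have \<alpha>1: "\<alpha> n T \<le> 1" for n T
    unfolding \<alpha>_def using integral_mono[OF hint[of n T], where g = "\<lambda>_. 1"] h01 by simp
  \<comment> \<open>Beyond N T the Birkhoff sum is at least T, by uniform expansion.\<close>
  define N where "N = (\<lambda>T. Suc (nat \<lfloor>T / l\<rfloor>))"
  have N: "T / l < real (N T)" "real (N T) \<le> T / l + 1" if "T \<ge> 0" for T
  proof -
    have "0 \<le> T / l" using that l by simp
    then show "T / l < real (N T)" "real (N T) \<le> T / l + 1" unfolding N_def by linarith+
  qed
  have \<alpha>vanish: "\<alpha> n T = 0" if T: "T \<ge> 0" and n: "n \<ge> N T" for n T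
  proof -
    have "T / l < real n" using N(1)[OF T] n by linarith
    then have "T \<le> real n * l" using l by (simp add: divide_less_eq)
    then have "h n T y = 0" if "y \<in> branches n x" for y
      using birkhoff_ge[OF l(2) that] by (simp add: h_def max_def)
    then have "AE y in P n x. h n T y = 0" by (simp add: AE_measure_pmf_iff set_pmf_P[OF x])
    then show ?thesis unfolding \<alpha>_def by (simp add: integral_eq_zero_AE)
  qed
  have indint: "integrable (measure_pmf (P n x)) (indicator A :: complex \<Rightarrow> real)" for n and A :: "complex set"
    by (intro measure_pmf.integrable_const_bound[where B=1]) auto
  define D where "D = (\<lambda>e n. {y. real n * e \<le> \<bar>birkhoff \<phi> n y - real n * entropy\<bar>})"
  have expD: "measure_pmf.expectation (P n x) (indicator A) = measure (measure_pmf (P n x)) A" for n and A :: "complex set" by simp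
  have "((\<lambda>T. (\<Sum>n<N T. \<alpha> n T) / T) \<longlongrightarrow> \<beta> / entropy) at_top"
  proof (rule renewal_limit[OF \<alpha>0 \<alpha>1 _ _ X l(1) lX N])
    show "0 \<le> \<beta>" "\<beta> \<le> 1" by (auto simp: \<beta>_def)
    fix e :: real assume e: "e > 0"
    define b where "b = (\<lambda>n. measure (measure_pmf (P n x)) B)"
    define d where "d = (\<lambda>n. \<bar>b n - \<beta>\<bar> + measure (measure_pmf (P n x)) (D (e/2) n) + exp (- (real n * (e/2))))"
    have "(\<lambda>n. \<bar>b n - \<beta>\<bar>) \<longlonglongrightarrow> 0"
      using visits_tendsto[OF x B bd] unfolding b_def \<beta>_def
      by (intro tendsto_rabs_zero) (simp add: LIM_zero)
    moreover have "(\<lambda>n. measure (measure_pmf (P n x)) (D (e/2) n)) \<longlonglongrightarrow> 0"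
      unfolding D_def by (rule deviation_probability[OF x]) (use e in simp)
    moreover have "(\<lambda>n. exp (- (real n * (e/2)))) \<longlonglongrightarrow> 0" using e by real_asymp
    ultimately have "d \<longlonglongrightarrow> 0 + 0 + 0" unfolding d_def by (intro tendsto_add)
    then have d0: "d \<longlonglongrightarrow> 0" by simp
    have "\<bar>\<alpha> n T - \<beta>\<bar> \<le> d n" if nT: "real n * (entropy + e) \<le> T" for n T
    proof -
      have "\<alpha> n T \<le> measure_pmf.expectation (P n x) (indicator B)"
        unfolding \<alpha>_def by (rule integral_mono[OF hint indint]) (auto simp: h_def indicator_def)
      then have up: "\<alpha> n T \<le> b n" by (simp add: b_def)
      have "measure_pmf.expectation (P n x) (indicator B)
          \<le> measure_pmf.expectation (P n x) (\<lambda>y. h n T y + indicator (D (e/2) n) y + exp (- (real n * (e/2))))"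
      proof (rule integral_mono)
        fix y
        show "indicator B y \<le> h n T y + indicator (D (e/2) n) y + exp (- (real n * (e/2)))"
        proof (cases "y \<in> D (e/2) n")
          case False
          then have "birkhoff \<phi> n y \<le> real n * entropy + real n * (e/2)"
            unfolding D_def mem_Collect_eq by linarith
          then have "birkhoff \<phi> n y - T \<le> - (real n * (e/2))" using nT by (simp add: algebra_simps)
          then have *: "exp (birkhoff \<phi> n y - T) \<le> exp (- (real n * (e/2)))" by simp
          show ?thesis
          proof (cases "y \<in> B")
            case True
            have "1 - exp (birkhoff \<phi> n y - T) \<le> h n T y" using True by (simp add: h_def)
            moreover have "indicator B y = (1::real)" "indicator (D (e/2) n) y = (0::real)" using True False by simp_all
            ultimately show ?thesis using * by linarith
          qed (use h01[of n T y] in \<open>auto simp: add_nonneg_nonneg\<close>)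
        qed (use h01[of n T y] in \<open>auto simp: indicator_def add_nonneg_nonneg\<close>)
      qed (use hint indint in auto)
      also have "\<dots> = \<alpha> n T + measure (measure_pmf (P n x)) (D (e/2) n) + exp (- (real n * (e/2)))"
        using hint indint by (simp add: \<alpha>_def)
      finally have "b n \<le> \<alpha> n T + measure (measure_pmf (P n x)) (D (e/2) n) + exp (- (real n * (e/2)))" by (simp add: b_def)
      moreover have "0 \<le> measure (measure_pmf (P n x)) (D (e/2) n)" "0 \<le> exp (- (real n * (e/2)))" by simp_all
      ultimately show ?thesis using up unfolding d_def by linarith
    qed
    then show "\<exists>d. d \<longlonglongrightarrow> 0 \<and> (\<forall>n T. real n * (entropy + e) \<le> T \<longrightarrow> \<bar>\<alpha> n T - \<beta>\<bar> \<le> d n)"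
      using d0 by blast
  next
    fix e :: real assume e: "0 < e" "e < entropy"
    have "\<alpha> n T \<le> measure (measure_pmf (P n x)) (D e n)" if nT: "T \<le> real n * (entropy - e)" for n T
    proof -
      have "\<alpha> n T \<le> measure_pmf.expectation (P n x) (indicator (D e n))"
        unfolding \<alpha>_def
      proof (rule integral_mono[OF hint])
        fix y
        show "h n T y \<le> indicator (D e n) y"
        proof (cases "birkhoff \<phi> n y < T")
          case True
          then have "birkhoff \<phi> n y \<le> real n * entropy - real n * e" using nT by (simp add: algebra_simps)
          then have "y \<in> D e n" unfolding D_def by (simp add: abs_if)
          then show ?thesis using h01[of n T y] by simp
        qed (auto simp: h_def max_def)
      qed (rule indint)
      then show ?thesis by simp
    qed
    then show "\<exists>d. d \<longlonglongrightarrow> 0 \<and> (\<forall>n T. T \<le> real n * (entropy - e) \<longrightarrow> \<alpha> n T \<le> d n)"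
      using deviation_probability[OF x e(1)] unfolding D_def by blast
  qed
  then have "((\<lambda>T. ennreal ((\<Sum>n<N T. \<alpha> n T) / T)) \<longlongrightarrow> ennreal (\<beta> / entropy)) at_top"
    by (rule tendsto_ennrealI)
  moreover have "eventually (\<lambda>T. ennreal ((\<Sum>n<N T. \<alpha> n T) / T)
      = (\<integral>\<^sup>+t\<in>{0..T}. preimage_count F x t B / ennreal (exp t) \<partial>lborel) / ennreal T) at_top"
    using eventually_gt_at_top[of 0]
  proof eventually_elim
    case (elim T)
    have "(\<integral>\<^sup>+t\<in>{0..T}. preimage_count F x t B / ennreal (exp t) \<partial>lborel) = (\<Sum>n. ennreal (\<alpha> n T))"
      using counting_integral[OF x B(2), of T] elim \<alpha>eq by (simp add: h_def)
    also have "\<dots> = (\<Sum>n<N T. ennreal (\<alpha> n T))"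
      by (rule suminf_finite) (use \<alpha>vanish elim in auto)
    also have "\<dots> = ennreal (\<Sum>n<N T. \<alpha> n T)" using \<alpha>0 by (intro sum_ennreal) auto
    finally show ?case using elim \<alpha>0 by (simp add: divide_ennreal sum_nonneg)
  qed
  ultimately show ?thesis unfolding \<beta>_def by (simp add: Lim_transform_eventually)
qed

end

theorem theorem1p4:
  fixes F :: "complex \<Rightarrow> complex" and x :: complex and B :: "complex set"
  assumes "one_component_inner_function F"
    and "F 0 = 0"
    and "\<not> is_rotation F"
    and "integrable circle_measure (\<lambda>z. ln (norm (boundary_deriv F z)))"
    and "x \<in> sphere 0 1"
    and "B \<in> sets borel" and "B \<subseteq> sphere 0 1"
    and "measure circle_measure (top_of_set (sphere 0 1) frontier_of B) = 0"
  shows "((\<lambda>T::real. (\<integral>\<^sup>+t\<in>{0..T}. preimage_count F x t B / ennreal (exp t) \<partial>lborel) / ennreal T)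
           \<longlongrightarrow> ennreal (1 / (LINT z|circle_measure. ln (norm (boundary_deriv F z)))
                        * measure circle_measure B)) at_top"
proof -
  obtain c where c: "0 < c" "c < 1" "connected {z \<in> ball 0 1. norm (F z) < c}"
    using assms(1) by (auto simp: one_component_inner_function_def)
  interpret finite_entropy_one_component F c
    by unfold_locales
      (use assms(1-4) c in \<open>auto simp: one_component_inner_function_def inner_function_def image_subset_iff\<close>)
  show ?thesis
    using averaged_orbit_counting[OF _ assms(6-8), of x] assms(5) by (simp add: entropy_def \<phi>_def)
qed

end
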